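(* Let $K$ be a field, $S=K[t_1,\ldots,t_s]$, and let $I$ be a graded binomial ideal of $S$ such that $V(I,t_i)=\{0\}$ for all $i=1,\ldots,s$. The following conditions are equivalent: (a) $I$ is a lattice ideal; (b) $I=(I:(t_1\cdots t_s)^{\infty})$; (c) $t_i$ is regular modulo $I$ (a non-zero-divisor on $S/I$) for all $i$; (d) $I=(I:t_1)$; (e) $I$ is Cohen-Macaulay; (f) $I$ is unmixed; (g) $I={\rm Hull}(I)$.
   Context: A binomial is a polynomial of the form $t^b-t^c$ with $b,c\in\mathbb{N}^s$, and a binomial ideal is an ideal generated by binomials. Graded means homogeneous with respect to some grading of $S$ with $\deg t_i=d_i$ a positive integer. $V(\cdot)$ is the set of common zeros in affine space $K^s$, and $V(I,t_i)=V((I,t_i))$. For $a\in\mathbb{Z}^s$ write $a=a^+-a^-$ with $a^\pm\in\mathbb{N}^s$ of disjoint support; a lattice ideal is an ideal of the form $I(\mathcal{L})=(t^{a^+}-t^{a^-}\mid a\in\mathcal{L})$ for some subgroup (lattice) $\mathcal{L}\subset\mathbb{Z}^s$. $(I:h)=\{f\in S\mid fh\in I\}$ and $(I:h^\infty)=\bigcup_{k\ge1}(I:h^k)$. $I$ is Cohen-Macaulay means that $S/I$ is a Cohen-Macaulay ring. $I$ is unmixed if all its associated primes have the same height. ${\rm Hull}(I)$ is the intersection of the isolated primary components of $I$ (those belonging to minimal primes of $I$). *)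

theory Defs
  imports
    "HOL-Library.Poly_Mapping"
    "HOL-Library.Extended_Nat"
    "HOL-Algebra.Algebra"
    "HOL-Algebra.Algebraic_Closure_Type"
begin

section \<open>Commutative algebra in an arbitrary commutative ring\<close>

definition colon_ideal :: "('a, 'm) ring_scheme \<Rightarrow> 'a set \<Rightarrow> 'a \<Rightarrow> 'a set" where
  "colon_ideal R I h = {f \<in> carrier R. f \<otimes>\<^bsub>R\<^esub> h \<in> I}"

definition saturation :: "('a, 'm) ring_scheme \<Rightarrow> 'a set \<Rightarrow> 'a \<Rightarrow> 'a set" where
  "saturation R I h = (\<Union>k\<in>{1::nat..}. colon_ideal R I (h [^]\<^bsub>R\<^esub> k))"

definition ideal_radical :: "('a, 'm) ring_scheme \<Rightarrow> 'a set \<Rightarrow> 'a set" where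
  "ideal_radical R I = {x \<in> carrier R. \<exists>n::nat. x [^]\<^bsub>R\<^esub> n \<in> I}"

subsection \<open>Heights, associated primes, unmixedness\<close>

text \<open>The supremum of the lengths of strict chains of prime ideals ending in \<open>P\<close>.\<close>
definition prime_height :: "('a, 'm) ring_scheme \<Rightarrow> 'a set \<Rightarrow> enat" where
  "prime_height R P = Sup {enat n | n. \<exists>p :: nat \<Rightarrow> 'a set.
     (\<forall>i\<le>n. primeideal (p i) R) \<and> (\<forall>i<n. p i \<subset> p (Suc i)) \<and> p n = P}"

text \<open>The prime ideals of \<open>R\<close> that are annihilators of elements of \<open>R/I\<close>: the annihilator
  of the class of \<open>x\<close> is \<open>(I : x)\<close>.\<close>
definition associated_primes :: "('a, 'm) ring_scheme \<Rightarrow> 'a set \<Rightarrow> 'a set set" where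
  "associated_primes R I = {P. primeideal P R \<and> (\<exists>x\<in>carrier R. P = colon_ideal R I x)}"

definition unmixed :: "('a, 'm) ring_scheme \<Rightarrow> 'a set \<Rightarrow> bool" where
  "unmixed R I \<longleftrightarrow>
     (\<forall>P\<in>associated_primes R I. \<forall>Q\<in>associated_primes R I. prime_height R P = prime_height R Q)"

subsection \<open>Primary decomposition and the hull\<close>

definition minimal_primes :: "('a, 'm) ring_scheme \<Rightarrow> 'a set \<Rightarrow> 'a set set" where
  "minimal_primes R I = {P. primeideal P R \<and> I \<subseteq> P \<and>
     (\<forall>P'. primeideal P' R \<longrightarrow> I \<subseteq> P' \<longrightarrow> P' \<subseteq> P \<longrightarrow> P' = P)}"

definition primary_ideal :: "('a, 'm) ring_scheme \<Rightarrow> 'a set \<Rightarrow> bool" where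
  "primary_ideal R Q \<longleftrightarrow> ideal Q R \<and> Q \<noteq> carrier R \<and>
     (\<forall>a\<in>carrier R. \<forall>b\<in>carrier R. a \<otimes>\<^bsub>R\<^esub> b \<in> Q \<longrightarrow> a \<in> Q \<or> (\<exists>n::nat. b [^]\<^bsub>R\<^esub> n \<in> Q))"

text \<open>Irredundant finite primary decompositions with pairwise distinct radicals. The intersection
  is taken inside \<open>carrier R\<close>, so that the empty family decomposes the unit ideal.\<close>
definition primary_decomposition :: "('a, 'm) ring_scheme \<Rightarrow> 'a set \<Rightarrow> 'a set set \<Rightarrow> bool" where
  "primary_decomposition R I D \<longleftrightarrow> finite D \<and> (\<forall>Q\<in>D. primary_ideal R Q) \<and>
     carrier R \<inter> \<Inter>D = I \<and> inj_on (ideal_radical R) D \<and>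
     (\<forall>Q\<in>D. carrier R \<inter> \<Inter>(D - {Q}) \<noteq> I)"

text \<open>The isolated primary components of \<open>I\<close> do not depend on the chosen decomposition
  (second uniqueness theorem), so it is harmless to let \<open>D\<close> range over all of them.\<close>
definition isolated_primary_components :: "('a, 'm) ring_scheme \<Rightarrow> 'a set \<Rightarrow> 'a set set" where
  "isolated_primary_components R I =
     {Q. (\<exists>D. primary_decomposition R I D \<and> Q \<in> D) \<and> ideal_radical R Q \<in> minimal_primes R I}"

definition Hull :: "('a, 'm) ring_scheme \<Rightarrow> 'a set \<Rightarrow> 'a set" where
  "Hull R I = carrier R \<inter> \<Inter>(isolated_primary_components R I)"

subsection \<open>Regular sequences and Cohen-Macaulay rings\<close>

definition non_zero_divisor :: "('a, 'm) ring_scheme \<Rightarrow> 'a \<Rightarrow> bool" where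
  "non_zero_divisor R x \<longleftrightarrow> x \<in> carrier R \<and>
     (\<forall>y\<in>carrier R. x \<otimes>\<^bsub>R\<^esub> y = \<zero>\<^bsub>R\<^esub> \<longrightarrow> y = \<zero>\<^bsub>R\<^esub>)"

definition regular_modulo :: "('a, 'm) ring_scheme \<Rightarrow> 'a set \<Rightarrow> 'a \<Rightarrow> bool" where
  "regular_modulo R I x \<longleftrightarrow> non_zero_divisor (R Quot I) (I +>\<^bsub>R\<^esub> x)"

definition regular_sequence :: "('a, 'm) ring_scheme \<Rightarrow> 'a list \<Rightarrow> bool" where
  "regular_sequence R xs \<longleftrightarrow> set xs \<subseteq> carrier R \<and> Idl\<^bsub>R\<^esub> (set xs) \<noteq> carrier R \<and>
     (\<forall>i<length xs. regular_modulo R (Idl\<^bsub>R\<^esub> (set (take i xs))) (xs ! i))"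

definition ideal_depth :: "('a, 'm) ring_scheme \<Rightarrow> 'a set \<Rightarrow> enat" where
  "ideal_depth R J = Sup {enat (length xs) | xs. regular_sequence R xs \<and> set xs \<subseteq> J}"

text \<open>The definition of Kaplansky (\<^emph>\<open>Commutative Rings\<close>) and Eisenbud
  (\<^emph>\<open>Commutative Algebra\<close>, Section 18.2): depth equals height at every maximal ideal.\<close>
definition Cohen_Macaulay_ring :: "('a, 'm) ring_scheme \<Rightarrow> bool" where
  "Cohen_Macaulay_ring R \<longleftrightarrow> cring R \<and> noetherian_ring R \<and>
     (\<forall>M. maximalideal M R \<longrightarrow> ideal_depth R M = prime_height R M)"


section \<open>Polynomial rings and binomial ideals\<close>

text \<open>The variables are indexed by a finite type \<open>'n\<close>, so \<open>s\<close> is \<open>CARD('n)\<close>; polynomials are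
  finitely supported functions on the exponent vectors \<open>'n \<Rightarrow>\<^sub>0 nat\<close>.\<close>
type_synonym ('n, 'k) mpoly = "('n \<Rightarrow>\<^sub>0 nat) \<Rightarrow>\<^sub>0 'k"

abbreviation mpoly_ring :: "('n::finite, 'k::field) mpoly ring" where
  "mpoly_ring \<equiv> ring_of_type_algebra"

definition monomial :: "('n::finite \<Rightarrow>\<^sub>0 nat) \<Rightarrow> ('n, 'k::field) mpoly" where
  "monomial b = Poly_Mapping.single b 1"

definition tvar :: "'n::finite \<Rightarrow> ('n, 'k::field) mpoly" where
  "tvar i = monomial (Poly_Mapping.single i 1)"

definition poly_eval :: "('n::finite, 'k::field) mpoly \<Rightarrow> ('n \<Rightarrow> 'k) \<Rightarrow> 'k" where
  "poly_eval f x = (\<Sum>m\<in>Poly_Mapping.keys f. Poly_Mapping.lookup f m * (\<Prod>i\<in>UNIV. x i ^ Poly_Mapping.lookup m i))"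

definition zero_set :: "('n::finite, 'k::field) mpoly set \<Rightarrow> ('n \<Rightarrow> 'k) set" where
  "zero_set A = {x. \<forall>f\<in>A. poly_eval f x = 0}"

subsection \<open>Gradings\<close>

definition weighted_degree :: "('n::finite \<Rightarrow> nat) \<Rightarrow> ('n \<Rightarrow>\<^sub>0 nat) \<Rightarrow> nat" where
  "weighted_degree d m = (\<Sum>i\<in>UNIV. d i * Poly_Mapping.lookup m i)"

definition homogeneous :: "('n::finite \<Rightarrow> nat) \<Rightarrow> ('n, 'k::field) mpoly \<Rightarrow> bool" where
  "homogeneous d f \<longleftrightarrow> (\<exists>n. \<forall>m\<in>Poly_Mapping.keys f. weighted_degree d m = n)"

definition graded_ideal :: "('n::finite, 'k::field) mpoly set \<Rightarrow> bool" where
  "graded_ideal I \<longleftrightarrow> (\<exists>d. (\<forall>i. d i > 0) \<and>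
     (\<exists>G. (\<forall>g\<in>G. homogeneous d g) \<and> I = Idl\<^bsub>mpoly_ring\<^esub> G))"

subsection \<open>Binomial ideals and lattice ideals\<close>

definition binomial_ideal :: "('n::finite, 'k::field) mpoly set \<Rightarrow> bool" where
  "binomial_ideal I \<longleftrightarrow>
     (\<exists>B. (\<forall>g\<in>B. \<exists>b c. g = monomial b - monomial c) \<and> I = Idl\<^bsub>mpoly_ring\<^esub> B)"

definition pos_part :: "('n \<Rightarrow>\<^sub>0 int) \<Rightarrow> ('n \<Rightarrow>\<^sub>0 nat)" where
  "pos_part a = Poly_Mapping.map nat a"

definition neg_part :: "('n \<Rightarrow>\<^sub>0 int) \<Rightarrow> ('n \<Rightarrow>\<^sub>0 nat)" where
  "neg_part a = Poly_Mapping.map nat (- a)"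

lemma lookup_pos_part: "Poly_Mapping.lookup (pos_part a) i = nat (Poly_Mapping.lookup a i)"
  by (simp add: pos_part_def Poly_Mapping.map.rep_eq when_def)

lemma lookup_neg_part: "Poly_Mapping.lookup (neg_part a) i = nat (- Poly_Mapping.lookup a i)"
  by (simp add: neg_part_def Poly_Mapping.map.rep_eq when_def)

definition is_lattice :: "('n \<Rightarrow>\<^sub>0 int) set \<Rightarrow> bool" where
  "is_lattice L \<longleftrightarrow> 0 \<in> L \<and> (\<forall>a\<in>L. \<forall>b\<in>L. a + b \<in> L) \<and> (\<forall>a\<in>L. - a \<in> L)"

definition lattice_ideal_of :: "('n::finite \<Rightarrow>\<^sub>0 int) set \<Rightarrow> ('n, 'k::field) mpoly set" where
  "lattice_ideal_of L = Idl\<^bsub>mpoly_ring\<^esub> {monomial (pos_part a) - monomial (neg_part a) | a. a \<in> L}"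

definition lattice_ideal :: "('n::finite, 'k::field) mpoly set \<Rightarrow> bool" where
  "lattice_ideal I \<longleftrightarrow> (\<exists>L. is_lattice L \<and> I = lattice_ideal_of L)"

end

theory Submission
  imports Defs
begin

text \<open>Let \<open>m\<close> be the ideal generated by the variables. A prime \<open>P \<supseteq> I\<close> containing a variable
  \<open>t\<^sub>i\<close> is \<open>m\<close>, because the indicator vector of the variables outside \<open>P\<close> lies in \<open>V(I, t\<^sub>i)\<close> and
  hence vanishes. So all \<open>t\<^sub>j\<close> are nilpotent modulo \<open>(I, t\<^sub>i)\<close>, and a pigeonhole argument on the
  monomials modulo \<open>I\<close> puts into \<open>I\<close>, for all \<open>x \<noteq> y\<close>, a binomial in \<open>t\<^sub>x\<close> and \<open>t\<^sub>y\<close> with two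
  different powers of \<open>t\<^sub>y\<close>. Below a prime \<open>P \<supseteq> I\<close> other than \<open>m\<close> one then finds a chain of primes
  of length \<open>s - 1\<close>, replacing \<open>P\<close> successively by the primes generated by its elements homogeneous
  in \<open>t\<^sub>y\<close>, for all \<open>y \<noteq> x\<close>. As \<open>S\<close> has dimension at most \<open>s\<close>, it follows that \<open>dim S/I = 1\<close> and that
  the associated primes of \<open>I\<close> other than \<open>m\<close>, which are graded and therefore contained in \<open>m\<close>,
  have height \<open>s - 1\<close>. All conditions of the theorem now amount to \<open>m\<close> not being associated to
  \<open>I\<close>. For (a), membership in a lattice ideal means that the coefficients sum to zero over the
  cosets of the lattice, and this is invariant under multiplication by variables.\<close>

section \<open>Primes and colon ideals in Noetherian rings\<close>

text \<open>Write \<open>s\<close> for the number of variables. A prime over \<open>I\<close>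
  strictly inside \<open>irrelevant\<close> is minimal over \<open>I\<close>: three nested primes
  over \<open>I\<close> would extend the \<open>s - 1\<close> steps below the first to a chain of
  \<open>s + 1\<close> steps. Such a prime exists, because every pure binomial vanishes at the
  all-ones point and the graded core of the ideal of that point fits between \<open>I\<close> and
  \<open>irrelevant\<close>. So \<open>irrelevant\<close>, when associated, is embedded, which is
  what unmixedness, the hull and the Cohen-Macaulay property detect. The last one also concerns
  maximal ideals of the quotient that are not graded; there too the graded core supplies a smaller
  prime, so that every maximal ideal has height exactly 1 and a single regular element settles its
  depth.\<close>

locale noetherian_cring = noetherian_ring R + cring R for R (structure)

context ideal
begin

lemma carrier_Quot: "carrier (R Quot I) = (+>) I ` carrier R"
  by (auto simp: FactRing_simps)

lemma rcos_in_carrier_Quot: "x \<in> carrier R \<Longrightarrow> I +> x \<in> carrier (R Quot I)"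
  unfolding carrier_Quot by (rule imageI)

lemma zero_Quot: "\<zero>\<^bsub>R Quot I\<^esub> = I"
  by (simp add: FactRing_def)

lemma mult_Quot:
  "\<lbrakk>x \<in> carrier R; y \<in> carrier R\<rbrakk> \<Longrightarrow> (I +> x) \<otimes>\<^bsub>R Quot I\<^esub> (I +> y) = I +> (x \<otimes> y)"
  by (simp add: FactRing_def rcoset_mult_add)

lemma rcos_eq_ideal_iff: "x \<in> carrier R \<Longrightarrow> I +> x = I \<longleftrightarrow> x \<in> I"
  using a_rcos_zero is_ideal rcos_const_imp_mem by blast

end

lemma (in ring) genideal_empty: "Idl {} = {\<zero>}"
proof
  show "Idl {} \<subseteq> {\<zero>}" by (rule genideal_minimal[OF zeroideal]) simp
  have "ideal (Idl {}) R" by (rule genideal_ideal) simp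
  then show "{\<zero>} \<subseteq> Idl {}" using additive_subgroup.zero_closed ideal.axioms(1) by blast
qed

lemma (in cring) regular_modulo_iff:
  assumes "ideal J R" "x \<in> carrier R"
  shows "regular_modulo R J x \<longleftrightarrow> (\<forall>y\<in>carrier R. y \<otimes> x \<in> J \<longrightarrow> y \<in> J)"
proof -
  interpret J: ideal J R by fact
  show ?thesis
    using assms(2)
    by (auto simp: regular_modulo_def non_zero_divisor_def J.carrier_Quot J.zero_Quot
        J.mult_Quot J.rcos_eq_ideal_iff m_comm)
qed

lemma (in cring) colon_ideal_is_ideal:
  assumes "ideal J R" "h \<in> carrier R"
  shows "ideal (colon_ideal R J h) R"
proof -
  have "colon_ideal R J h = {x \<in> carrier R. h \<otimes> x \<in> J}"
    using assms(2) by (auto simp: colon_ideal_def m_comm)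
  then show ?thesis
    using ideal.helper_max_prime[OF assms(1) is_cring assms(2)] by simp
qed

text \<open>Puts \<open>y \<otimes> x\<close> in competition with \<open>x\<close>, so that a
  maximal colon ideal does not change when \<open>x\<close> is multiplied.\<close>

lemma (in cring) colon_ideal_mult_mono:
  assumes "ideal J R" "x \<in> carrier R" "y \<in> carrier R"
  shows "colon_ideal R J x \<subseteq> colon_ideal R J (y \<otimes> x)"
proof
  fix f assume "f \<in> colon_ideal R J x"
  then have f: "f \<in> carrier R" "f \<otimes> x \<in> J" by (auto simp: colon_ideal_def)
  then have "y \<otimes> (f \<otimes> x) \<in> J"
    using assms by (simp add: ideal.I_l_closed)
  moreover have "f \<otimes> (y \<otimes> x) = y \<otimes> (f \<otimes> x)"
    using assms f by algebra
  ultimately show "f \<in> colon_ideal R J (y \<otimes> x)"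
    using f assms by (simp add: colon_ideal_def)
qed

lemma (in noetherian_ring) exists_maximal_ideal_in:
  assumes "F \<noteq> {}" "\<And>J. J \<in> F \<Longrightarrow> ideal J R"
  shows "\<exists>M\<in>F. \<forall>J\<in>F. M \<subseteq> J \<longrightarrow> J = M"
proof (rule subset_Zorn)
  fix C assume chain: "subset.chain F C"
  show "\<exists>U\<in>F. \<forall>J\<in>C. J \<subseteq> U"
  proof (cases "C = {}")
    case True
    then show ?thesis using assms(1) by auto
  next
    case False
    have "subset.chain {I. ideal I R} C"
      using chain assms(2) by (auto simp: subset.chain_def)
    then have "\<Union>C \<in> C" using ideal_chain_is_trivial False by blast
    then show ?thesis using chain by (auto simp: subset.chain_def)
  qed
qed

corollary (in noetherian_ring) exists_maximal_ideal_image: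
  assumes "A \<noteq> {}" "\<And>y. y \<in> A \<Longrightarrow> ideal (f y) R"
  obtains y where "y \<in> A" "\<And>z. z \<in> A \<Longrightarrow> f y \<subseteq> f z \<Longrightarrow> f z = f y"
proof -
  have "\<exists>M\<in>f ` A. \<forall>J\<in>f ` A. M \<subseteq> J \<longrightarrow> J = M"
    by (rule exists_maximal_ideal_in) (use assms in auto)
  then show ?thesis using that by auto
qed

lemma (in noetherian_ring) noetherian_induct [consumes 1, case_names step]:
  assumes "ideal I R"
    and step: "\<And>I. ideal I R \<Longrightarrow> (\<And>J. ideal J R \<Longrightarrow> I \<subset> J \<Longrightarrow> \<phi> J) \<Longrightarrow> \<phi> I"
  shows "\<phi> I"
proof (rule ccontr)
  assume "\<not> \<phi> I"
  then have "{J. ideal J R \<and> \<not> \<phi> J} \<noteq> {}" using assms(1) by auto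
  then have "\<exists>M\<in>{J. ideal J R \<and> \<not> \<phi> J}. \<forall>J\<in>{J. ideal J R \<and> \<not> \<phi> J}. M \<subseteq> J \<longrightarrow> J = M"
    by (rule exists_maximal_ideal_in) simp
  then obtain M where M: "ideal M R" "\<not> \<phi> M"
    and max: "\<forall>J. ideal J R \<and> \<not> \<phi> J \<longrightarrow> M \<subseteq> J \<longrightarrow> J = M"
    by auto
  have "\<phi> J" if "ideal J R" "M \<subset> J" for J
    using max that by auto
  then show False using step[OF M(1)] M(2) by simp
qed

text \<open>A maximal member among the \<open>(J : x)\<close> with \<open>x\<close> not killed by \<open>W\<close> is prime.\<close>
lemma (in noetherian_cring) exists_prime_colon:
  assumes J: "ideal J R" and W: "W \<subseteq> carrier R" "\<one> \<in> W" "\<And>a b. a \<in> W \<Longrightarrow> b \<in> W \<Longrightarrow> a \<otimes> b \<in> W"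
    and disj: "W \<inter> J = {}"
  obtains x where "x \<in> carrier R" "primeideal (colon_ideal R J x) R" "colon_ideal R J x \<inter> W = {}"
proof -
  interpret J: ideal J R by fact
  let ?X = "{x \<in> carrier R. \<forall>w\<in>W. w \<otimes> x \<notin> J}"
  have "\<one> \<in> ?X"
    using W disj by auto
  then obtain x where x: "x \<in> ?X"
    and max': "\<And>y. y \<in> ?X \<Longrightarrow>
      colon_ideal R J x \<subseteq> colon_ideal R J y \<Longrightarrow> colon_ideal R J y = colon_ideal R J x"
    using exists_maximal_ideal_image[of ?X "colon_ideal R J"] colon_ideal_is_ideal[OF J] by blast
  then have x: "x \<in> carrier R" "\<And>w. w \<in> W \<Longrightarrow> w \<otimes> x \<notin> J" by auto
  have max: "colon_ideal R J y = colon_ideal R J x"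
    if "y \<in> carrier R" "\<And>w. w \<in> W \<Longrightarrow> w \<otimes> y \<notin> J" "colon_ideal R J x \<subseteq> colon_ideal R J y" for y
    using max'[of y] that by simp
  have disj': "colon_ideal R J x \<inter> W = {}"
    using x by (auto simp: colon_ideal_def)
  have "primeideal (colon_ideal R J x) R"
  proof (rule primeidealI[OF colon_ideal_is_ideal[OF J x(1)] is_cring])
    show "carrier R \<noteq> colon_ideal R J x"
      using disj' W by blast
  next
    fix a b
    assume ab: "a \<in> carrier R" "b \<in> carrier R" "a \<otimes> b \<in> colon_ideal R J x"
    then have abx: "a \<otimes> b \<otimes> x \<in> J" by (simp add: colon_ideal_def)
    show "a \<in> colon_ideal R J x \<or> b \<in> colon_ideal R J x"
    \<comment> \<open>If no \<open>w\<close> sends \<open>a \<otimes> x\<close> into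
      \<open>J\<close>, this element competes with \<open>x\<close> and maximality gives
      \<open>b\<close>; otherwise \<open>w \<otimes> x\<close> competes and gives
      \<open>a\<close>.\<close>
    proof (cases "\<exists>w\<in>W. w \<otimes> (a \<otimes> x) \<in> J")
      case False
      then have "colon_ideal R J (a \<otimes> x) = colon_ideal R J x"
        using ab x by (intro max colon_ideal_mult_mono J) auto
      moreover have "b \<otimes> (a \<otimes> x) = a \<otimes> b \<otimes> x" using ab x by algebra
      then have "b \<in> colon_ideal R J (a \<otimes> x)" using ab abx by (simp add: colon_ideal_def)
      ultimately show ?thesis by simp
    next
      case True
      then obtain w where w: "w \<in> W" "w \<otimes> (a \<otimes> x) \<in> J" by blast
      then have wc: "w \<in> carrier R" using W by auto
      have "v \<otimes> (w \<otimes> x) \<notin> J" if "v \<in> W" for v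
      proof -
        have "v \<otimes> (w \<otimes> x) = (v \<otimes> w) \<otimes> x" using that W wc x by (auto simp: m_assoc)
        then show ?thesis using x(2)[OF W(3)[OF that w(1)]] by simp
      qed
      then have "colon_ideal R J (w \<otimes> x) = colon_ideal R J x"
        using wc x by (intro max colon_ideal_mult_mono J) auto
      moreover have "a \<otimes> (w \<otimes> x) = w \<otimes> (a \<otimes> x)" using ab x wc by algebra
      then have "a \<in> colon_ideal R J (w \<otimes> x)" using ab w by (simp add: colon_ideal_def)
      ultimately show ?thesis by simp
    qed
  qed
  then show ?thesis using that x disj' by blast
qed

text \<open>Taking the complement of \<open>P\<close> for \<open>W\<close> shows that every prime
  over \<open>J\<close> contains an associated prime of \<open>J\<close>.\<close>

corollary (in noetherian_cring) exists_prime_colon_below: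
  assumes "ideal J R" "primeideal P R" "J \<subseteq> P"
  obtains x where "x \<in> carrier R" "primeideal (colon_ideal R J x) R" "colon_ideal R J x \<subseteq> P"
proof -
  interpret P: primeideal P R by fact
  have "\<one> \<notin> P" using P.one_imp_carrier P.I_notcarr by auto
  then have one: "\<one> \<in> carrier R - P" by simp
  have mult: "\<And>a b. a \<in> carrier R - P \<Longrightarrow> b \<in> carrier R - P \<Longrightarrow> a \<otimes> b \<in> carrier R - P"
    using P.I_prime by fast
  have "(carrier R - P) \<inter> J = {}" using assms(3) by auto
  from exists_prime_colon[OF assms(1) Diff_subset one mult this]
  obtain x where x: "x \<in> carrier R" "primeideal (colon_ideal R J x) R"
    "colon_ideal R J x \<inter> (carrier R - P) = {}" by blast
  then have "colon_ideal R J x \<subseteq> P" by (auto simp: colon_ideal_def)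
  then show ?thesis using that x by blast
qed

lemma (in cring) ideal_subset_colon:
  assumes "ideal J R" "x \<in> carrier R"
  shows "J \<subseteq> colon_ideal R J x"
  using assms by (auto simp: colon_ideal_def ideal.Icarr ideal.I_r_closed)

lemma (in cring) primeideal_not_one: "primeideal P R \<Longrightarrow> \<one> \<notin> P"
  using ideal.one_imp_carrier[of P R] primeideal.axioms(1)[of P R] primeideal.I_notcarr[of P R] by auto

lemma (in cring) prime_colon_not_mem:
  assumes "primeideal (colon_ideal R J x) R" "x \<in> carrier R"
  shows "x \<notin> J"
  using primeideal_not_one[OF assms(1)] assms(2) by (auto simp: colon_ideal_def)

lemma (in cring) primeideal_pow:
  assumes "primeideal P R" "a \<in> carrier R" "a [^] (n::nat) \<in> P"
  shows "a \<in> P"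
  using assms(3)
proof (induction n)
  case 0
  then show ?case using primeideal_not_one[OF assms(1)] by simp
next
  case (Suc n)
  then show ?case using primeideal.I_prime[OF assms(1), of "a [^] n" a] assms(2) by auto
qed

subsection \<open>Chains of primes\<close>

text \<open>The clause of \<open>prime_height\<close> with the length as a parameter, so that chains
  can be extended one prime at a time. The number \<open>n\<close> counts inclusions, not
  primes.\<close>

definition prime_chain :: "('a, 'm) ring_scheme \<Rightarrow> nat \<Rightarrow> 'a set \<Rightarrow> bool" where
  "prime_chain R n P \<longleftrightarrow> (\<exists>p :: nat \<Rightarrow> 'a set.
     (\<forall>i\<le>n. primeideal (p i) R) \<and> (\<forall>i<n. p i \<subset> p (Suc i)) \<and> p n = P)"

lemma prime_height_eq_Sup: "prime_height R P = Sup {enat n | n. prime_chain R n P}"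
  by (simp add: prime_height_def prime_chain_def)

lemma prime_chain_0: "primeideal P R \<Longrightarrow> prime_chain R 0 P"
  by (auto simp: prime_chain_def)

lemma prime_chain_SucI:
  assumes "prime_chain R n Q" "Q \<subset> P" "primeideal P R"
  shows "prime_chain R (Suc n) P"
proof -
  obtain p where p: "\<And>i. i \<le> n \<Longrightarrow> primeideal (p i) R" "\<And>i. i < n \<Longrightarrow> p i \<subset> p (Suc i)" "p n = Q"
    using assms(1) by (auto simp: prime_chain_def)
  show ?thesis
    unfolding prime_chain_def
    by (rule exI[of _ "p(Suc n := P)"]) (use p assms in \<open>auto simp: less_Suc_eq le_Suc_eq\<close>)
qed

lemma prime_chain_le_height: "prime_chain R n P \<Longrightarrow> enat n \<le> prime_height R P"
  unfolding prime_height_eq_Sup by (rule Sup_upper) auto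

lemma prime_height_le: "(\<And>n. prime_chain R n P \<Longrightarrow> n \<le> m) \<Longrightarrow> prime_height R P \<le> enat m"
  unfolding prime_height_eq_Sup by (rule Sup_least) auto

text \<open>Every chain ending in \<open>Q\<close> extends by \<open>P\<close>. The bound
  \<open>m\<close> makes the height of \<open>P\<close> finite; for infinite heights the inequality
  could fail to be strict.\<close>

lemma prime_height_strict_mono:
  assumes "prime_height R P \<le> enat m" "Q \<subset> P" "primeideal Q R" "primeideal P R"
  shows "prime_height R Q < prime_height R P"
proof -
  obtain h where h: "prime_height R P = enat h"
    using assms(1) by (cases "prime_height R P") auto
  have "Suc n \<le> h" if "prime_chain R n Q" for n
    using prime_chain_le_height[OF prime_chain_SucI[OF that assms(2,4)]] h by simp
  \<comment> \<open>The chain of length 0 at \<open>Q\<close> forces \<open>h \<ge> 1\<close>, so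
    \<open>h - 1\<close> is not truncated.\<close>
  from this[OF prime_chain_0[OF assms(3)]] this have "prime_height R Q \<le> enat (h - 1)" "h \<ge> 1"
    by (force intro!: prime_height_le)+
  then show ?thesis using h by (cases "prime_height R Q") auto
qed

text \<open>A regular element modulo \<open>J\<close> lies in no prime of the form
  \<open>(J : x)\<close>. So an associated prime of the ideal of the first \<open>i\<close> entries,
  chosen inside \<open>P\<close>, misses \<open>xs ! i\<close> and is strictly smaller than
  \<open>P\<close>; the induction continues with it.\<close>

lemma (in noetherian_cring) prime_chain_of_regular_sequence:
  assumes "regular_sequence R xs" "i \<le> length xs" "primeideal P R" "set (take i xs) \<subseteq> P"
  shows "prime_chain R i P"
  using assms(2-4)
proof (induction i arbitrary: P)
  case 0
  then show ?case by (simp add: prime_chain_0)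
next
  case (Suc i)
  have xs: "set xs \<subseteq> carrier R" using assms(1) by (simp add: regular_sequence_def)
  define J where "J = Idl (set (take i xs))"
  have sub: "set (take i xs) \<subseteq> carrier R" using xs set_take_subset by fast
  have J: "ideal J R" unfolding J_def by (rule genideal_ideal[OF sub])
  have tk: "take (Suc i) xs = take i xs @ [xs ! i]"
    using Suc.prems by (simp add: take_Suc_conv_app_nth)
  have xi: "xs ! i \<in> carrier R" "xs ! i \<in> P" using Suc.prems xs tk by auto
  have "J \<subseteq> P" unfolding J_def
    by (rule genideal_minimal) (use Suc.prems tk in \<open>auto simp: primeideal_def\<close>)
  then obtain x where x: "x \<in> carrier R" and Q: "primeideal (colon_ideal R J x) R" "colon_ideal R J x \<subseteq> P"
    using exists_prime_colon_below[OF J Suc.prems(2)] by blast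
  have "regular_modulo R J (xs ! i)"
    using assms(1) Suc.prems by (auto simp: regular_sequence_def J_def)
  then have "xs ! i \<notin> colon_ideal R J x"
    using regular_modulo_iff[OF J xi(1)] x xi prime_colon_not_mem[OF Q(1) x]
    by (auto simp: colon_ideal_def m_comm)
  then have "colon_ideal R J x \<subset> P" using Q xi by blast
  moreover have "set (take i xs) \<subseteq> colon_ideal R J x"
    using ideal_subset_colon[OF J x] genideal_self[OF sub] by (auto simp: J_def)
  then have "prime_chain R i (colon_ideal R J x)"
    using Suc.IH Q Suc.prems by auto
  ultimately show ?case using Suc.prems prime_chain_SucI by blast
qed

corollary (in noetherian_cring) ideal_depth_le_height:
  assumes "primeideal P R"
  shows "ideal_depth R P \<le> prime_height R P"
  unfolding ideal_depth_def
proof (rule Sup_least)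
  fix d assume "d \<in> {enat (length xs) |xs. regular_sequence R xs \<and> set xs \<subseteq> P}"
  then obtain xs where "d = enat (length xs)" "regular_sequence R xs" "set xs \<subseteq> P" by auto
  then show "d \<le> prime_height R P"
    using prime_chain_of_regular_sequence[of xs "length xs" P] assms prime_chain_le_height by auto
qed

subsection \<open>Prime avoidance\<close>

lemma (in cring) exists_in_all_not_in_prime:
  assumes "finite F" "primeideal P R" "ideal J R" "\<not> J \<subseteq> P"
    and "\<And>Q. Q \<in> F \<Longrightarrow> ideal Q R \<and> \<not> Q \<subseteq> P"
  shows "\<exists>z\<in>J. z \<notin> P \<and> (\<forall>Q\<in>F. z \<in> Q)"
  using assms(1,5)
proof (induction F)
  case empty
  then show ?case using assms by auto
next
  case (insert Q F)
  then obtain z where z: "z \<in> J" "z \<notin> P" "\<And>Q. Q \<in> F \<Longrightarrow> z \<in> Q" by auto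
  obtain q where q: "q \<in> Q" "q \<notin> P" using insert.prems by auto
  have c: "q \<in> carrier R" "z \<in> carrier R"
    using ideal.Icarr[of Q R q] ideal.Icarr[OF assms(3) z(1)] insert.prems[of Q] q by auto
  have "z \<otimes> q \<notin> P" using primeideal.I_prime[OF assms(2)] c z(2) q(2) by auto
  moreover have "z \<otimes> q \<in> J" using z c assms(3) by (simp add: ideal.I_r_closed)
  moreover have "\<forall>Q'\<in>insert Q F. z \<otimes> q \<in> Q'"
    using z c q insert.prems by (auto simp: ideal.I_r_closed ideal.I_l_closed)
  ultimately show ?case by blast
qed

text \<open>If the element \<open>x\<close> that avoids \<open>F\<close> lies in the new prime
  \<open>P\<close>, add to it an element of \<open>J\<close> that lies in all of \<open>F\<close>
  but not in \<open>P\<close>. Incomparability of the primes makes such an element exist.\<close>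

lemma (in cring) prime_avoidance:
  assumes "finite F" "\<And>P. P \<in> F \<Longrightarrow> primeideal P R" "ideal J R" "\<And>P. P \<in> F \<Longrightarrow> \<not> J \<subseteq> P"
    and "\<And>P Q. P \<in> F \<Longrightarrow> Q \<in> F \<Longrightarrow> P \<subseteq> Q \<Longrightarrow> P = Q"
  shows "\<exists>x\<in>J. \<forall>P\<in>F. x \<notin> P"
  using assms(1,2,4,5)
proof (induction F)
  case empty
  then show ?case using assms(3) additive_subgroup.zero_closed ideal.axioms(1) by blast
next
  case (insert P F)
  then obtain x where x: "x \<in> J" "\<And>P. P \<in> F \<Longrightarrow> x \<notin> P" by auto
  show ?case
  proof (cases "x \<in> P")
    case False
    then show ?thesis using x by auto
  next
    case True
    have "\<exists>z\<in>J. z \<notin> P \<and> (\<forall>Q\<in>F. z \<in> Q)"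
    proof (rule exists_in_all_not_in_prime)
      fix Q assume Q: "Q \<in> F"
      then have "Q \<noteq> P" using insert.hyps by auto
      then show "ideal Q R \<and> \<not> Q \<subseteq> P"
        using primeideal.axioms(1)[OF insert.prems(1)[of Q]] insert.prems(3)[of Q P] Q by blast
    qed (use insert assms in auto)
    then obtain z where z: "z \<in> J" "z \<notin> P" "\<And>Q. Q \<in> F \<Longrightarrow> z \<in> Q" by auto
    have sub: "a \<in> Q" if "primeideal Q R" "a \<oplus> b \<in> Q" "b \<in> Q" "a \<in> J" for a b Q
    proof -
      interpret Q: primeideal Q R by fact
      have "a \<in> carrier R" "b \<in> carrier R" using that assms(3) ideal.Icarr by auto
      then have "(a \<oplus> b) \<ominus> b = a" by algebra
      then show ?thesis
        using Q.a_closed[OF that(2) Q.a_inv_closed[OF that(3)]] unfolding a_minus_def by metis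
    qed
    have c: "x \<in> carrier R" "z \<in> carrier R"
      using ideal.Icarr[OF assms(3) x(1)] ideal.Icarr[OF assms(3) z(1)] by auto
    have "x \<oplus> z \<in> J" using x z assms(3) by (simp add: additive_subgroup.a_closed ideal.axioms(1))
    moreover have "x \<oplus> z \<notin> P" using sub[of P z x] insert.prems(1) z True c by (auto simp: a_comm)
    moreover have "x \<oplus> z \<notin> Q" if "Q \<in> F" for Q
      using sub[of Q x z] insert.prems(1) z x that by auto
    ultimately show ?thesis by auto
  qed
qed

subsection \<open>Primary decomposition\<close>

lemma (in cring) mem_add_PIdl_iff:
  "y \<in> I <+>\<^bsub>R\<^esub> PIdl a \<longleftrightarrow> (\<exists>i\<in>I. \<exists>r\<in>carrier R. y = i \<oplus> r \<otimes> a)"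
  unfolding set_add_def' cgenideal_def by auto

text \<open>If \<open>a \<otimes> b\<close> shows that \<open>I\<close> is not primary and the
  ideals \<open>(I : b^n)\<close> stop growing at \<open>n\<close>, then \<open>I\<close> is the
  intersection of the strictly larger ideals \<open>I + (a)\<close> and \<open>I + (b^n)\<close>, to
  which Noetherian induction applies.\<close>

lemma (in noetherian_cring) exists_primary_intersection:
  assumes "ideal I R"
  shows "\<exists>D. finite D \<and> (\<forall>Q\<in>D. primary_ideal R Q) \<and> carrier R \<inter> \<Inter>D = I"
  using assms
proof (induction I rule: noetherian_induct)
  case (step I)
  interpret I: ideal I R by fact
  consider "I = carrier R" | "primary_ideal R I" |
    a b where "a \<in> carrier R" "b \<in> carrier R" "a \<otimes> b \<in> I" "a \<notin> I" "\<And>n::nat. b [^] n \<notin> I"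
    using step(1) by (auto simp: primary_ideal_def)
  then show ?case
  proof cases
    case 1
    then show ?thesis by (intro exI[of _ "{}"]) auto
  next
    case 2
    then show ?thesis using I.a_subset by (intro exI[of _ "{I}"]) auto
  next
    case 3
    obtain n :: nat
      where max: "\<And>k::nat. colon_ideal R I (b [^] n) \<subseteq> colon_ideal R I (b [^] k) \<Longrightarrow>
        colon_ideal R I (b [^] k) = colon_ideal R I (b [^] n)"
      using exists_maximal_ideal_image[of "UNIV :: nat set" "\<lambda>n. colon_ideal R I (b [^] n)"]
        colon_ideal_is_ideal[OF step(1)] 3(2) by auto
    have bn: "b [^] n \<in> carrier R" using 3 by simp
    have stab: "colon_ideal R I (b [^] Suc n) = colon_ideal R I (b [^] n)"
      using colon_ideal_mult_mono[OF step(1) bn 3(2)] 3 by (intro max) (simp add: m_comm)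
    have bigger: "ideal (I <+>\<^bsub>R\<^esub> PIdl c) R" "I \<subset> I <+>\<^bsub>R\<^esub> PIdl c" if "c \<in> carrier R" "c \<notin> I" for c
    proof -
      show "ideal (I <+>\<^bsub>R\<^esub> PIdl c) R" using add_ideals[OF step(1) cgenideal_ideal[OF that(1)]] .
      have "c \<in> I <+>\<^bsub>R\<^esub> PIdl c" unfolding mem_add_PIdl_iff
        by (rule bexI[of _ \<zero>], rule bexI[of _ \<one>]) (use that in auto)
      moreover have "I \<subseteq> I <+>\<^bsub>R\<^esub> PIdl c"
      proof
        fix y assume "y \<in> I"
        then show "y \<in> I <+>\<^bsub>R\<^esub> PIdl c" unfolding mem_add_PIdl_iff
          by (intro bexI[of _ y] bexI[of _ \<zero>]) (use that I.Icarr in auto)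
      qed
      ultimately show "I \<subset> I <+>\<^bsub>R\<^esub> PIdl c" using that by auto
    qed
    obtain D1 where D1: "finite D1" "\<forall>Q\<in>D1. primary_ideal R Q" "carrier R \<inter> \<Inter>D1 = I <+>\<^bsub>R\<^esub> PIdl a"
      using step(2)[OF bigger[OF 3(1,4)]] by auto
    obtain D2 where D2: "finite D2" "\<forall>Q\<in>D2. primary_ideal R Q" "carrier R \<inter> \<Inter>D2 = I <+>\<^bsub>R\<^esub> PIdl (b [^] n)"
      using step(2)[OF bigger[OF bn 3(5)]] by auto
    have "y \<in> I" if y1: "y \<in> I <+>\<^bsub>R\<^esub> PIdl a" and y2: "y \<in> I <+>\<^bsub>R\<^esub> PIdl (b [^] n)" for y
    proof -
      obtain i r where ir: "i \<in> I" "r \<in> carrier R" "y = i \<oplus> r \<otimes> a"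
        using y1 mem_add_PIdl_iff by auto
      obtain j s where js: "j \<in> I" "s \<in> carrier R" "y = j \<oplus> s \<otimes> b [^] n"
        using y2 mem_add_PIdl_iff by auto
      have c: "i \<in> carrier R" "j \<in> carrier R" using ir js I.Icarr by auto
      \<comment> \<open>Multiplication by \<open>b\<close> sends the \<open>a\<close>-part into
        \<open>I\<close>, so \<open>s\<close> lies in \<open>(I : b^(n+1))\<close>, which equals
        \<open>(I : b^n)\<close>.\<close>
      have "y \<otimes> b = i \<otimes> b \<oplus> r \<otimes> (a \<otimes> b)" unfolding ir(3) using ir(2) c 3 by algebra
      then have yb: "y \<otimes> b \<in> I" using ir 3 by (simp add: I.I_r_closed I.I_l_closed)
      have "s \<otimes> (b [^] n \<otimes> b) = y \<otimes> b \<ominus> j \<otimes> b" unfolding js(3) using js(2) c bn 3(2) by algebra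
      also have "\<dots> \<in> I" using yb js 3 by (simp add: a_minus_def I.I_r_closed)
      finally have "s \<in> colon_ideal R I (b [^] Suc n)" using js by (simp add: colon_ideal_def)
      then have "s \<otimes> b [^] n \<in> I" using stab by (auto simp: colon_ideal_def)
      then show ?thesis using js by simp
    qed
    then have "carrier R \<inter> \<Inter>(D1 \<union> D2) = I"
      using D1(3) D2(3) bigger(2)[OF 3(1,4)] bigger(2)[OF bn 3(5)] by blast
    then show ?thesis using D1 D2 by (intro exI[of _ "D1 \<union> D2"]) auto
  qed
qed

lemma (in cring) pow_mem_ideal_mono:
  assumes "ideal Q R" "x \<in> carrier R" "x [^] (n::nat) \<in> Q"
  shows "x [^] (n + k) \<in> Q"
  using assms by (simp add: nat_pow_mult[symmetric] ideal.I_r_closed)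

text \<open>With equal radicals, an element that has a power in one ideal has a power in the other,
  and the sum of the two exponents works for both.\<close>

lemma (in cring) primary_Int:
  assumes Q: "primary_ideal R Q\<^sub>1" "primary_ideal R Q\<^sub>2" and rad: "ideal_radical R Q\<^sub>1 = ideal_radical R Q\<^sub>2"
  shows "primary_ideal R (Q\<^sub>1 \<inter> Q\<^sub>2)"
proof -
  have ideals: "ideal Q\<^sub>1 R" "ideal Q\<^sub>2 R" using Q by (auto simp: primary_ideal_def)
  have *: "\<exists>n::nat. b [^] n \<in> Q\<^sub>1 \<inter> Q\<^sub>2" if b: "b \<in> ideal_radical R Q\<^sub>1" for b
  proof -
    obtain n m :: nat where "b \<in> carrier R" "b [^] n \<in> Q\<^sub>1" "b [^] m \<in> Q\<^sub>2"
      using b b[unfolded rad] unfolding ideal_radical_def by blast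
    then have "b [^] (n + m) \<in> Q\<^sub>1" "b [^] (m + n) \<in> Q\<^sub>2"
      using ideals by (auto intro: pow_mem_ideal_mono)
    then show ?thesis by (auto simp: add.commute)
  qed
  show ?thesis
    unfolding primary_ideal_def
  proof (intro conjI ballI impI)
    show "ideal (Q\<^sub>1 \<inter> Q\<^sub>2) R" using ideals by (rule i_intersect)
    show "Q\<^sub>1 \<inter> Q\<^sub>2 \<noteq> carrier R" using Q ideals
      by (metis additive_subgroup.a_subset ideal.axioms(1) inf_le1 primary_ideal_def subset_antisym)
  next
    fix a b assume ab: "a \<in> carrier R" "b \<in> carrier R" "a \<otimes> b \<in> Q\<^sub>1 \<inter> Q\<^sub>2"
    then have "a \<in> Q\<^sub>1 \<and> a \<in> Q\<^sub>2 \<or> b \<in> ideal_radical R Q\<^sub>1 \<or> b \<in> ideal_radical R Q\<^sub>2"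
      using Q by (auto simp: primary_ideal_def ideal_radical_def)
    then show "a \<in> Q\<^sub>1 \<inter> Q\<^sub>2 \<or> (\<exists>n::nat. b [^] n \<in> Q\<^sub>1 \<inter> Q\<^sub>2)"
      using * rad by auto
  qed
qed

text \<open>A family of least cardinality is automatically irredundant and has distinct radicals.\<close>
theorem (in noetherian_cring) exists_primary_decomposition:
  assumes "ideal I R"
  shows "\<exists>D. primary_decomposition R I D"
proof -
  let ?ok = "\<lambda>D. finite D \<and> (\<forall>Q\<in>D. primary_ideal R Q) \<and> carrier R \<inter> \<Inter>D = I"
  obtain D where D: "?ok D" and least: "\<And>E. ?ok E \<Longrightarrow> card D \<le> card E"
    using exists_primary_intersection[OF assms] ex_has_least_nat[of ?ok _ card] by metis
  have "carrier R \<inter> \<Inter>(D - {Q}) \<noteq> I" if "Q \<in> D" for Q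
  proof
    assume "carrier R \<inter> \<Inter>(D - {Q}) = I"
    then have "card D \<le> card (D - {Q})" using D by (intro least) auto
    then show False using D that by (meson card_Diff1_less not_le)
  qed
  moreover have "inj_on (ideal_radical R) D"
  proof (rule inj_onI, rule ccontr)
    fix P Q assume PQ: "P \<in> D" "Q \<in> D" "ideal_radical R P = ideal_radical R Q" "P \<noteq> Q"
    \<comment> \<open>Merging two components with the same radical gives a smaller family.\<close>
    let ?E = "insert (P \<inter> Q) (D - {P, Q})"
    have "\<Inter>?E = \<Inter>D" using PQ by auto
    then have "?ok ?E" using D PQ primary_Int[of P Q] by auto
    then have "card D \<le> card ?E" by (rule least)
    also have "\<dots> \<le> Suc (card (D - {P, Q}))" by (rule card_insert_le_m1) auto
    also have "card (D - {P, Q}) = card D - 2"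
      using PQ D by (subst card_Diff_subset) auto
    also have "2 \<le> card D" using PQ D card_mono[of D "{P, Q}"] by auto
    then have "Suc (card D - 2) < card D" by linarith
    finally show False by simp
  qed
  ultimately show ?thesis using D by (auto simp: primary_decomposition_def)
qed

text \<open>Among the \<open>y\<close> in all other components but outside \<open>Q\<close>, take
  one with \<open>(Q : y)\<close> maximal. For such \<open>y\<close>,
  \<open>(Q : y) = (I : y)\<close>; primariness puts this into the radical of \<open>Q\<close>, and
  maximality gives the reverse inclusion.\<close>

lemma (in noetherian_cring) radical_component_associated:
  assumes D: "primary_decomposition R I D" and Q: "Q \<in> D" and I: "ideal I R"
  shows "ideal_radical R Q \<in> associated_primes R I"
proof -
  have prim: "primary_ideal R Q" using D Q by (auto simp: primary_decomposition_def)
  then have Qi: "ideal Q R" by (simp add: primary_ideal_def)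
  define A where "A = carrier R \<inter> \<Inter>(D - {Q})"
  have AI: "A \<inter> Q = I" using D Q Qi unfolding A_def primary_decomposition_def by auto
  have mult: "a \<otimes> y \<in> A" if "a \<in> carrier R" "y \<in> A" for a y
    using that D by (auto simp: A_def primary_decomposition_def primary_ideal_def ideal.I_l_closed)
  have "A \<noteq> I" using D Q by (auto simp: A_def primary_decomposition_def)
  then have ne: "A - Q \<noteq> {}" using AI by auto
  obtain y where y: "y \<in> A - Q"
    and max: "\<And>z. z \<in> A - Q \<Longrightarrow> colon_ideal R Q y \<subseteq> colon_ideal R Q z \<Longrightarrow> colon_ideal R Q z = colon_ideal R Q y"
    by (rule exists_maximal_ideal_image[OF ne, of "colon_ideal R Q"])
      (auto simp: A_def colon_ideal_is_ideal[OF Qi])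
  then have y: "y \<in> A" "y \<notin> Q" by auto
  have yc: "y \<in> carrier R" using y by (auto simp: A_def)
  have "ideal_radical R Q = colon_ideal R Q y"
  proof (intro equalityI subsetI)
    fix a assume "a \<in> colon_ideal R Q y"
    then show "a \<in> ideal_radical R Q"
      using prim y yc unfolding colon_ideal_def ideal_radical_def primary_ideal_def
      by (metis (mono_tags, lifting) m_comm mem_Collect_eq)
  next
    fix a assume "a \<in> ideal_radical R Q"
    then obtain n :: nat where a: "a \<in> carrier R" "a [^] n \<in> Q" by (auto simp: ideal_radical_def)
    let ?P = "\<lambda>k::nat. a [^] k \<otimes> y \<in> Q"
    have "?P n" using a yc Qi by (simp add: ideal.I_r_closed)
    \<comment> \<open>The product with the exponent just below the least \<open>k\<close> is still
      outside \<open>Q\<close> and competes with \<open>y\<close>, and its colon ideal contains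
      \<open>a\<close>.\<close>
    define k where "k = (LEAST k. ?P k)"
    have k: "?P k" unfolding k_def using \<open>?P n\<close> by (rule LeastI)
    have "k \<noteq> 0" using k y yc by (intro notI) simp
    then obtain j where j: "k = Suc j" by (cases k) auto
    then have nj: "\<not> ?P j" unfolding k_def by (metis lessI not_less_Least)
    have "colon_ideal R Q (a [^] j \<otimes> y) = colon_ideal R Q y"
      using mult nj a y yc colon_ideal_mult_mono[OF Qi yc] by (intro max) auto
    moreover have "a \<otimes> (a [^] j \<otimes> y) = a [^] k \<otimes> y"
      using a yc by (simp add: j m_assoc[symmetric] m_comm)
    then have "a \<in> colon_ideal R Q (a [^] j \<otimes> y)" using k a by (simp add: colon_ideal_def)
    ultimately show "a \<in> colon_ideal R Q y" by simp
  qed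
  moreover have "colon_ideal R Q y = colon_ideal R I y"
    using AI mult y by (auto simp: colon_ideal_def)
  moreover have "primeideal (ideal_radical R Q) R"
    unfolding \<open>ideal_radical R Q = colon_ideal R Q y\<close>
  proof (rule primeidealI[OF colon_ideal_is_ideal[OF Qi yc] is_cring])
    have "\<one> \<notin> colon_ideal R Q y" using y yc by (simp add: colon_ideal_def)
    then show "carrier R \<noteq> colon_ideal R Q y" by blast
  next
    fix a b assume ab: "a \<in> carrier R" "b \<in> carrier R" "a \<otimes> b \<in> colon_ideal R Q y"
    then have "a \<otimes> b \<in> ideal_radical R Q"
      unfolding \<open>ideal_radical R Q = colon_ideal R Q y\<close> by blast
    then obtain n :: nat where "a [^] n \<otimes> b [^] n \<in> Q"
      using ab(1,2) by (auto simp: ideal_radical_def nat_pow_distrib)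
    then have "a [^] n \<in> Q \<or> (\<exists>m::nat. b [^] (n * m) \<in> Q)"
      using prim ab(1,2) unfolding primary_ideal_def
      by (metis nat_pow_closed nat_pow_pow)
    then have "a \<in> ideal_radical R Q \<or> b \<in> ideal_radical R Q"
      using ab(1,2) unfolding ideal_radical_def by blast
    then show "a \<in> colon_ideal R Q y \<or> b \<in> colon_ideal R Q y"
      unfolding \<open>ideal_radical R Q = colon_ideal R Q y\<close> .
  qed
  ultimately show ?thesis using yc by (auto simp: associated_primes_def)
qed

subsection \<open>Quotient rings\<close>

context cring
begin

lemma primeideal_Quot_vimage:
  assumes I: "ideal I R" and P: "primeideal P (R Quot I)"
  shows "primeideal {x \<in> carrier R. I +> x \<in> P} R"
proof -
  interpret I: ideal I R by fact
  interpret P: primeideal P "R Quot I" by fact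
  interpret h: ring_hom_ring R "R Quot I" "(+>) I" by (rule I.rcos_ring_hom_ring)
  show ?thesis
  proof (rule primeidealI[OF h.ideal_vimage[OF P.is_ideal] is_cring])
    show "carrier R \<noteq> {x \<in> carrier R. I +> x \<in> P}"
      using P.I_notcarr P.a_subset by (auto simp: I.carrier_Quot)
  next
    fix a b assume ab: "a \<in> carrier R" "b \<in> carrier R" "a \<otimes> b \<in> {x \<in> carrier R. I +> x \<in> P}"
    then have "(I +> a) \<otimes>\<^bsub>R Quot I\<^esub> (I +> b) \<in> P"
      unfolding I.mult_Quot[OF ab(1,2)] by blast
    then have "I +> a \<in> P \<or> I +> b \<in> P"
      by (rule P.I_prime[OF I.rcos_in_carrier_Quot[OF ab(1)] I.rcos_in_carrier_Quot[OF ab(2)]])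
    then show "a \<in> {x \<in> carrier R. I +> x \<in> P} \<or> b \<in> {x \<in> carrier R. I +> x \<in> P}"
      using ab(1,2) by blast
  qed
qed

lemma ideal_subset_Quot_vimage:
  assumes I: "ideal I R" and P: "ideal P (R Quot I)"
  shows "I \<subseteq> {x \<in> carrier R. I +> x \<in> P}"
proof -
  interpret I: ideal I R by fact
  show ?thesis
  proof
    fix x assume "x \<in> I"
    moreover have "I \<in> P"
      using additive_subgroup.zero_closed[OF ideal.axioms(1)[OF P]] unfolding I.zero_Quot .
    ultimately show "x \<in> {x \<in> carrier R. I +> x \<in> P}"
      using I.rcos_eq_ideal_iff[of x] I.Icarr[of x] by auto
  qed
qed

lemma rcos_mem_image_iff:
  assumes I: "ideal I R" and J: "ideal J R" "I \<subseteq> J" "x \<in> carrier R"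
  shows "I +> x \<in> (+>) I ` J \<longleftrightarrow> x \<in> J"
proof
  interpret J: ideal J R by fact
  assume "I +> x \<in> (+>) I ` J"
  then obtain y where y: "y \<in> J" "I +> x = I +> y" by auto
  then have "x \<ominus> y \<in> J" using quotient_eq_iff_same_a_r_cos[OF I, of x y] J by auto
  then have "(x \<ominus> y) \<oplus> y \<in> J" using y by simp
  moreover have "(x \<ominus> y) \<oplus> y = x" using J(3) J.Icarr[OF y(1)] by algebra
  ultimately show "x \<in> J" by simp
qed auto

lemma primeideal_Quot_image:
  assumes I: "ideal I R" and P: "primeideal P R" "I \<subseteq> P"
  shows "primeideal ((+>) I ` P) (R Quot I)"
proof -
  interpret I: ideal I R by fact
  interpret P: primeideal P R by fact
  note iff = rcos_mem_image_iff[OF I P.is_ideal P(2)]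
  show ?thesis
  proof (rule primeidealI[OF ring_ideal_imp_quot_ideal[OF I P.is_ideal] I.quotient_is_cring[OF is_cring]])
    show "carrier (R Quot I) \<noteq> (+>) I ` P"
      using iff[of \<one>] primeideal_not_one[OF P(1)] by (auto simp: I.carrier_Quot)
  next
    fix x y
    assume "x \<in> carrier (R Quot I)" "y \<in> carrier (R Quot I)" and xy: "x \<otimes>\<^bsub>R Quot I\<^esub> y \<in> (+>) I ` P"
    then obtain a b where ab: "a \<in> carrier R" "b \<in> carrier R" "x = I +> a" "y = I +> b"
      by (auto simp: I.carrier_Quot)
    then have "a \<otimes> b \<in> P" using xy iff[of "a \<otimes> b"] by (simp add: I.mult_Quot)
    then show "x \<in> (+>) I ` P \<or> y \<in> (+>) I ` P" using P.I_prime[OF ab(1,2)] ab by auto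
  qed
qed

lemma noetherian_Quot:
  assumes I: "ideal I R" and "noetherian_ring R"
  shows "noetherian_ring (R Quot I)"
proof -
  interpret I: ideal I R by fact
  interpret h: ring_hom_ring R "R Quot I" "(+>) I" by (rule I.rcos_ring_hom_ring)
  show ?thesis
  proof (rule ring.noetherian_ringI[OF I.quotient_is_ring])
    fix J assume J: "ideal J (R Quot I)"
    let ?V = "{r \<in> carrier R. I +> r \<in> J}"
    obtain A where A: "A \<subseteq> carrier R" "finite A" "?V = Idl A"
      using noetherian_ring.finetely_gen[OF assms(2) h.ideal_vimage[OF J]] by auto
    have AV: "A \<subseteq> ?V" using genideal_self[OF A(1)] A(3) by simp
    let ?G = "Idl\<^bsub>R Quot I\<^esub> ((+>) I ` A)"
    have Ac: "(+>) I ` A \<subseteq> carrier (R Quot I)" using A by (auto simp: I.carrier_Quot)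
    have G: "ideal ?G (R Quot I)" by (rule h.S.genideal_ideal[OF Ac])
    have "?G \<subseteq> J" by (rule h.S.genideal_minimal[OF J]) (use AV in auto)
    moreover have "J \<subseteq> ?G"
    proof
      fix y assume y: "y \<in> J"
      then have "y \<in> carrier (R Quot I)" using J ideal.Icarr by metis
      then obtain x where x: "x \<in> carrier R" "y = I +> x" by (auto simp: I.carrier_Quot)
      have "Idl A \<subseteq> {r \<in> carrier R. I +> r \<in> ?G}"
        by (rule genideal_minimal[OF h.ideal_vimage[OF G]])
          (use A h.S.genideal_self[OF Ac] in auto)
      then show "y \<in> ?G" using x y A(3) by auto
    qed
    ultimately show "\<exists>A\<subseteq>carrier (R Quot I). finite A \<and> J = Idl\<^bsub>R Quot I\<^esub> A"
      using A Ac by (intro exI[of _ "(+>) I ` A"]) auto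
  qed
qed

end

section \<open>Ideals of a type-based commutative ring\<close>

lemma ring_of_type_algebra_simps [simp]:
  "carrier (ring_of_type_algebra :: 'a::ring_1 ring) = UNIV"
  "x \<otimes>\<^bsub>(ring_of_type_algebra :: 'a ring)\<^esub> y = x * y"
  "x \<oplus>\<^bsub>(ring_of_type_algebra :: 'a ring)\<^esub> y = x + y"
  "\<zero>\<^bsub>(ring_of_type_algebra :: 'a ring)\<^esub> = 0"
  "\<one>\<^bsub>(ring_of_type_algebra :: 'a ring)\<^esub> = 1"
  by (simp_all add: ring_of_type_algebra_def)

interpretation type_ring: cring "ring_of_type_algebra :: 'a::comm_ring_1 ring"
  by (rule cring_from_type_algebra)

lemma type_ring_pow [simp]: "x [^]\<^bsub>(ring_of_type_algebra :: 'a::comm_ring_1 ring)\<^esub> (n::nat) = x ^ n"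
  by (induction n) (auto simp: mult.commute)

lemma type_ring_minus: "\<ominus>\<^bsub>(ring_of_type_algebra :: 'a::comm_ring_1 ring)\<^esub> x = - x"
  by (rule type_ring.minus_equality) auto

abbreviation is_ideal :: "'a::comm_ring_1 set \<Rightarrow> bool" where
  "is_ideal J \<equiv> ideal J ring_of_type_algebra"

abbreviation is_prime :: "'a::comm_ring_1 set \<Rightarrow> bool" where
  "is_prime P \<equiv> primeideal P ring_of_type_algebra"

lemma is_idealI:
  assumes "0 \<in> J" "\<And>x y. x \<in> J \<Longrightarrow> y \<in> J \<Longrightarrow> x + y \<in> J" "\<And>r x. x \<in> J \<Longrightarrow> r * x \<in> J"
  shows "is_ideal J"
proof (rule idealI)
  show "subgroup J (add_monoid (ring_of_type_algebra :: 'a ring))"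
  proof
    fix x assume "x \<in> J"
    then have "- x \<in> J" using assms(3)[of x "-1"] by simp
    then show "inv\<^bsub>add_monoid ring_of_type_algebra\<^esub> x \<in> J"
      unfolding type_ring_minus[symmetric] a_inv_def .
  qed (use assms in auto)
qed (use assms in \<open>auto simp: mult.commute type_ring.ring_axioms\<close>)

lemma is_ideal_zero: "is_ideal J \<Longrightarrow> 0 \<in> J"
  using additive_subgroup.zero_closed ideal.axioms(1) by fastforce

lemma is_ideal_add: "is_ideal J \<Longrightarrow> x \<in> J \<Longrightarrow> y \<in> J \<Longrightarrow> x + y \<in> J"
  using additive_subgroup.a_closed ideal.axioms(1) by fastforce

lemma is_ideal_mult: "is_ideal J \<Longrightarrow> x \<in> J \<Longrightarrow> r * x \<in> J"
  using ideal.I_l_closed[of J ring_of_type_algebra x r] by simp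

lemma is_ideal_mult': "is_ideal J \<Longrightarrow> x \<in> J \<Longrightarrow> x * r \<in> J"
  using is_ideal_mult[of J x r] by (simp add: mult.commute)

lemma is_ideal_uminus: "is_ideal J \<Longrightarrow> x \<in> J \<Longrightarrow> - x \<in> J"
  using is_ideal_mult[of J x "-1"] by simp

lemma is_ideal_diff: "is_ideal J \<Longrightarrow> x \<in> J \<Longrightarrow> y \<in> J \<Longrightarrow> x - y \<in> J"
  using is_ideal_add[of J x "- y"] is_ideal_uminus[of J y] by simp

lemma is_ideal_sum: "is_ideal J \<Longrightarrow> (\<And>i. i \<in> A \<Longrightarrow> f i \<in> J) \<Longrightarrow> sum f A \<in> J"
  by (induction A rule: infinite_finite_induct) (auto simp: is_ideal_zero is_ideal_add)

lemma is_ideal_add_iff: "is_ideal J \<Longrightarrow> x \<in> J \<Longrightarrow> x + y \<in> J \<longleftrightarrow> y \<in> J"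
  using is_ideal_add[of J x y] is_ideal_diff[of J "x + y" x] by auto

lemma is_ideal_one: "is_ideal J \<Longrightarrow> 1 \<in> J \<longleftrightarrow> J = UNIV"
  using is_ideal_mult[of J 1] by auto

lemma is_ideal_Idl: "is_ideal (Idl\<^bsub>ring_of_type_algebra\<^esub> (G :: 'a::comm_ring_1 set))"
  by (rule type_ring.genideal_ideal) simp

lemma Idl_superset: "G \<subseteq> Idl\<^bsub>ring_of_type_algebra\<^esub> (G :: 'a::comm_ring_1 set)"
  by (rule type_ring.genideal_self) simp

lemma is_primeI:
  assumes "is_ideal P" "1 \<notin> P" "\<And>a b. a * b \<in> P \<Longrightarrow> a \<in> P \<or> b \<in> P"
  shows "is_prime P"
  by (rule primeidealI[OF assms(1) type_ring.is_cring]) (use assms in auto)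

lemma is_prime_ideal: "is_prime P \<Longrightarrow> is_ideal P"
  by (rule primeideal.axioms)

lemma is_prime_one: "is_prime P \<Longrightarrow> 1 \<notin> P"
  using type_ring.primeideal_not_one[of P] by simp

lemma is_prime_mult_iff: "is_prime P \<Longrightarrow> a * b \<in> P \<longleftrightarrow> a \<in> P \<or> b \<in> P"
  using primeideal.I_prime[of P ring_of_type_algebra a b]
    is_ideal_mult[of P b a] is_ideal_mult'[of P a b] is_prime_ideal[of P] by auto

lemma is_prime_power: "is_prime P \<Longrightarrow> a ^ n \<in> P \<Longrightarrow> a \<in> P"
  using type_ring.primeideal_pow[of P a n] by simp

lemma mem_colon_ideal_iff [simp]:
  "f \<in> colon_ideal (ring_of_type_algebra :: 'a::comm_ring_1 ring) I h \<longleftrightarrow> f * h \<in> I"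
  by (simp add: colon_ideal_def)


section \<open>Polynomials and weighted degrees\<close>

lemma mpoly_sum_single: "f = (\<Sum>m\<in>Poly_Mapping.keys f. Poly_Mapping.single m (Poly_Mapping.lookup f m))"
  by (rule poly_mapping_eqI) (simp add: lookup_sum lookup_single when_def in_keys_iff)

lemma mpoly_induct [case_names single add]:
  fixes f :: "'a \<Rightarrow>\<^sub>0 'b::comm_monoid_add"
  assumes single: "\<And>m c. \<phi> (Poly_Mapping.single m c)" and add: "\<And>f g. \<phi> f \<Longrightarrow> \<phi> g \<Longrightarrow> \<phi> (f + g)"
  shows "\<phi> f"
proof -
  have zero: "\<phi> 0" using single[of undefined 0] by simp
  have "\<phi> (\<Sum>m\<in>A. Poly_Mapping.single m (Poly_Mapping.lookup f m))" for A
    by (induction A rule: infinite_finite_induct) (auto intro: zero single add)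
  then show ?thesis by (subst mpoly_sum_single)
qed

lemma monomial_add: "monomial (a + b) = monomial a * (monomial b :: ('n::finite, 'k::field) mpoly)"
  by (simp add: monomial_def mult_single)

lemma monomial_0 [simp]: "monomial 0 = (1 :: ('n::finite, 'k::field) mpoly)"
  by (simp add: monomial_def)

lemma lookup_monomial: "Poly_Mapping.lookup (monomial a) b = (1 when a = b)"
  by (simp add: monomial_def lookup_single)

lemma single_eq_const_mult_monomial:
  "Poly_Mapping.single m c = Poly_Mapping.single 0 c * (monomial m :: ('n::finite, 'k::field) mpoly)"
  by (simp add: monomial_def mult_single)

lemma tvar_power: "(tvar i :: ('n::finite, 'k::field) mpoly) ^ n = monomial (Poly_Mapping.single i n)"
proof (induction n)
  case (Suc n)
  have "Poly_Mapping.single i (Suc n) = Poly_Mapping.single i 1 + Poly_Mapping.single i n"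
    by (simp flip: single_add)
  then show ?case using Suc by (simp add: tvar_def flip: monomial_add)
qed simp

lemma exponent_sum_single:
  fixes m :: "'n::finite \<Rightarrow>\<^sub>0 nat"
  shows "m = (\<Sum>i\<in>UNIV. Poly_Mapping.single i (Poly_Mapping.lookup m i))"
  by (rule poly_mapping_eqI) (simp add: lookup_sum lookup_single when_def)

lemma monomial_sum: "monomial (sum f A) = (\<Prod>a\<in>A. monomial (f a) :: ('n::finite, 'k::field) mpoly)"
  by (induction A rule: infinite_finite_induct) (auto simp: monomial_add)

lemma monomial_eq_prod:
  "(monomial m :: ('n::finite, 'k::field) mpoly) = (\<Prod>i\<in>UNIV. tvar i ^ Poly_Mapping.lookup m i)"
  by (subst exponent_sum_single) (simp add: monomial_sum tvar_power)

section \<open>Weighted degrees and homogeneous components\<close>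

lemma weighted_degree_add: "weighted_degree w (a + b) = weighted_degree w a + weighted_degree w b"
  by (simp add: weighted_degree_def lookup_add algebra_simps sum.distrib)

lemma weighted_degree_zero [simp]: "weighted_degree w 0 = 0"
  by (simp add: weighted_degree_def)

lemma weighted_degree_single [simp]: "weighted_degree w (Poly_Mapping.single i n) = w i * n"
proof -
  have "weighted_degree w (Poly_Mapping.single i n) = (\<Sum>j\<in>UNIV. if i = j then w j * n else 0)"
    unfolding weighted_degree_def by (rule sum.cong) (auto simp: lookup_single when_def)
  then show ?thesis by simp
qed

text \<open>The homogeneous component of degree \<open>k\<close>. Weights may vanish: besides the
  positive grading \<open>d\<close> of the ideal, the degree in a single variable is used.\<close>

definition wcomp :: "('n::finite \<Rightarrow> nat) \<Rightarrow> nat \<Rightarrow> ('n, 'k::field) mpoly \<Rightarrow> ('n, 'k) mpoly" where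
  "wcomp w k f = Poly_Mapping.mapp (\<lambda>m c. c when weighted_degree w m = k) f"

definition wgraded :: "('n::finite \<Rightarrow> nat) \<Rightarrow> ('n, 'k::field) mpoly set \<Rightarrow> bool" where
  "wgraded w J \<longleftrightarrow> (\<forall>f\<in>J. \<forall>k. wcomp w k f \<in> J)"

lemma lookup_wcomp: "Poly_Mapping.lookup (wcomp w k f) m = (Poly_Mapping.lookup f m when weighted_degree w m = k)"
  by (simp add: wcomp_def lookup_mapp when_def in_keys_iff)

lemma wcomp_add: "wcomp w k (f + g) = wcomp w k f + wcomp w k g"
  by (rule poly_mapping_eqI) (simp add: lookup_wcomp lookup_add when_def)

lemma wcomp_diff: "wcomp w k (f - g) = wcomp w k f - wcomp w k g"
  by (rule poly_mapping_eqI) (simp add: lookup_wcomp lookup_minus when_def)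

lemma wcomp_zero [simp]: "wcomp w k 0 = 0"
  by (rule poly_mapping_eqI) (simp add: lookup_wcomp)

lemma wcomp_sum: "wcomp w k (sum f A) = (\<Sum>a\<in>A. wcomp w k (f a))"
  by (induction A rule: infinite_finite_induct) (auto simp: wcomp_add)

lemma wcomp_single: "wcomp w k (Poly_Mapping.single m c) = (Poly_Mapping.single m c when weighted_degree w m = k)"
  by (rule poly_mapping_eqI) (auto simp: lookup_wcomp lookup_single when_def)

lemma wcomp_monomial: "wcomp w k (monomial m) = (monomial m when weighted_degree w m = k)"
  by (simp add: monomial_def wcomp_single)

lemma wcomp_wcomp: "wcomp w k (wcomp w l f) = (wcomp w l f when k = l)"
  by (rule poly_mapping_eqI) (auto simp: lookup_wcomp when_def)

lemma keys_wcomp: "Poly_Mapping.keys (wcomp w k f) = {m \<in> Poly_Mapping.keys f. weighted_degree w m = k}"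
  by (auto simp: in_keys_iff lookup_wcomp)

lemma wcomp_eq_0_iff: "wcomp w k f = 0 \<longleftrightarrow> k \<notin> weighted_degree w ` Poly_Mapping.keys f"
  by (auto simp: keys_wcomp image_iff simp flip: Poly_Mapping.keys_eq_empty)

lemma sum_wcomp:
  assumes "finite A" "weighted_degree w ` Poly_Mapping.keys f \<subseteq> A"
  shows "(\<Sum>k\<in>A. wcomp w k f) = f"
proof (rule poly_mapping_eqI)
  fix m
  have "Poly_Mapping.lookup f m = 0" if "weighted_degree w m \<notin> A"
    using that assms(2) by (force simp: in_keys_iff)
  then show "Poly_Mapping.lookup (\<Sum>k\<in>A. wcomp w k f) m = Poly_Mapping.lookup f m"
    using assms(1) by (auto simp: lookup_sum lookup_wcomp when_def)
qed

lemma wcomp_mult: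
  "wcomp w k (f * g) = (\<Sum>i\<le>k. wcomp w i f * wcomp w (k - i) g)"
proof (induction f rule: mpoly_induct)
  case (add f f')
  then show ?case by (simp add: distrib_right wcomp_add sum.distrib)
next
  case (single m c)
  show ?case
  proof (induction g rule: mpoly_induct)
    case (add f f')
    then show ?case by (simp add: distrib_left wcomp_add sum.distrib)
  next
    case (single n d)
    let ?a = "weighted_degree w m" and ?b = "weighted_degree w n"
    have "(\<Sum>i\<le>k. wcomp w i (Poly_Mapping.single m c) * wcomp w (k - i) (Poly_Mapping.single n d))
      = (\<Sum>i\<le>k. if i = ?a then (Poly_Mapping.single (m + n) (c * d) when ?b = k - ?a) else 0)"
      by (rule sum.cong) (auto simp: wcomp_single when_def mult_single)
    also have "\<dots> = wcomp w k (Poly_Mapping.single m c * Poly_Mapping.single n d)"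
      by (auto simp: wcomp_single mult_single weighted_degree_add when_def)
    finally show ?case by simp
  qed
qed

lemma wcomp_mult_hom:
  assumes "wcomp w a f = f"
  shows "wcomp w (a + k) (f * g) = f * wcomp w k g"
proof -
  have "wcomp w i f = (f when i = a)" for i
    using wcomp_wcomp[of w i a f] assms by simp
  then have "wcomp w (a + k) (f * g) = (\<Sum>i\<le>a + k. if i = a then f * wcomp w k g else 0)"
    unfolding wcomp_mult by (intro sum.cong) (auto simp: when_def)
  then show ?thesis by simp
qed

lemma wcomp_mult_lowest:
  assumes "\<And>i. i < a \<Longrightarrow> wcomp w i f = 0" "\<And>i. i < b \<Longrightarrow> wcomp w i g = 0"
  shows "wcomp w (a + b) (f * g) = wcomp w a f * wcomp w b g"
proof -
  have "wcomp w (a + b) (f * g) = (\<Sum>i\<le>a + b. if i = a then wcomp w a f * wcomp w b g else 0)"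
    unfolding wcomp_mult
  proof (rule sum.cong)
    fix i assume "i \<in> {..a + b}"
    then consider "i < a" | "i = a" | "a + b - i < b" by force
    then show "wcomp w i f * wcomp w (a + b - i) g = (if i = a then wcomp w a f * wcomp w b g else 0)"
      by cases (use assms in auto)
  qed simp
  then show ?thesis by simp
qed

lemma hom_power:
  assumes "wcomp w a f = f"
  shows "wcomp w (r * a) (f ^ r) = f ^ r"
proof (induction r)
  case 0
  show ?case unfolding power_0 monomial_0[symmetric] wcomp_monomial by simp
next
  case (Suc r)
  then show ?case using wcomp_mult_hom[OF assms, of "r * a" "f ^ r"] by simp
qed

text \<open>Induction on the number of components of \<open>x\<close>: the lowest component \<open>f\<^sub>a\<close> of \<open>f\<close> kills the
  lowest component \<open>x\<^sub>b\<close> of \<open>x\<close>, so one may pass to \<open>f\<^sub>a (x - x\<^sub>b)\<close>.\<close>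
lemma lowest_component_power:
  assumes I: "is_ideal I" "wgraded w I" and low: "\<And>i. i < a \<Longrightarrow> wcomp w i f = 0" and "f * x \<in> I"
  shows "\<exists>r. wcomp w a f ^ r * x \<in> I"
  using assms(4)
proof (induction "card (weighted_degree w ` Poly_Mapping.keys x)" arbitrary: x rule: less_induct)
  case less
  let ?D = "\<lambda>x. weighted_degree w ` Poly_Mapping.keys x" and ?f = "wcomp w a f"
  show ?case
  proof (cases "x = 0")
    case True
    then show ?thesis using I(1) by (simp add: is_ideal_zero)
  next
    case False
    then have ne: "?D x \<noteq> {}" by simp
    define b where "b = Min (?D x)"
    have b: "b \<in> ?D x" "\<And>i. i < b \<Longrightarrow> wcomp w i x = 0"
      using ne by (auto simp: b_def wcomp_eq_0_iff intro: Min_in)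
    have "wcomp w (a + b) (f * x) \<in> I" using less.prems I by (auto simp: wgraded_def)
    then have 1: "?f * wcomp w b x \<in> I" using wcomp_mult_lowest[OF low b(2)] by simp
    define x' where "x' = ?f * (x - wcomp w b x)"
    \<comment> \<open>The components of \<open>x'\<close> are those of \<open>x\<close>, multiplied
      by \<open>?f\<close> and shifted by \<open>a\<close>, with the \<open>b\<close>-th one gone;
      hence there are fewer of them.\<close>
    have "wcomp w (a + k) x' = ?f * (wcomp w k x - wcomp w k (wcomp w b x))" for k
      unfolding x'_def by (subst wcomp_mult_hom) (auto simp: wcomp_wcomp wcomp_diff)
    moreover have "wcomp w k x' = 0" if "k < a" for k
      using that unfolding x'_def wcomp_mult by (intro sum.neutral) (auto simp: wcomp_wcomp)
    ultimately have "?D x' \<subseteq> (+) a ` (?D x - {b})"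
    proof -
      assume *: "\<And>k. wcomp w (a + k) x' = ?f * (wcomp w k x - wcomp w k (wcomp w b x))"
        "\<And>k. k < a \<Longrightarrow> wcomp w k x' = 0"
      show ?thesis
      proof
        fix l assume "l \<in> ?D x'"
        then have nz: "wcomp w l x' \<noteq> 0" by (simp add: wcomp_eq_0_iff)
        then have "l \<ge> a" using *(2)[of l] by (meson not_le)
        then obtain k where k: "l = a + k" using le_Suc_ex by blast
        have "k \<noteq> b" using nz *(1)[of b] k by (auto simp: wcomp_wcomp)
        moreover from this have "wcomp w k x \<noteq> 0" using nz *(1)[of k] k by (auto simp: wcomp_wcomp)
        ultimately have "k \<in> ?D x - {b}" by (simp add: wcomp_eq_0_iff)
        then show "l \<in> (+) a ` (?D x - {b})" using k by blast
      qed
    qed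
    then have "card (?D x') \<le> card ((+) a ` (?D x - {b}))" by (intro card_mono) auto
    also have "\<dots> \<le> card (?D x - {b})" by (rule card_image_le) auto
    also have "\<dots> < card (?D x)" using b(1) by (intro card_Diff1_less) auto
    finally have "card (?D x') < card (?D x)" .
    moreover have "f * x' = ?f * (f * x) - f * (?f * wcomp w b x)"
      by (simp add: x'_def algebra_simps)
    then have "f * x' \<in> I" using less.prems 1 I(1) by (simp add: is_ideal_diff is_ideal_mult)
    ultimately obtain r where r: "?f ^ r * x' \<in> I" using less.hyps by blast
    have "?f ^ Suc r * x = ?f ^ r * x' + ?f ^ r * (?f * wcomp w b x)"
      by (simp add: x'_def algebra_simps)
    then show ?thesis using r 1 I(1) by (metis is_ideal_add is_ideal_mult)
  qed
qed

section \<open>Graded cores of primes, and associated primes of graded ideals\<close>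

lemma wgraded_sum_lower:
  assumes "is_ideal J" "\<And>i. i < a \<Longrightarrow> wcomp w i f \<in> J"
  defines "f' \<equiv> f - (\<Sum>i<a. wcomp w i f)"
  shows "f - f' \<in> J" "\<And>i. i < a \<Longrightarrow> wcomp w i f' = 0" "wcomp w a f' = wcomp w a f"
proof -
  show "f - f' \<in> J" unfolding f'_def using assms(1,2) by (auto intro: is_ideal_sum)
  have *: "wcomp w i f' = wcomp w i f - (\<Sum>j<a. wcomp w j f when i = j)" for i
    by (simp add: f'_def wcomp_diff wcomp_sum wcomp_wcomp)
  show "wcomp w i f' = 0" if "i < a" for i
    using that by (simp add: * when_def)
  show "wcomp w a f' = wcomp w a f"
    by (simp add: * when_def)
qed

text \<open>For an ideal \<open>P\<close> this is the largest \<open>w\<close>-graded ideal inside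
  \<open>P\<close>.\<close>

definition wcore :: "('n::finite \<Rightarrow> nat) \<Rightarrow> ('n, 'k::field) mpoly set \<Rightarrow> ('n, 'k) mpoly set" where
  "wcore w P = {f. \<forall>k. wcomp w k f \<in> P}"

lemma wcore_subset: "is_ideal P \<Longrightarrow> wcore w P \<subseteq> P"
proof
  fix f assume P: "is_ideal P" "f \<in> wcore w P"
  have "(\<Sum>k\<in>weighted_degree w ` Poly_Mapping.keys f. wcomp w k f) \<in> P"
    using P by (intro is_ideal_sum) (auto simp: wcore_def)
  then show "f \<in> P" by (simp add: sum_wcomp)
qed

lemma wgraded_wcore: "is_ideal P \<Longrightarrow> wgraded w (wcore w P)"
  by (auto simp: wgraded_def wcore_def wcomp_wcomp when_def is_ideal_zero)

lemma subset_wcore: "wgraded w I \<Longrightarrow> I \<subseteq> P \<Longrightarrow> I \<subseteq> wcore w P"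
  by (auto simp: wgraded_def wcore_def)

lemma is_ideal_wcore: "is_ideal P \<Longrightarrow> is_ideal (wcore w P)"
  by (rule is_idealI)
    (auto simp: wcore_def wcomp_add wcomp_mult is_ideal_zero is_ideal_add is_ideal_mult intro: is_ideal_sum)

text \<open>Let \<open>wcomp w a f\<close> be the lowest component of \<open>f\<close> outside
  \<open>P\<close>. The components below it can be discarded modulo the core, so by
  \<open>lowest_component_power\<close> some power of it times \<open>g\<close> lies in the core.
  Reading this off degree by degree and cancelling in \<open>P\<close> puts every component of
  \<open>g\<close> into \<open>P\<close>.\<close>

lemma is_prime_wcore:
  assumes P: "is_prime P"
  shows "is_prime (wcore w P)"
proof (rule is_primeI)
  note Pi = is_prime_ideal[OF P]
  show C: "is_ideal (wcore w P)" using is_ideal_wcore[OF Pi] .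
  show "1 \<notin> wcore w P" using wcore_subset[OF Pi] is_prime_one[OF P] by auto
  fix f g assume fg: "f * g \<in> wcore w P"
  show "f \<in> wcore w P \<or> g \<in> wcore w P"
  proof (cases "f \<in> wcore w P")
    case False
    then obtain k where "wcomp w k f \<notin> P" by (auto simp: wcore_def)
    define a where "a = (LEAST k. wcomp w k f \<notin> P)"
    have a: "wcomp w a f \<notin> P" "\<And>i. i < a \<Longrightarrow> wcomp w i f \<in> P"
      unfolding a_def using \<open>wcomp w k f \<notin> P\<close> by (rule LeastI) (use not_less_Least in auto)
    define f' where "f' = f - (\<Sum>i<a. wcomp w i f)"
    have "wcomp w i f \<in> wcore w P" if "i < a" for i
      using a(2)[OF that] Pi by (auto simp: wcore_def wcomp_wcomp when_def is_ideal_zero)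
    note f' = wgraded_sum_lower[OF C this, of a, folded f'_def]
    have "f' * g = f * g - (f - f') * g" by (simp add: algebra_simps)
    then have "f' * g \<in> wcore w P" using fg f'(1) C by (simp add: is_ideal_diff is_ideal_mult')
    then obtain r where r: "wcomp w a f ^ r * g \<in> wcore w P"
      using lowest_component_power[OF C wgraded_wcore[OF Pi], of a f' g] f'(2,3) by auto
    have "wcomp w k g \<in> P" for k
    proof -
      have "wcomp w (r * a + k) (wcomp w a f ^ r * g) = wcomp w a f ^ r * wcomp w k g"
        by (intro wcomp_mult_hom hom_power) (simp add: wcomp_wcomp)
      moreover have "wcomp w (r * a + k) (wcomp w a f ^ r * g) \<in> P"
        using r by (auto simp: wcore_def)
      ultimately have "wcomp w a f ^ r * wcomp w k g \<in> P" by simp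
      then show ?thesis using P a(1) by (auto simp: is_prime_mult_iff dest: is_prime_power)
    qed
    then show ?thesis by (simp add: wcore_def)
  qed simp
qed

text \<open>The element \<open>x\<close> with \<open>P = (I : x)\<close> may be inhomogeneous. The
  lowest component of \<open>f\<close> outside \<open>P\<close> would have a power that sends
  \<open>x\<close> into \<open>I\<close>, hence a power in the prime \<open>P\<close>.\<close>

lemma associated_prime_wgraded:
  assumes I: "is_ideal I" "wgraded w I" and P: "P \<in> associated_primes mpoly_ring I"
  shows "wgraded w P"
  unfolding wgraded_def
proof (intro ballI, rule ccontr)
  obtain x where x: "P = colon_ideal mpoly_ring I x" and Pp: "is_prime P"
    using P by (auto simp: associated_primes_def)
  note Pi = is_prime_ideal[OF Pp]
  fix f assume f: "f \<in> P" "\<not> (\<forall>k. wcomp w k f \<in> P)"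
  then obtain k where "wcomp w k f \<notin> P" by auto
  define a where "a = (LEAST k. wcomp w k f \<notin> P)"
  have a: "wcomp w a f \<notin> P" "\<And>i. i < a \<Longrightarrow> wcomp w i f \<in> P"
    unfolding a_def using \<open>wcomp w k f \<notin> P\<close> by (rule LeastI) (use not_less_Least in auto)
  define f' where "f' = f - (\<Sum>i<a. wcomp w i f)"
  note f' = wgraded_sum_lower[OF Pi a(2), of a, folded f'_def]
  have "f' \<in> P" using is_ideal_diff[OF Pi f(1) f'(1)] by simp
  then have "f' * x \<in> I" using x by simp
  then obtain r where "wcomp w a f ^ r * x \<in> I"
    using lowest_component_power[OF I, of a f' x] f'(2,3) by auto
  then have "wcomp w a f ^ r \<in> P" using x by simp
  then show False using is_prime_power[OF Pp] a(1) by blast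
qed

section \<open>Hilbert's basis theorem\<close>

text \<open>A decreasing sequence of natural numbers is constant from the index on where it attains
  its minimum.\<close>

lemma nat_seq_incseq_subseq:
  fixes s :: "nat \<Rightarrow> nat"
  shows "\<exists>r. strict_mono r \<and> incseq (s \<circ> r)"
proof -
  obtain g where g: "strict_mono g" "monoseq (\<lambda>n. s (g n))"
    using seq_monosub[of s] by auto
  from g(2) consider "incseq (\<lambda>n. s (g n))" | "decseq (\<lambda>n. s (g n))"
    by (auto simp: monoseq_iff)
  then show ?thesis
  proof cases
    case 1
    then show ?thesis using g by (auto simp: comp_def)
  next
    case 2
    obtain n where n: "\<And>k. s (g n) \<le> s (g k)"
      using ex_has_least_nat[of "\<lambda>_. True" 0 "\<lambda>k. s (g k)"] by auto
    have "s (g (n + k)) = s (g n)" for k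
      using n[of "n + k"] decseqD[OF 2, of n "n + k"] by simp
    moreover have "strict_mono (\<lambda>k. g (n + k))"
      using g(1) by (auto simp: strict_mono_def)
    ultimately show ?thesis
      by (intro exI[of _ "\<lambda>k. g (n + k)"]) (auto simp: incseq_def)
  qed
qed

lemma seq_incseq_subseq:
  fixes f :: "nat \<Rightarrow> 'n \<Rightarrow> nat"
  assumes "finite A"
  shows "\<exists>r. strict_mono r \<and> (\<forall>i\<in>A. incseq (\<lambda>k. f (r k) i))"
  using assms
proof (induction A)
  case empty
  show ?case by (auto intro!: exI[of _ id] simp: strict_mono_id)
next
  case (insert a A)
  then obtain r where r: "strict_mono r" "\<forall>i\<in>A. incseq (\<lambda>k. f (r k) i)" by auto
  obtain q where q: "strict_mono q" "incseq ((\<lambda>k. f (r k) a) \<circ> q)"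
    using nat_seq_incseq_subseq by blast
  have "incseq (\<lambda>k. f (r (q k)) i)" if "i \<in> A" for i
    using r(2) that q(1) by (auto simp: incseq_def strict_mono_less_eq)
  then show ?case
    using q r by (intro exI[of _ "r \<circ> q"]) (auto simp: comp_def strict_mono_def)
qed

text \<open>\<open>F\<close> consists of the minimal elements of \<open>A\<close>. Descent on the
  sum of the exponents finds one below any element; infinitely many of them would contain a
  coordinatewise weakly increasing subsequence, hence two comparable ones.\<close>

lemma dickson:
  fixes A :: "('n::finite \<Rightarrow>\<^sub>0 nat) set"
  shows "\<exists>F\<subseteq>A. finite F \<and> (\<forall>x\<in>A. \<exists>u\<in>F. \<forall>i. Poly_Mapping.lookup u i \<le> Poly_Mapping.lookup x i)"
proof -
  let ?le = "\<lambda>u x :: 'n \<Rightarrow>\<^sub>0 nat. \<forall>i. Poly_Mapping.lookup u i \<le> Poly_Mapping.lookup x i"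
  let ?F = "{x \<in> A. \<forall>y\<in>A. ?le y x \<longrightarrow> y = x}"
  have "\<exists>u\<in>?F. ?le u x" if "x \<in> A" for x
    using that
  proof (induction "\<Sum>i\<in>UNIV. Poly_Mapping.lookup x i" arbitrary: x rule: less_induct)
    case less
    show ?case
    proof (cases "x \<in> ?F")
      case False
      then obtain y where y: "y \<in> A" "?le y x" "y \<noteq> x" using less.prems by auto
      then obtain i where "Poly_Mapping.lookup y i \<noteq> Poly_Mapping.lookup x i"
        by (metis poly_mapping_eqI)
      then have "Poly_Mapping.lookup y i < Poly_Mapping.lookup x i" using y(2) by (simp add: order_less_le)
      then have "(\<Sum>i\<in>UNIV. Poly_Mapping.lookup y i) < (\<Sum>i\<in>UNIV. Poly_Mapping.lookup x i)"
        using y(2) by (intro sum_strict_mono_ex1) auto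
      then obtain u where "u \<in> ?F" "?le u y" using less.hyps y(1) by blast
      then show ?thesis using y(2) le_trans by blast
    qed auto
  qed
  moreover have "finite ?F"
  proof (rule ccontr)
    assume "infinite ?F"
    then obtain e :: "nat \<Rightarrow> 'n \<Rightarrow>\<^sub>0 nat" where e: "inj e" "range e \<subseteq> ?F"
      using infinite_countable_subset by blast
    obtain r where r: "strict_mono r" "\<forall>i\<in>UNIV. incseq (\<lambda>k. Poly_Mapping.lookup (e (r k)) i)"
      using seq_incseq_subseq[of UNIV "\<lambda>k. Poly_Mapping.lookup (e k)"] by auto
    have "?le (e (r 0)) (e (r 1))" using r(2) by (auto simp: incseq_def)
    then have "e (r 0) = e (r 1)" using e(2) by blast
    then have "r 0 = r 1" using e(1) by (simp add: inj_eq)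
    then show False using r(1) by (simp add: strict_mono_eq)
  qed
  ultimately show ?thesis by (intro exI[of _ ?F]) auto
qed

text \<open>Lexicographic comparison along a list of variables; for a list of all variables it is a
  monomial order. The recursion lets well-foundedness come from lexicographic products.\<close>

primrec lexrel :: "'n list \<Rightarrow> ('n \<Rightarrow>\<^sub>0 nat) rel" where
  "lexrel [] = {}"
| "lexrel (v # vs) = inv_image (less_than <*lex*> lexrel vs) (\<lambda>a. (Poly_Mapping.lookup a v, a))"

lemma wf_lexrel: "wf (lexrel vs)"
  by (induction vs) auto

lemma trans_lexrel: "trans (lexrel vs)"
proof (induction vs)
  case (Cons v vs)
  then show ?case by (auto intro!: trans_inv_image trans_lex_prod)
qed simp

lemma lexrel_total:
  "\<lbrakk>\<exists>i\<in>set vs. Poly_Mapping.lookup a i \<noteq> Poly_Mapping.lookup b i\<rbrakk> \<Longrightarrow> (a, b) \<in> lexrel vs \<or> (b, a) \<in> lexrel vs"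
  by (induction vs) auto

lemma lexrel_add: "(a, b) \<in> lexrel vs \<Longrightarrow> (c + a, c + b) \<in> lexrel vs"
  by (induction vs) (auto simp: lookup_add)

lemma lookup_single_mult:
  fixes g :: "('n::finite, 'k::field) mpoly"
  shows "Poly_Mapping.lookup (Poly_Mapping.single v c * g) (v + k) = c * Poly_Mapping.lookup g k"
proof (induction g rule: mpoly_induct)
  case (single m d)
  then show ?case by (simp add: mult_single lookup_single when_def)
next
  case (add f g)
  then show ?case by (simp add: distrib_left lookup_add)
qed

lemma lookup_const_mult:
  "Poly_Mapping.lookup (Poly_Mapping.single 0 c * g) m = c * Poly_Mapping.lookup (g :: ('n::finite, 'k::field) mpoly) m"
  using lookup_single_mult[of 0 c g m] by simp

lemma keys_single_mult:
  fixes g :: "('n::finite, 'k::field) mpoly"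
  shows "Poly_Mapping.keys (Poly_Mapping.single v c * g) \<subseteq> (+) v ` Poly_Mapping.keys g"
  using keys_mult[of "Poly_Mapping.single v c" g] by (auto split: if_splits)

text \<open>By \<open>dickson\<close>, finitely many members of \<open>J\<close> have leading
  exponents below all others coordinatewise. Subtracting a multiple of one of them cancels the
  leading term and lowers the leading exponent in a well-founded order.\<close>

theorem noetherian_mpoly: "noetherian_ring (mpoly_ring :: ('n::finite, 'k::field) mpoly ring)"
proof (rule type_ring.noetherian_ringI)
  fix J :: "('n, 'k) mpoly set"
  assume J: "is_ideal J"
  obtain vs :: "'n list" where vs: "set vs = UNIV" using finite_list[OF finite] by blast
  let ?R = "lexrel vs"
  have total: "a = b \<or> (a, b) \<in> ?R \<or> (b, a) \<in> ?R" for a b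
    using lexrel_total[of vs a b] vs by (metis UNIV_I poly_mapping_eqI)
  define lm where "lm f m \<longleftrightarrow> m \<in> Poly_Mapping.keys f \<and> (\<forall>k\<in>Poly_Mapping.keys f. k = m \<or> (k, m) \<in> ?R)"
    for f :: "('n, 'k) mpoly" and m
  have max: "\<exists>m\<in>A. \<forall>k\<in>A. k = m \<or> (k, m) \<in> ?R" if "finite A" "A \<noteq> {}" for A
    using that
  proof (induction A rule: finite_ne_induct)
    case (insert a A)
    then obtain m where m: "m \<in> A" "\<forall>k\<in>A. k = m \<or> (k, m) \<in> ?R" by auto
    show ?case
    proof (cases "(m, a) \<in> ?R")
      case True
      then have "\<forall>k\<in>insert a A. k = a \<or> (k, a) \<in> ?R"
        using m(2) trans_lexrel[of vs] by (auto dest: transD)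
      then show ?thesis by blast
    next
      case False
      then show ?thesis using m total[of m a] by auto
    qed
  qed simp
  have ex_lm: "\<exists>m. lm f m" if "f \<noteq> 0" for f
    using max[of "Poly_Mapping.keys f"] that by (auto simp: lm_def)
  obtain F where F: "F \<subseteq> {m. \<exists>f\<in>J. lm f m}" "finite F"
    "\<And>m. \<exists>f\<in>J. lm f m \<Longrightarrow> \<exists>u\<in>F. \<forall>i. Poly_Mapping.lookup u i \<le> Poly_Mapping.lookup m i"
    using dickson[of "{m. \<exists>f\<in>J. lm f m}"] by auto
  then have "\<forall>u\<in>F. \<exists>f. f \<in> J \<and> lm f u" by blast
  then obtain g where g: "\<And>u. u \<in> F \<Longrightarrow> g u \<in> J" "\<And>u. u \<in> F \<Longrightarrow> lm (g u) u"
    by metis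
  let ?G = "Idl\<^bsub>mpoly_ring\<^esub> (g ` F)"
  have G: "is_ideal ?G" by (rule is_ideal_Idl)
  have "f \<in> ?G" if "f \<in> J" "lm f m" for f m
    using that
  proof (induction m arbitrary: f rule: wf_induct_rule[OF wf_lexrel[of vs]])
    case (1 m)
    then obtain u where u: "u \<in> F" "\<forall>i. Poly_Mapping.lookup u i \<le> Poly_Mapping.lookup m i"
      using F(3) by blast
    define v where "v = m - u"
    have m: "m = v + u"
      by (rule poly_mapping_eqI) (use u(2) in \<open>simp add: v_def lookup_add lookup_minus\<close>)
    let ?c = "Poly_Mapping.lookup f m / Poly_Mapping.lookup (g u) u"
    have nz: "Poly_Mapping.lookup (g u) u \<noteq> 0" using g(2)[OF u(1)] by (auto simp: lm_def in_keys_iff)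
    define f' where "f' = f - Poly_Mapping.single v ?c * g u"
    have gG: "g u \<in> ?G" using Idl_superset[of "g ` F"] u(1) by auto
    have f'J: "f' \<in> J" unfolding f'_def using 1(2) g(1)[OF u(1)] J by (simp add: is_ideal_diff is_ideal_mult)
    have "Poly_Mapping.lookup f' m = 0"
      using nz unfolding f'_def m by (simp add: lookup_minus lookup_single_mult)
    then have "m \<notin> Poly_Mapping.keys f'" by (simp add: in_keys_iff)
    moreover have "Poly_Mapping.keys f' \<subseteq> Poly_Mapping.keys f \<union> (+) v ` Poly_Mapping.keys (g u)"
      unfolding f'_def using keys_single_mult[of v ?c "g u"]
      by (smt (verit) Un_iff diff_zero in_keys_iff lookup_minus subset_iff)
    ultimately have "k \<noteq> m \<and> (k \<in> Poly_Mapping.keys f \<or> (\<exists>k'\<in>Poly_Mapping.keys (g u). k = v + k'))"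
      if "k \<in> Poly_Mapping.keys f'" for k
      using that by auto
    then have less: "(k, m) \<in> ?R" if "k \<in> Poly_Mapping.keys f'" for k
      using that 1(3) g(2)[OF u(1)] lexrel_add[of _ u vs v] unfolding lm_def m by metis
    have "f' \<in> ?G"
    proof (cases "f' = 0")
      case True
      then show ?thesis using G by (simp add: is_ideal_zero)
    next
      case False
      then obtain m' where m': "lm f' m'" using ex_lm by blast
      then have "(m', m) \<in> ?R" using less by (simp add: lm_def)
      then show ?thesis using 1(1) f'J m' by blast
    qed
    then have "f' + Poly_Mapping.single v ?c * g u \<in> ?G"
      by (rule is_ideal_add[OF G _ is_ideal_mult[OF G gG]])
    then show ?case by (simp add: f'_def)
  qed
  then have "f \<in> ?G" if "f \<in> J" for f
    using ex_lm[of f] is_ideal_zero[OF G] that by (cases "f = 0") auto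
  then have "J \<subseteq> ?G" by blast
  moreover have "?G \<subseteq> J" by (rule type_ring.genideal_minimal[OF J]) (use g in auto)
  ultimately show "\<exists>A\<subseteq>carrier mpoly_ring. finite A \<and> J = Idl\<^bsub>mpoly_ring\<^esub> A"
    using F(2) by (intro exI[of _ "g ` F"]) auto
qed

interpretation mpoly: noetherian_cring "mpoly_ring :: ('n::finite, 'k::field) mpoly ring"
  by (intro noetherian_cring.intro noetherian_mpoly cring_from_type_algebra)


section \<open>The dimension of a polynomial ring\<close>

text \<open>Gaussian elimination: an equation \<open>m\<close> that involves an unknown
  \<open>p\<close> is solved for \<open>p\<close>, which leaves one equation and one unknown
  fewer.\<close>

lemma homogeneous_linear_system:
  fixes A :: "'a \<Rightarrow> 'b \<Rightarrow> 'k::field"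
  assumes "finite M" "finite E" "card M < card E"
  shows "\<exists>c. (\<exists>e\<in>E. c e \<noteq> 0) \<and> (\<forall>m\<in>M. (\<Sum>e\<in>E. c e * A e m) = 0)"
  using assms
proof (induction M arbitrary: E A)
  case empty
  then have "E \<noteq> {}" by auto
  then show ?case by (intro exI[of _ "\<lambda>_. 1"]) auto
next
  case (insert m M)
  show ?case
  proof (cases "\<exists>p\<in>E. A p m \<noteq> 0")
    case False
    have "card M < card E" using insert by simp
    then obtain c where "\<exists>e\<in>E. c e \<noteq> 0" "\<forall>m\<in>M. (\<Sum>e\<in>E. c e * A e m) = 0"
      using insert.IH[OF insert.prems(1), of A] by auto
    then show ?thesis using False by (intro exI[of _ c]) auto
  next
    case True
    then obtain p where p: "p \<in> E" "A p m \<noteq> 0" by auto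
    let ?E = "E - {p}"
    define A' where "A' e k = A e k - A e m / A p m * A p k" for e k
    have "card M < card ?E" "finite ?E" using insert p by auto
    then obtain c where c: "\<exists>e\<in>?E. c e \<noteq> 0" "\<forall>k\<in>M. (\<Sum>e\<in>?E. c e * A' e k) = 0"
      using insert.IH[of ?E A'] by auto
    define c' where "c' = c(p := - (\<Sum>e\<in>?E. c e * (A e m / A p m)))"
    have "(\<Sum>e\<in>E. c' e * A e k) = (\<Sum>e\<in>?E. c e * A' e k)" for k
    proof -
      have "(\<Sum>e\<in>E. c' e * A e k) = c' p * A p k + (\<Sum>e\<in>?E. c' e * A e k)"
        using p insert.prems by (simp add: sum.remove)
      also have "(\<Sum>e\<in>?E. c' e * A e k) = (\<Sum>e\<in>?E. c e * A e k)"
        by (rule sum.cong) (auto simp: c'_def)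
      also have "c' p * A p k = - (\<Sum>e\<in>?E. c e * (A e m / A p m) * A p k)"
        by (simp add: c'_def sum_distrib_right)
      also have "\<dots> + (\<Sum>e\<in>?E. c e * A e k) = (\<Sum>e\<in>?E. c e * A' e k)"
        by (simp add: A'_def algebra_simps sum_subtractf)
      finally show ?thesis .
    qed
    moreover have "(\<Sum>e\<in>?E. c e * A' e m) = 0" using p by (simp add: A'_def)
    ultimately have "\<forall>k\<in>insert m M. (\<Sum>e\<in>E. c' e * A e k) = 0" using c(2) by simp
    moreover have "\<exists>e\<in>E. c' e \<noteq> 0" using c(1) by (auto simp: c'_def)
    ultimately show ?thesis by blast
  qed
qed

definition bounded_lists :: "nat \<Rightarrow> nat \<Rightarrow> nat list set" where
  "bounded_lists N n = {l. length l = n \<and> set l \<subseteq> {..N}}"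

lemma finite_bounded_lists: "finite (bounded_lists N n)"
  unfolding bounded_lists_def by (rule finite_subset[OF _ finite_lists_length_eq[of "{..N}" n]]) auto

lemma card_bounded_lists: "card (bounded_lists N n) = Suc N ^ n"
  using card_lists_length_eq[of "{..N}" n] by (simp add: bounded_lists_def conj_commute)

lemma bounded_lists_Suc:
  "bounded_lists N (Suc n) = (\<lambda>(j, l). j # l) ` ({..N} \<times> bounded_lists N n)"
  by (auto simp: bounded_lists_def length_Suc_conv image_iff)

text \<open>\<open>power_word [x\<^sub>1, \<dots>, x\<^sub>n] [l\<^sub>1, \<dots>, l\<^sub>n]\<close> is \<open>x\<^sub>1^l\<^sub>1 \<cdots> x\<^sub>n^l\<^sub>n\<close>, and \<open>power_sum\<close> is a linear
  combination of these words in Horner form.\<close>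
fun power_word :: "'a::comm_ring_1 list \<Rightarrow> nat list \<Rightarrow> 'a" where
  "power_word (x # xs) (j # l) = x ^ j * power_word xs l"
| "power_word _ _ = 1"

fun power_sum :: "nat \<Rightarrow> ('n::finite, 'k::field) mpoly list \<Rightarrow> (nat list \<Rightarrow> 'k) \<Rightarrow> ('n, 'k) mpoly" where
  "power_sum N [] c = Poly_Mapping.single 0 (c [])"
| "power_sum N (x # xs) c = (\<Sum>j\<le>N. x ^ j * power_sum N xs (\<lambda>l. c (j # l)))"

lemma power_sum_eq:
  "power_sum N xs c = (\<Sum>l\<in>bounded_lists N (length xs). Poly_Mapping.single 0 (c l) * power_word xs l)"
proof (induction xs arbitrary: c)
  case Nil
  have "bounded_lists N 0 = {[]}" by (auto simp: bounded_lists_def)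
  then show ?case by simp
next
  case (Cons x xs)
  have "inj_on (\<lambda>(j, l). j # l) ({..N} \<times> bounded_lists N (length xs))"
    by (auto simp: inj_on_def)
  then have "(\<Sum>l\<in>bounded_lists N (length (x # xs)). Poly_Mapping.single 0 (c l) * power_word (x # xs) l)
    = (\<Sum>(j, l)\<in>{..N} \<times> bounded_lists N (length xs). Poly_Mapping.single 0 (c (j # l)) * (x ^ j * power_word xs l))"
    by (simp add: bounded_lists_Suc sum.reindex case_prod_unfold)
  then show ?case
    by (simp add: Cons sum.cartesian_product[symmetric] sum_distrib_left mult.left_commute)
qed

lemma power_sum_zero: "(\<And>l. l \<in> bounded_lists N (length xs) \<Longrightarrow> c l = 0) \<Longrightarrow> power_sum N xs c = 0"
  by (simp add: power_sum_eq)

text \<open>Elements chosen along a strict chain of primes are algebraically independent: compare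
  the lexicographically smallest terms of a relation.\<close>
lemma power_sum_chain:
  fixes p :: "nat \<Rightarrow> ('n::finite, 'k::field) mpoly set"
  assumes "\<And>i. i \<le> length xs \<Longrightarrow> is_prime (p i)"
    and "\<And>i. i < length xs \<Longrightarrow> p i \<subseteq> p (Suc i) \<and> xs ! i \<in> p (Suc i) \<and> xs ! i \<notin> p i"
    and "power_sum N xs c \<in> p 0" "l \<in> bounded_lists N (length xs)"
  shows "c l = 0"
  using assms
proof (induction xs arbitrary: p c l)
  case Nil
  show ?case
  proof (rule ccontr)
    assume "c l \<noteq> 0"
    then have nz: "c [] \<noteq> 0" using Nil by (simp add: bounded_lists_def)
    have "Poly_Mapping.single 0 (inverse (c [])) * Poly_Mapping.single 0 (c []) \<in> p 0"
      using Nil is_ideal_mult[OF is_prime_ideal[OF Nil(1)]] by simp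
    then show False using nz is_prime_one[OF Nil(1)] by (simp add: mult_single)
  qed
next
  case (Cons x xs)
  have P0: "is_prime (p 0)" and P1: "is_prime (p 1)" using Cons.prems(1)[of 0] Cons.prems(1)[of 1] by auto
  have x: "p 0 \<subseteq> p 1" "x \<in> p 1" "x \<notin> p 0" using Cons.prems(2)[of 0] by auto
  let ?g = "\<lambda>j. power_sum N xs (\<lambda>l. c (j # l))"
  have "c (j # k) = 0" if "j \<le> N" "k \<in> bounded_lists N (length xs)" for j k
    using that
  proof (induction j arbitrary: k rule: less_induct)
    case (less j)
    have "?g i = 0" if "i < j" for i
      by (rule power_sum_zero) (use less that in auto)
    then have "(\<Sum>i\<le>N. x ^ i * ?g i) = (\<Sum>i\<in>{j..N}. x ^ i * ?g i)"
      by (intro sum.mono_neutral_right) auto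
    also have "\<dots> = x ^ j * ?g j + (\<Sum>i\<in>{Suc j..N}. x ^ i * ?g i)"
      using less.prems by (simp add: sum.atLeast_Suc_atMost)
    also have "(\<Sum>i\<in>{Suc j..N}. x ^ i * ?g i) = x ^ j * (x * (\<Sum>i\<in>{Suc j..N}. x ^ (i - Suc j) * ?g i))"
      unfolding sum_distrib_left
    proof (rule sum.cong)
      fix i assume "i \<in> {Suc j..N}"
      then have "x ^ i = x ^ j * (x * x ^ (i - Suc j))"
        by (simp flip: power_Suc power_add)
      then show "x ^ i * ?g i = x ^ j * (x * (x ^ (i - Suc j) * ?g i))" by (simp add: mult.assoc)
    qed simp
    finally have "x ^ j * (?g j + x * (\<Sum>i\<in>{Suc j..N}. x ^ (i - Suc j) * ?g i)) \<in> p 0"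
      using Cons.prems(3) by (simp add: distrib_left)
    \<comment> \<open>The power of \<open>x\<close>, which factors out since the earlier
      coefficients vanish, is cancelled in \<open>p 0\<close>; modulo \<open>p 1\<close>, which
      contains \<open>x\<close>, only the coefficient of \<open>x ^ j\<close> remains.\<close>
    then have "?g j + x * (\<Sum>i\<in>{Suc j..N}. x ^ (i - Suc j) * ?g i) \<in> p 1"
      using x P0 is_prime_power[OF P0] by (auto simp: is_prime_mult_iff)
    then have "?g j \<in> p 1"
      using is_ideal_add_iff[OF is_prime_ideal[OF P1] is_ideal_mult'[OF is_prime_ideal[OF P1] x(2)]]
      by (simp add: add.commute)
    then show ?case
      using Cons.IH[of "p \<circ> Suc" "\<lambda>l. c (j # l)" k] Cons.prems(1,2) less.prems by fastforce
  qed
  then show ?case using Cons.prems(4) by (auto simp: bounded_lists_Suc)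
qed

text \<open>Cubes of exponents, because their size is bounded by a plain power that compares well
  with \<open>card_bounded_lists\<close>.\<close>

definition exponent_box :: "nat \<Rightarrow> ('n::finite \<Rightarrow>\<^sub>0 nat) set" where
  "exponent_box D = {m. \<forall>i. Poly_Mapping.lookup m i \<le> D}"

lemma exponent_box_card:
  "finite (exponent_box D :: ('n::finite \<Rightarrow>\<^sub>0 nat) set)"
  "card (exponent_box D :: ('n::finite \<Rightarrow>\<^sub>0 nat) set) \<le> Suc D ^ card (UNIV :: 'n set)"
proof -
  let ?B = "exponent_box D :: ('n \<Rightarrow>\<^sub>0 nat) set"
  have inj: "inj_on Poly_Mapping.lookup ?B"
    by (rule inj_onI) (simp add: poly_mapping_eqI)
  have sub: "Poly_Mapping.lookup ` ?B \<subseteq> (UNIV \<rightarrow>\<^sub>E {..D})" by (auto simp: exponent_box_def)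
  have fin: "finite ((UNIV :: 'n set) \<rightarrow>\<^sub>E {..D})" by (rule finite_PiE) auto
  show "finite ?B" using inj sub fin by (meson finite_imageD finite_subset)
  have "card ?B \<le> card ((UNIV :: 'n set) \<rightarrow>\<^sub>E {..D})" by (rule card_inj_on_le[OF inj sub fin])
  then show "card ?B \<le> Suc D ^ card (UNIV :: 'n set)" by (simp add: card_PiE)
qed

lemma exponent_box_mult:
  assumes "Poly_Mapping.keys f \<subseteq> exponent_box a" "Poly_Mapping.keys g \<subseteq> exponent_box b"
  shows "Poly_Mapping.keys (f * g :: ('n::finite, 'k::field) mpoly) \<subseteq> exponent_box (a + b)"
proof
  fix m assume "m \<in> Poly_Mapping.keys (f * g)"
  then obtain u v where "m = u + v" "u \<in> Poly_Mapping.keys f" "v \<in> Poly_Mapping.keys g"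
    using keys_mult[of f g] by auto
  then show "m \<in> exponent_box (a + b)"
    using assms by (auto simp: exponent_box_def lookup_add subset_iff intro: add_mono)
qed

lemma exponent_box_power_word:
  fixes xs :: "('n::finite, 'k::field) mpoly list"
  assumes "\<And>x. x \<in> set xs \<Longrightarrow> Poly_Mapping.keys x \<subseteq> exponent_box D" "l \<in> bounded_lists N (length xs)"
  shows "Poly_Mapping.keys (power_word xs l) \<subseteq> exponent_box (length xs * (N * D))"
  using assms
proof (induction xs arbitrary: l)
  case Nil
  have "Poly_Mapping.keys (1 :: ('n, 'k) mpoly) = {0}" by simp
  then show ?case by (auto simp: exponent_box_def)
next
  case (Cons x xs)
  obtain j k where l: "l = j # k" "j \<le> N" "k \<in> bounded_lists N (length xs)"
    using Cons.prems(2) by (auto simp: bounded_lists_Suc)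
  have "Poly_Mapping.keys (x ^ j) \<subseteq> exponent_box (j * D)" for j
  proof (induction j)
    case 0
    have "Poly_Mapping.keys (1 :: ('n, 'k) mpoly) = {0}" by simp
    then show ?case by (auto simp: exponent_box_def)
  next
    case (Suc j)
    then show ?case using exponent_box_mult[of x D "x ^ j" "j * D"] Cons.prems(1) by simp
  qed
  moreover have "exponent_box (j * D) \<subseteq> exponent_box (N * D)"
    using l(2) by (auto simp: exponent_box_def intro: order_trans mult_le_mono1)
  ultimately have "Poly_Mapping.keys (x ^ j) \<subseteq> exponent_box (N * D)" by blast
  moreover have "Poly_Mapping.keys (power_word xs k) \<subseteq> exponent_box (length xs * (N * D))"
    using Cons l by auto
  ultimately show ?case
    using exponent_box_mult[of "x ^ j" "N * D" "power_word xs k" "length xs * (N * D)"] l(1) by simp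
qed

lemma keys_bounded:
  assumes "finite A"
  shows "\<exists>D. \<forall>x\<in>A. Poly_Mapping.keys (x :: ('n::finite, 'k::field) mpoly) \<subseteq> exponent_box D"
proof -
  let ?E = "\<Union>x\<in>A. \<Union>m\<in>Poly_Mapping.keys x. range (Poly_Mapping.lookup m)"
  have "finite ?E" using assms by auto
  then have "e \<le> Max ?E" if "e \<in> ?E" for e using that by (rule Max_ge)
  then show ?thesis
    by (intro exI[of _ "Max ?E"] ballI subsetI) (unfold exponent_box_def, blast)
qed

text \<open>For \<open>s + 1\<close> polynomials there are \<open>(N + 1)^(s + 1)\<close> words with
  exponents up to \<open>N\<close>, while the number of exponent vectors available to them grows
  only like \<open>N^s\<close>; for large \<open>N\<close> the words are linearly dependent.\<close>

lemma power_sum_dependent: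
  fixes xs :: "('n::finite, 'k::field) mpoly list"
  assumes "length xs = Suc (card (UNIV :: 'n set))"
  shows "\<exists>N c. power_sum N xs c = 0 \<and> (\<exists>l\<in>bounded_lists N (length xs). c l \<noteq> 0)"
proof -
  obtain D where D: "\<And>x. x \<in> set xs \<Longrightarrow> Poly_Mapping.keys x \<subseteq> exponent_box D"
    using keys_bounded[of "set xs"] by auto
  let ?n = "length xs"
  \<comment> \<open>With \<open>n = s + 1\<close> this choice gives
    \<open>(n N D + 1)^s \<le> (N + 1)^s N < (N + 1)^(s + 1)\<close>.\<close>
  define N where "N = Suc (?n * D) ^ card (UNIV :: 'n set)"
  let ?M = "exponent_box (?n * (N * D)) :: ('n \<Rightarrow>\<^sub>0 nat) set" and ?E = "bounded_lists N ?n"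
  have "card ?M \<le> Suc (?n * (N * D)) ^ card (UNIV :: 'n set)" by (rule exponent_box_card)
  also have "\<dots> \<le> (Suc N * Suc (?n * D)) ^ card (UNIV :: 'n set)"
    by (intro power_mono) (auto simp: algebra_simps)
  also have "\<dots> = Suc N ^ card (UNIV :: 'n set) * N" by (simp only: N_def power_mult_distrib)
  also have "\<dots> < Suc N ^ card (UNIV :: 'n set) * Suc N" by simp
  also have "\<dots> = card ?E" using assms by (simp add: card_bounded_lists)
  finally have "card ?M < card ?E" .
  from homogeneous_linear_system[OF exponent_box_card(1) finite_bounded_lists this,
      of "\<lambda>l m. Poly_Mapping.lookup (power_word xs l) m"]
  obtain c where c: "\<exists>l\<in>?E. c l \<noteq> 0"
    "\<And>m. m \<in> ?M \<Longrightarrow> (\<Sum>l\<in>?E. c l * Poly_Mapping.lookup (power_word xs l) m) = 0" by auto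
  have "power_sum N xs c = 0"
  proof (rule poly_mapping_eqI)
    fix m
    have "Poly_Mapping.lookup (power_word xs l) m = 0" if "m \<notin> ?M" "l \<in> ?E" for l
      using exponent_box_power_word[OF D that(2)] that(1) by (metis in_keys_iff subsetD)
    then have "(\<Sum>l\<in>?E. c l * Poly_Mapping.lookup (power_word xs l) m) = 0"
      using c(2) by (cases "m \<in> ?M") auto
    then show "Poly_Mapping.lookup (power_sum N xs c) m = Poly_Mapping.lookup 0 m"
      by (simp add: power_sum_eq lookup_sum lookup_const_mult)
  qed
  then show ?thesis using c(1) by blast
qed

text \<open>Elements picked from the successive differences of a chain with more than
  \<open>s\<close> steps would satisfy a relation by \<open>power_sum_dependent\<close> and none by
  \<open>power_sum_chain\<close>.\<close>

theorem prime_chain_length_le: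
  assumes "prime_chain (mpoly_ring :: ('n::finite, 'k::field) mpoly ring) n P"
  shows "n \<le> card (UNIV :: 'n set)"
proof (rule ccontr)
  assume n: "\<not> n \<le> card (UNIV :: 'n set)"
  obtain p where p: "\<And>i. i \<le> n \<Longrightarrow> is_prime (p i :: ('n, 'k) mpoly set)" "\<And>i. i < n \<Longrightarrow> p i \<subset> p (Suc i)"
    using assms by (auto simp: prime_chain_def)
  then have "\<forall>i<n. \<exists>x. x \<in> p (Suc i) \<and> x \<notin> p i" by blast
  then obtain x where x: "\<And>i. i < n \<Longrightarrow> x i \<in> p (Suc i) \<and> x i \<notin> p i" by metis
  let ?xs = "map x [0..<Suc (card (UNIV :: 'n set))]"
  obtain N c l where N: "power_sum N ?xs c = 0" "l \<in> bounded_lists N (length ?xs)" "c l \<noteq> 0"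
    using power_sum_dependent[of ?xs] by auto
  have "c l = 0"
  proof (rule power_sum_chain[OF _ _ _ N(2)])
    show "power_sum N ?xs c \<in> p 0" using N(1) p(1)[of 0] by (simp add: is_ideal_zero is_prime_ideal)
    show "is_prime (p i)" if "i \<le> length ?xs" for i using p(1) that n by simp
    show "p i \<subseteq> p (Suc i) \<and> ?xs ! i \<in> p (Suc i) \<and> ?xs ! i \<notin> p i" if "i < length ?xs" for i
      using p(2)[of i] x[of i] that n by (auto simp del: upt_Suc)
  qed
  then show False using N(3) by simp
qed

section \<open>Evaluation and class sums\<close>

text \<open>The linear functional with values \<open>\<mu>\<close> on the monomials: an evaluation
  if \<open>\<mu>\<close> is multiplicative, a sum of coefficients over a class if
  \<open>\<mu>\<close> is its indicator.\<close>

definition mlin :: "(('n::finite \<Rightarrow>\<^sub>0 nat) \<Rightarrow> 'k::field) \<Rightarrow> ('n, 'k) mpoly \<Rightarrow> 'k" where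
  "mlin \<mu> f = (\<Sum>m\<in>Poly_Mapping.keys f. Poly_Mapping.lookup f m * \<mu> m)"

lemma mlin_add: "mlin \<mu> (f + g) = mlin \<mu> f + mlin \<mu> g"
  unfolding mlin_def by (rule setsum_keys_plus_distrib) (auto simp: distrib_right)

lemma mlin_single [simp]: "mlin \<mu> (Poly_Mapping.single m c) = c * \<mu> m"
  by (simp add: mlin_def)

lemma mlin_monomial [simp]: "mlin \<mu> (monomial m) = \<mu> m"
  by (simp add: monomial_def)

lemma mlin_zero [simp]: "mlin \<mu> 0 = 0"
  by (simp add: mlin_def)

lemma mlin_diff: "mlin \<mu> (f - g) = mlin \<mu> f - mlin \<mu> g"
  using mlin_add[of \<mu> "f - g" g] by simp

lemma mlin_single_mult: "mlin \<mu> (Poly_Mapping.single m c * f) = c * mlin (\<lambda>b. \<mu> (m + b)) f"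
  by (induction f rule: mpoly_induct) (simp_all add: mult_single mlin_add distrib_left)

lemma mlin_mult:
  assumes "\<And>a b. \<mu> (a + b) = \<mu> a * \<mu> b"
  shows "mlin \<mu> (f * g) = mlin \<mu> f * mlin \<mu> g"
proof (induction f rule: mpoly_induct)
  case (single m c)
  have "mlin (\<lambda>b. \<mu> (m + b)) g = \<mu> m * mlin \<mu> g"
    by (simp add: mlin_def assms sum_distrib_left mult.left_commute)
  then show ?case by (simp add: mlin_single_mult)
qed (simp add: mlin_add distrib_right)

lemma is_prime_mlin_kernel:
  assumes "\<And>a b. \<mu> (a + b) = \<mu> a * \<mu> b" "\<mu> 0 = 1"
  shows "is_prime {f. mlin \<mu> f = 0}"
proof (rule is_primeI)
  show "is_ideal {f. mlin \<mu> f = 0}"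
    by (rule is_idealI) (auto simp: mlin_add mlin_mult[OF assms(1)])
  have "mlin \<mu> (monomial 0) = 1" by (simp only: mlin_monomial assms(2))
  then show "1 \<notin> {f. mlin \<mu> f = 0}" by simp
qed (auto simp: mlin_mult[OF assms(1)])

lemma poly_eval_eq_mlin: "poly_eval f x = mlin (\<lambda>m. \<Prod>i\<in>UNIV. x i ^ Poly_Mapping.lookup m i) f"
  by (simp add: poly_eval_def mlin_def)

lemma mem_zero_set_IdlI:
  assumes "\<And>g. g \<in> G \<Longrightarrow> poly_eval g x = 0"
  shows "x \<in> zero_set (Idl\<^bsub>mpoly_ring\<^esub> G)"
proof -
  let ?K = "{f. mlin (\<lambda>m. \<Prod>i\<in>UNIV. x i ^ Poly_Mapping.lookup m i) f = 0}"
  have "is_prime ?K"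
    by (rule is_prime_mlin_kernel) (simp_all add: lookup_add power_add prod.distrib)
  then have "Idl\<^bsub>mpoly_ring\<^esub> G \<subseteq> ?K"
    using assms by (intro type_ring.genideal_minimal is_prime_ideal) (auto simp: poly_eval_eq_mlin)
  then show ?thesis by (auto simp: zero_set_def poly_eval_eq_mlin)
qed

text \<open>Functionals constant on the classes of \<open>E\<close> encode the sums of the coefficients over these
  classes.\<close>
lemma mlin_invariant_Idl:
  assumes B: "\<And>g. g \<in> B \<Longrightarrow> \<exists>b c. g = monomial b - monomial c \<and> E b c"
    and add: "\<And>m b c. E b c \<Longrightarrow> E (m + b) (m + c)"
    and f: "f \<in> Idl\<^bsub>mpoly_ring\<^esub> B" and inv: "\<And>b c. E b c \<Longrightarrow> \<mu> b = \<mu> c"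
  shows "mlin \<mu> f = 0"
proof -
  \<comment> \<open>All invariant functionals are taken at once, since multiplication by a monomial
    replaces \<open>\<mu>\<close> by a shifted one.\<close>
  let ?K = "{f. \<forall>\<mu>. (\<forall>b c. E b c \<longrightarrow> \<mu> b = \<mu> c) \<longrightarrow> mlin \<mu> f = 0}"
  have "is_ideal ?K"
  proof (rule is_idealI)
    fix r f assume f: "f \<in> ?K"
    show "r * f \<in> ?K"
    proof (induction r rule: mpoly_induct)
      case (single m c)
      then show ?case using f add by (auto simp: mlin_single_mult)
    qed (auto simp: distrib_right mlin_add)
  qed (auto simp: mlin_add)
  moreover have "B \<subseteq> ?K"
    using B by (force simp: mlin_diff)
  ultimately have "Idl\<^bsub>mpoly_ring\<^esub> B \<subseteq> ?K" by (rule type_ring.genideal_minimal)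
  then show ?thesis using f inv by blast
qed

text \<open>Replacing every monomial of \<open>f\<close> by a representative of its class changes
  \<open>f\<close> by an element of \<open>J\<close>. Each coefficient of the result is a sum over a
  class, which \<open>zero\<close> makes vanish.\<close>

lemma mlin_invariant_converse:
  assumes J: "is_ideal J" and E: "equivp E" "\<And>b c. E b c \<Longrightarrow> monomial b - monomial c \<in> J"
    and zero: "\<And>\<mu>. (\<And>b c. E b c \<Longrightarrow> \<mu> b = \<mu> c) \<Longrightarrow> mlin \<mu> f = 0"
  shows "f \<in> J"
proof -
  define rep where "rep m = (SOME b. E m b)" for m
  have rep: "E m (rep m)" for m
    unfolding rep_def by (rule someI[of _ m]) (rule equivp_reflp[OF E(1)])
  have rep_cong: "rep b = rep c" if "E b c" for b c
  proof -
    have "E b = E c" using that E(1) by (simp add: equivp_def)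
    then show ?thesis by (simp add: rep_def)
  qed
  let ?h = "\<Sum>m\<in>Poly_Mapping.keys f. Poly_Mapping.single (rep m) (Poly_Mapping.lookup f m)"
  have "?h = 0"
  proof (rule poly_mapping_eqI)
    fix r
    have "mlin (\<lambda>m. if rep m = r then 1 else 0) f = 0"
      by (rule zero) (simp add: rep_cong)
    then show "Poly_Mapping.lookup ?h r = Poly_Mapping.lookup 0 r"
      by (simp add: lookup_sum lookup_single mlin_def when_def if_distrib cong: if_cong)
  qed
  then have "f = (\<Sum>m\<in>Poly_Mapping.keys f. Poly_Mapping.single m (Poly_Mapping.lookup f m)) - ?h"
    by (simp flip: mpoly_sum_single)
  also have "\<dots> = (\<Sum>m\<in>Poly_Mapping.keys f. Poly_Mapping.single 0 (Poly_Mapping.lookup f m) * (monomial m - monomial (rep m)))"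
    by (simp add: sum_subtractf right_diff_distrib monomial_def mult_single)
  also have "\<dots> \<in> J"
    by (intro is_ideal_sum is_ideal_mult J E(2) rep)
  finally show ?thesis .
qed

section \<open>Congruence of monomials modulo an ideal\<close>

definition mcong :: "('n::finite, 'k::field) mpoly set \<Rightarrow> ('n \<Rightarrow>\<^sub>0 nat) \<Rightarrow> ('n \<Rightarrow>\<^sub>0 nat) \<Rightarrow> bool" where
  "mcong J b c \<longleftrightarrow> monomial b - monomial c \<in> J"

lemma mcong_refl: "is_ideal J \<Longrightarrow> mcong J b b"
  by (simp add: mcong_def is_ideal_zero)

lemma mcong_sym: "is_ideal J \<Longrightarrow> mcong J b c \<Longrightarrow> mcong J c b"
  using is_ideal_uminus[of J "monomial b - monomial c"] by (simp add: mcong_def)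

lemma mcong_trans: "is_ideal J \<Longrightarrow> mcong J a b \<Longrightarrow> mcong J b c \<Longrightarrow> mcong J a c"
  using is_ideal_add[of J "monomial a - monomial b" "monomial b - monomial c"] by (simp add: mcong_def)

lemma mcong_add: "is_ideal J \<Longrightarrow> mcong J b c \<Longrightarrow> mcong J (m + b) (m + c)"
  using is_ideal_mult[of J "monomial b - monomial c" "monomial m"]
  by (simp add: mcong_def monomial_add right_diff_distrib)

lemma mcong_add2:
  assumes "is_ideal J" "mcong J a b" "mcong J c e"
  shows "mcong J (a + c) (b + e)"
  using mcong_trans[OF assms(1) mcong_add[OF assms(1,3), of a] mcong_add[OF assms(1,2), of e, unfolded add.commute[of e]]] .


section \<open>Lattice ideals\<close>

text \<open>Congruence modulo \<open>L\<close>. The difference is formed in the integers because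
  subtraction of exponent vectors truncates.\<close>

definition lattice_rel :: "('n \<Rightarrow>\<^sub>0 int) set \<Rightarrow> ('n \<Rightarrow>\<^sub>0 nat) \<Rightarrow> ('n \<Rightarrow>\<^sub>0 nat) \<Rightarrow> bool" where
  "lattice_rel L b c \<longleftrightarrow> (\<exists>l\<in>L. \<forall>i. Poly_Mapping.lookup l i = int (Poly_Mapping.lookup b i) - int (Poly_Mapping.lookup c i))"

lemma exists_poly_mapping: "\<exists>f :: 'n::finite \<Rightarrow>\<^sub>0 'a::zero. \<forall>i. Poly_Mapping.lookup f i = g i"
  by (intro exI[of _ "Abs_poly_mapping g"]) simp

text \<open>With \<open>w\<close> the coordinatewise minimum, the binomial of \<open>b\<close> and
  \<open>c\<close> becomes a monomial multiple of the one attached to \<open>l\<close>.\<close>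

lemma pos_neg_decomposition:
  fixes b c :: "'n::finite \<Rightarrow>\<^sub>0 nat"
  assumes "\<And>i. Poly_Mapping.lookup l i = int (Poly_Mapping.lookup b i) - int (Poly_Mapping.lookup c i)"
  shows "\<exists>w. b = w + pos_part l \<and> c = w + neg_part l"
proof -
  obtain w :: "'n \<Rightarrow>\<^sub>0 nat" where w: "\<And>i. Poly_Mapping.lookup w i = min (Poly_Mapping.lookup b i) (Poly_Mapping.lookup c i)"
    using exists_poly_mapping[of "\<lambda>i. min (Poly_Mapping.lookup b i) (Poly_Mapping.lookup c i)"] by auto
  have "b = w + pos_part l" "c = w + neg_part l"
    by (rule poly_mapping_eqI, simp add: lookup_add lookup_pos_part lookup_neg_part assms w)+
  then show ?thesis by blast
qed

lemma equivp_lattice_rel: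
  assumes "is_lattice L"
  shows "equivp (lattice_rel L)"
proof (rule equivpI)
  show "reflp (lattice_rel L)"
    using assms by (auto simp: reflp_def lattice_rel_def is_lattice_def intro!: bexI[of _ 0])
  show "symp (lattice_rel L)"
    unfolding symp_def lattice_rel_def
  proof (intro allI impI)
    fix b c assume "\<exists>l\<in>L. \<forall>i. Poly_Mapping.lookup l i = int (Poly_Mapping.lookup b i) - int (Poly_Mapping.lookup c i)"
    then obtain l where "l \<in> L" "\<forall>i. Poly_Mapping.lookup l i = int (Poly_Mapping.lookup b i) - int (Poly_Mapping.lookup c i)"
      by blast
    then show "\<exists>l\<in>L. \<forall>i. Poly_Mapping.lookup l i = int (Poly_Mapping.lookup c i) - int (Poly_Mapping.lookup b i)"
      using assms by (intro bexI[of _ "- l"]) (auto simp: is_lattice_def)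
  qed
  show "transp (lattice_rel L)"
    unfolding transp_def lattice_rel_def
  proof (intro allI impI)
    fix a b c
    assume "\<exists>l\<in>L. \<forall>i. Poly_Mapping.lookup l i = int (Poly_Mapping.lookup a i) - int (Poly_Mapping.lookup b i)"
      "\<exists>l\<in>L. \<forall>i. Poly_Mapping.lookup l i = int (Poly_Mapping.lookup b i) - int (Poly_Mapping.lookup c i)"
    then obtain l l' where "l \<in> L" "l' \<in> L"
      "\<forall>i. Poly_Mapping.lookup l i = int (Poly_Mapping.lookup a i) - int (Poly_Mapping.lookup b i)"
      "\<forall>i. Poly_Mapping.lookup l' i = int (Poly_Mapping.lookup b i) - int (Poly_Mapping.lookup c i)"
      by blast
    then show "\<exists>l\<in>L. \<forall>i. Poly_Mapping.lookup l i = int (Poly_Mapping.lookup a i) - int (Poly_Mapping.lookup c i)"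
      using assms by (intro bexI[of _ "l + l'"]) (auto simp: is_lattice_def lookup_add)
  qed
qed

lemma lattice_rel_add_iff: "lattice_rel L (m + b) (m + c) \<longleftrightarrow> lattice_rel L b c"
  by (simp add: lattice_rel_def lookup_add)

lemma mem_lattice_ideal_of_iff:
  fixes f :: "('n::finite, 'k::field) mpoly"
  assumes L: "is_lattice L"
  shows "f \<in> lattice_ideal_of L \<longleftrightarrow> (\<forall>\<mu>. (\<forall>b c. lattice_rel L b c \<longrightarrow> \<mu> b = \<mu> c) \<longrightarrow> mlin \<mu> f = 0)"
proof (intro iffI allI impI)
  fix \<mu> :: "('n \<Rightarrow>\<^sub>0 nat) \<Rightarrow> 'k"
  assume "f \<in> lattice_ideal_of L" "\<forall>b c. lattice_rel L b c \<longrightarrow> \<mu> b = \<mu> c"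
  then show "mlin \<mu> f = 0"
    unfolding lattice_ideal_of_def
  proof (intro mlin_invariant_Idl[where E = "lattice_rel L"])
    fix g assume "g \<in> {monomial (pos_part a) - monomial (neg_part a) :: ('n, 'k) mpoly | a. a \<in> L}"
    then obtain a where "a \<in> L" "g = monomial (pos_part a) - monomial (neg_part a)" by auto
    moreover have "\<forall>i. Poly_Mapping.lookup a i = int (Poly_Mapping.lookup (pos_part a) i) - int (Poly_Mapping.lookup (neg_part a) i)"
      by (simp add: lookup_pos_part lookup_neg_part)
    ultimately show "\<exists>b c. g = monomial b - monomial c \<and> lattice_rel L b c"
      unfolding lattice_rel_def by blast
  qed (auto simp: lattice_rel_add_iff)
next
  assume *: "\<forall>\<mu>. (\<forall>b c. lattice_rel L b c \<longrightarrow> \<mu> b = \<mu> c) \<longrightarrow> mlin \<mu> f = 0"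
  show "f \<in> lattice_ideal_of L"
  proof (rule mlin_invariant_converse[OF _ equivp_lattice_rel[OF L]])
    show "is_ideal (lattice_ideal_of L :: ('n, 'k) mpoly set)"
      unfolding lattice_ideal_of_def by (rule is_ideal_Idl)
    fix b c assume "lattice_rel L b c"
    then obtain l where l: "l \<in> L"
      "\<And>i. Poly_Mapping.lookup l i = int (Poly_Mapping.lookup b i) - int (Poly_Mapping.lookup c i)"
      unfolding lattice_rel_def by blast
    obtain w where w: "b = w + pos_part l" "c = w + neg_part l"
      using pos_neg_decomposition[OF l(2)] by blast
    have "monomial (pos_part l) - monomial (neg_part l) \<in> (lattice_ideal_of L :: ('n, 'k) mpoly set)"
      unfolding lattice_ideal_of_def using l(1) by (intro subsetD[OF Idl_superset]) auto
    from is_ideal_mult[OF \<open>is_ideal (lattice_ideal_of L)\<close> this, of "monomial w"]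
    show "monomial b - monomial c \<in> (lattice_ideal_of L :: ('n, 'k) mpoly set)"
      by (simp add: w monomial_add right_diff_distrib)
  qed (use * in auto)
qed

text \<open>Shifting by one variable is injective on cosets of the lattice. Undoing the shift turns
  an invariant \<open>\<mu>\<close> into an invariant \<open>\<mu>'\<close> that takes on
  \<open>tvar i * f\<close> the value that \<open>\<mu>\<close> takes on \<open>f\<close>.\<close>

lemma lattice_ideal_regular:
  fixes I :: "('n::finite, 'k::field) mpoly set"
  assumes "lattice_ideal I" "f * tvar i \<in> I"
  shows "f \<in> I"
proof -
  obtain L where L: "is_lattice L" and I: "I = lattice_ideal_of L"
    using assms(1) by (auto simp: lattice_ideal_def)
  let ?e = "Poly_Mapping.single i 1" and ?E = "lattice_rel L"
  have E: "?E = ?E" "\<And>a b c. ?E a b \<Longrightarrow> ?E b c \<Longrightarrow> ?E a c" "\<And>a b. ?E a b \<Longrightarrow> ?E b a" "\<And>a. ?E a a"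
    using equivp_lattice_rel[OF L] by (auto dest: equivp_transp equivp_symp equivp_reflp)
  show ?thesis
    unfolding I mem_lattice_ideal_of_iff[OF L]
  proof (intro allI impI)
    fix \<mu> :: "('n \<Rightarrow>\<^sub>0 nat) \<Rightarrow> 'k" assume inv: "\<forall>b c. ?E b c \<longrightarrow> \<mu> b = \<mu> c"
    \<comment> \<open>Cosets without an exponent \<open>?e + m\<close> get the value 0; no term of
      \<open>tvar i * f\<close> lies in them. Different choices of \<open>m\<close> are congruent,
      as \<open>?e\<close> cancels in \<open>lattice_rel\<close>.\<close>
    define \<mu>' where "\<mu>' b = (if \<exists>m. ?E b (?e + m) then \<mu> (SOME m. ?E b (?e + m)) else 0)" for b
    have "\<mu>' (?e + m) = \<mu> m" for m
    proof -
      have "?E (?e + m) (?e + (SOME m'. ?E (?e + m) (?e + m')))"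
        by (rule someI[of _ m]) (rule E)
      then have "\<mu> (SOME m'. ?E (?e + m) (?e + m')) = \<mu> m"
        using inv E(3) lattice_rel_add_iff by metis
      then show ?thesis using E(4)[of "?e + m"] by (auto simp: \<mu>'_def)
    qed
    moreover have "\<mu>' b = \<mu>' c" if "?E b c" for b c
    proof -
      have "?E b = ?E c" using that equivp_lattice_rel[OF L] by (simp add: equivp_def)
      then show ?thesis by (simp add: \<mu>'_def)
    qed
    then have "mlin \<mu>' (tvar i * f) = 0"
      using assms(2) by (simp add: I mem_lattice_ideal_of_iff[OF L] mult.commute)
    ultimately show "mlin \<mu> f = 0"
      by (simp add: tvar_def monomial_def mlin_single_mult)
  qed
qed

lemma regular_monomial:
  assumes "\<And>i f. f * tvar i \<in> I \<Longrightarrow> f \<in> I" and "f * monomial m \<in> I"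
  shows "f \<in> I"
proof -
  define reg where "reg h \<longleftrightarrow> (\<forall>f. f * h \<in> I \<longrightarrow> f \<in> I)" for h
  have mult: "reg (g * h)" if "reg g" "reg h" for g h
    unfolding reg_def
  proof (intro allI impI)
    fix f assume "f * (g * h) \<in> I"
    then have "f * g * h \<in> I" by (simp add: mult.assoc)
    then show "f \<in> I" using that unfolding reg_def by blast
  qed
  have one: "reg 1" by (simp add: reg_def)
  have pow: "reg (g ^ n)" if "reg g" for g and n :: nat
  proof (induction n)
    case (Suc n)
    then show ?case using mult[OF that] by simp
  qed (simp add: one)
  have tv: "reg (tvar i)" for i using assms(1) by (simp add: reg_def)
  have "reg (\<Prod>i\<in>A. tvar i ^ Poly_Mapping.lookup m i)" for A
  proof (induction A rule: infinite_finite_induct)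
    case (insert i A)
    then show ?case using mult[OF pow[OF tv]] by simp
  qed (auto simp: one)
  then have "reg (monomial m)" by (simp add: monomial_eq_prod)
  then show ?thesis using assms(2) by (simp add: reg_def)
qed

text \<open>Regularity lets monomials be cancelled in \<open>mcong I\<close>, so whether
  \<open>b\<close> and \<open>c\<close> are congruent depends only on their difference in the
  integers; the differences that occur form the lattice.\<close>

lemma regular_imp_lattice_ideal:
  fixes I :: "('n::finite, 'k::field) mpoly set"
  assumes I: "binomial_ideal I" and reg: "\<And>i f. f * tvar i \<in> I \<Longrightarrow> f \<in> I"
  shows "lattice_ideal I"
proof -
  obtain B where B: "\<And>g. g \<in> B \<Longrightarrow> \<exists>b c. g = monomial b - monomial c" "I = Idl\<^bsub>mpoly_ring\<^esub> B"
    using I by (auto simp: binomial_ideal_def)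
  have ideal: "is_ideal I" unfolding B(2) by (rule is_ideal_Idl)
  have cancel: "mcong I b c" if "mcong I (m + b) (m + c)" for m b c
    using that regular_monomial[where I = I and m = m and f = "monomial b - monomial c", OF reg]
    by (simp add: mcong_def monomial_add algebra_simps)
  define L where "L = {a. mcong I (pos_part a) (neg_part a)}"
  have L: "l \<in> L \<longleftrightarrow> mcong I b c"
    if l: "\<And>i. Poly_Mapping.lookup l i = int (Poly_Mapping.lookup b i) - int (Poly_Mapping.lookup c i)" for l b c
  proof -
    obtain w where w: "b = w + pos_part l" "c = w + neg_part l" using pos_neg_decomposition[OF l] by blast
    have "mcong I b c \<longleftrightarrow> mcong I (pos_part l) (neg_part l)"
      unfolding w by (rule iffI[OF cancel mcong_add[OF ideal]])
    then show ?thesis by (simp add: L_def)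
  qed
  have "is_lattice L"
    unfolding is_lattice_def
  proof (intro conjI ballI)
    show "0 \<in> L" using L[of 0 0 0] mcong_refl[OF ideal] by simp
  next
    fix a b assume "a \<in> L" "b \<in> L"
    then have "mcong I (pos_part a + pos_part b) (neg_part a + neg_part b)"
      by (intro mcong_add2 ideal) (simp_all add: L_def)
    moreover have "Poly_Mapping.lookup (a + b) i = int (Poly_Mapping.lookup (pos_part a + pos_part b) i)
        - int (Poly_Mapping.lookup (neg_part a + neg_part b) i)" for i
      by (simp add: lookup_add lookup_pos_part lookup_neg_part)
    ultimately show "a + b \<in> L" using L[of "a + b" "pos_part a + pos_part b" "neg_part a + neg_part b"] by simp
  next
    fix a assume "a \<in> L"
    then have "mcong I (neg_part a) (pos_part a)" using mcong_sym[OF ideal, of "pos_part a" "neg_part a"] by (simp add: L_def)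
    moreover have "Poly_Mapping.lookup (- a) i = int (Poly_Mapping.lookup (neg_part a) i)
        - int (Poly_Mapping.lookup (pos_part a) i)" for i
      by (simp add: lookup_pos_part lookup_neg_part)
    ultimately show "- a \<in> L" using L[of "- a" "neg_part a" "pos_part a"] by simp
  qed
  moreover have "I = lattice_ideal_of L"
  proof
    have J: "is_ideal (lattice_ideal_of L :: ('n, 'k) mpoly set)"
      unfolding lattice_ideal_of_def by (rule is_ideal_Idl)
    show "lattice_ideal_of L \<subseteq> I"
      unfolding lattice_ideal_of_def by (rule type_ring.genideal_minimal[OF ideal]) (auto simp: L_def mcong_def)
    show "I \<subseteq> lattice_ideal_of L"
      unfolding B(2)
    proof (rule type_ring.genideal_minimal[OF J], rule subsetI)
      fix g assume g: "g \<in> B"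
      then obtain b c where bc: "g = monomial b - monomial c" using B(1) by blast
      obtain l :: "'n \<Rightarrow>\<^sub>0 int" where
        l: "\<And>i. Poly_Mapping.lookup l i = int (Poly_Mapping.lookup b i) - int (Poly_Mapping.lookup c i)"
        using exists_poly_mapping[of "\<lambda>i. int (Poly_Mapping.lookup b i) - int (Poly_Mapping.lookup c i)"] by blast
      have "mcong I b c" using g bc B(2) Idl_superset[of B] by (auto simp: mcong_def)
      then have "l \<in> L" using L[OF l] by simp
      obtain w where w: "b = w + pos_part l" "c = w + neg_part l" using pos_neg_decomposition[OF l] by blast
      have "monomial (pos_part l) - monomial (neg_part l) \<in> (lattice_ideal_of L :: ('n, 'k) mpoly set)"
        unfolding lattice_ideal_of_def using \<open>l \<in> L\<close> by (intro subsetD[OF Idl_superset]) auto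
      from is_ideal_mult[OF J this, of "monomial w"]
      show "g \<in> lattice_ideal_of L" by (simp add: bc w monomial_add right_diff_distrib)
    qed
  qed
  ultimately show ?thesis by (auto simp: lattice_ideal_def)
qed


section \<open>The irrelevant maximal ideal\<close>

definition irrelevant :: "('n::finite, 'k::field) mpoly set" where
  "irrelevant = {f. Poly_Mapping.lookup f 0 = 0}"

lemma exponent_add_eq_0_iff: "(a :: 'n \<Rightarrow>\<^sub>0 nat) + b = 0 \<longleftrightarrow> a = 0 \<and> b = 0"
  by (auto simp: poly_mapping_eq_iff lookup_add fun_eq_iff)

lemma lookup_0_eq_mlin: "Poly_Mapping.lookup f 0 = mlin (\<lambda>m. if m = 0 then 1 else 0) f"
  by (induction f rule: mpoly_induct) (auto simp: lookup_add mlin_add lookup_single when_def)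

lemma is_prime_irrelevant: "is_prime irrelevant"
  unfolding irrelevant_def lookup_0_eq_mlin
  by (rule is_prime_mlin_kernel) (auto simp: exponent_add_eq_0_iff)

lemma tvar_in_irrelevant: "tvar i \<in> irrelevant"
proof -
  have "Poly_Mapping.single i (1::nat) \<noteq> 0" by (metis lookup_single_eq lookup_zero zero_neq_one)
  then show ?thesis by (simp add: irrelevant_def tvar_def lookup_monomial when_def)
qed

lemma monomial_factor:
  assumes "Poly_Mapping.lookup m i > 0"
  shows "monomial m = tvar i * monomial (m - Poly_Mapping.single i 1)"
proof -
  have "m = Poly_Mapping.single i 1 + (m - Poly_Mapping.single i 1)"
    by (rule poly_mapping_eqI) (use assms in \<open>auto simp: lookup_add lookup_minus lookup_single when_def\<close>)
  then show ?thesis by (metis monomial_add tvar_def)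
qed

lemma irrelevant_subset:
  assumes P: "is_ideal P" "\<And>i. tvar i \<in> P"
  shows "irrelevant \<subseteq> P"
proof
  fix f :: "('a, 'b) mpoly" assume f: "f \<in> irrelevant"
  have "(\<Sum>m\<in>Poly_Mapping.keys f. Poly_Mapping.single m (Poly_Mapping.lookup f m)) \<in> P"
  proof (rule is_ideal_sum[OF P(1)])
    fix m assume "m \<in> Poly_Mapping.keys f"
    then have "m \<noteq> 0" using f by (auto simp: irrelevant_def in_keys_iff)
    then obtain i where "Poly_Mapping.lookup m i > 0" by (metis lookup_zero neq0_conv poly_mapping_eqI)
    then show "Poly_Mapping.single m (Poly_Mapping.lookup f m) \<in> P"
      using P by (subst single_eq_const_mult_monomial) (simp add: monomial_factor is_ideal_mult is_ideal_mult')
  qed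
  then show "f \<in> P" by (simp flip: mpoly_sum_single)
qed

lemma irrelevant_maximal:
  assumes P: "is_ideal P" "1 \<notin> P" "irrelevant \<subseteq> P"
  shows "P = irrelevant"
proof
  show "P \<subseteq> irrelevant"
  proof
    fix f assume f: "f \<in> P"
    let ?c = "Poly_Mapping.lookup f 0"
    have "f - Poly_Mapping.single 0 ?c \<in> P"
      using P(3) by (auto simp: irrelevant_def lookup_minus)
    then have "Poly_Mapping.single 0 ?c \<in> P" using is_ideal_diff[OF P(1) f] by fastforce
    from is_ideal_mult[OF P(1) this, of "Poly_Mapping.single 0 (inverse ?c)"]
    have "?c = 0" using P(2) by (cases "?c = 0") (auto simp: mult_single)
    then show "f \<in> irrelevant" by (simp add: irrelevant_def)
  qed
qed (rule P(3))

text \<open>For positive weights the component of degree 0 is the constant term, and a proper ideal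
  contains no nonzero constant.\<close>

lemma wgraded_subset_irrelevant:
  assumes d: "\<And>i. d i > 0" and P: "is_ideal P" "1 \<notin> P" "wgraded d P"
  shows "P \<subseteq> irrelevant"
proof
  fix f assume f: "f \<in> P"
  let ?c = "Poly_Mapping.lookup f 0"
  have deg0: "weighted_degree d m = 0 \<longleftrightarrow> m = 0" for m
  proof -
    have nz: "(d i = 0) = False" for i using d[of i] by simp
    have "weighted_degree d m = 0 \<longleftrightarrow> (\<forall>i. Poly_Mapping.lookup m i = 0)"
      by (simp add: weighted_degree_def nz)
    then show ?thesis by (auto simp: poly_mapping_eq_iff fun_eq_iff)
  qed
  have "wcomp d 0 f = Poly_Mapping.single 0 ?c"
    by (rule poly_mapping_eqI) (auto simp: lookup_wcomp lookup_single when_def deg0)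
  then have "Poly_Mapping.single 0 ?c \<in> P" using f P(3) by (metis wgraded_def)
  from is_ideal_mult[OF P(1) this, of "Poly_Mapping.single 0 (inverse ?c)"]
  have "?c = 0" using P(2) by (cases "?c = 0") (auto simp: mult_single)
  then show "f \<in> irrelevant" by (simp add: irrelevant_def)
qed

text \<open>Homogeneous generators lie in the core of \<open>I\<close>; as the core is an ideal, it
  is all of \<open>I\<close>.\<close>

lemma graded_ideal_wgraded:
  fixes I :: "('n::finite, 'k::field) mpoly set"
  assumes "graded_ideal I"
  shows "\<exists>d. (\<forall>i. d i > 0) \<and> wgraded d I"
proof -
  obtain d G where d: "\<forall>i. d i > 0" and G: "\<And>g. g \<in> G \<Longrightarrow> homogeneous d g" "I = Idl\<^bsub>mpoly_ring\<^esub> G"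
    using assms unfolding graded_ideal_def by blast
  have I: "is_ideal I" unfolding G(2) by (rule is_ideal_Idl)
  have "G \<subseteq> wcore d I"
  proof
    fix g assume g: "g \<in> G"
    then obtain n where n: "\<forall>m\<in>Poly_Mapping.keys g. weighted_degree d m = n"
      using G(1) by (auto simp: homogeneous_def)
    have "wcomp d k g = (g when k = n)" for k
    proof (rule poly_mapping_eqI)
      fix m
      show "Poly_Mapping.lookup (wcomp d k g) m = Poly_Mapping.lookup (g when k = n) m"
        using n by (cases "m \<in> Poly_Mapping.keys g") (auto simp: lookup_wcomp when_def in_keys_iff)
    qed
    moreover have "g \<in> I" using g G(2) Idl_superset[of G] by auto
    ultimately show "g \<in> wcore d I" using I by (auto simp: wcore_def when_def is_ideal_zero)
  qed
  then have "Idl\<^bsub>mpoly_ring\<^esub> G \<subseteq> wcore d I" by (rule type_ring.genideal_minimal[OF is_ideal_wcore[OF I]])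
  then have "wgraded d I" using G(2) by (auto simp: wgraded_def wcore_def)
  then show ?thesis using d by blast
qed

section \<open>Graded binomial ideals whose variables are parameters\<close>

lemma monomial_mem_prime_iff:
  assumes P: "is_prime P"
  shows "monomial m \<in> P \<longleftrightarrow> (\<exists>i. Poly_Mapping.lookup m i > 0 \<and> tvar i \<in> P)"
proof
  assume "\<exists>i. Poly_Mapping.lookup m i > 0 \<and> tvar i \<in> P"
  then obtain i where "Poly_Mapping.lookup m i > 0" "tvar i \<in> P" by blast
  then show "monomial m \<in> P"
    using is_ideal_mult'[OF is_prime_ideal[OF P]] by (simp add: monomial_factor)
next
  have "\<exists>i\<in>A. Poly_Mapping.lookup m i > 0 \<and> tvar i \<in> P"
    if "(\<Prod>i\<in>A. tvar i ^ Poly_Mapping.lookup m i) \<in> P" for A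
    using that
  proof (induction A rule: infinite_finite_induct)
    case (insert i A)
    then have "tvar i ^ Poly_Mapping.lookup m i \<in> P \<or> (\<Prod>i\<in>A. tvar i ^ Poly_Mapping.lookup m i) \<in> P"
      by (simp add: is_prime_mult_iff[OF P])
    then show ?case
    proof
      assume *: "tvar i ^ Poly_Mapping.lookup m i \<in> P"
      then have "Poly_Mapping.lookup m i \<noteq> 0" using is_prime_one[OF P] by (intro notI) simp
      then show ?thesis using is_prime_power[OF P *] by auto
    qed (use insert in auto)
  qed (use is_prime_one[OF P] in auto)
  then show "monomial m \<in> P \<Longrightarrow> \<exists>i. Poly_Mapping.lookup m i > 0 \<and> tvar i \<in> P"
    unfolding monomial_eq_prod by blast
qed

lemma mem_Idl_Un_singleton_iff:
  fixes t :: "'a::comm_ring_1"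
  assumes I: "is_ideal I"
  shows "f \<in> Idl\<^bsub>ring_of_type_algebra\<^esub> (I \<union> {t}) \<longleftrightarrow> (\<exists>a\<in>I. \<exists>h. f = a + t * h)"
proof
  let ?J = "{f. \<exists>a\<in>I. \<exists>h. f = a + t * h}"
  have "is_ideal ?J"
  proof (rule is_idealI)
    show "0 \<in> ?J" using is_ideal_zero[OF I] by (auto intro!: bexI[of _ 0] exI[of _ 0])
  next
    fix x y assume "x \<in> ?J" "y \<in> ?J"
    then obtain a b h k where "a \<in> I" "b \<in> I" "x = a + t * h" "y = b + t * k" by blast
    then have "a + b \<in> I" "x + y = (a + b) + t * (h + k)"
      by (simp_all add: is_ideal_add[OF I] algebra_simps)
    then show "x + y \<in> ?J" by blast
  next
    fix r x assume "x \<in> ?J"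
    then obtain a h where "a \<in> I" "x = a + t * h" by blast
    then have "r * a \<in> I" "r * x = r * a + t * (r * h)"
      using is_ideal_mult[OF I] by (blast, simp add: algebra_simps)
    then show "r * x \<in> ?J" by blast
  qed
  moreover have "I \<union> {t} \<subseteq> ?J"
  proof
    fix x assume "x \<in> I \<union> {t}"
    then have "x \<in> I \<or> x = t" by auto
    moreover have "x = x + t * 0" "t = 0 + t * 1" by simp_all
    ultimately show "x \<in> ?J" using is_ideal_zero[OF I] by blast
  qed
  ultimately have "Idl\<^bsub>ring_of_type_algebra\<^esub> (I \<union> {t}) \<subseteq> ?J" by (rule type_ring.genideal_minimal)
  then show "f \<in> Idl\<^bsub>ring_of_type_algebra\<^esub> (I \<union> {t}) \<Longrightarrow> \<exists>a\<in>I. \<exists>h. f = a + t * h" by blast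
next
  assume "\<exists>a\<in>I. \<exists>h. f = a + t * h"
  then obtain a h where ah: "a \<in> I" "f = a + t * h" by blast
  have "a \<in> Idl\<^bsub>ring_of_type_algebra\<^esub> (I \<union> {t})" "t \<in> Idl\<^bsub>ring_of_type_algebra\<^esub> (I \<union> {t})"
    using Idl_superset[of "I \<union> {t}"] ah(1) by auto
  then show "f \<in> Idl\<^bsub>ring_of_type_algebra\<^esub> (I \<union> {t})"
    unfolding ah(2) by (intro is_ideal_add is_ideal_mult' is_ideal_Idl)
qed

text \<open>Passing to the core for the grading by the degree in \<open>y\<close> loses the binomial in \<open>x\<close> and \<open>y\<close>
  but keeps those in \<open>x\<close> and the remaining variables.\<close>
lemma prime_chain_of_binomials:
  fixes P :: "('n::finite, 'k::field) mpoly set"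
  assumes "is_prime P" "\<And>i. tvar i \<notin> P" "distinct ys" "x \<notin> set ys"
    and "\<And>y. y \<in> set ys \<Longrightarrow> \<exists>N N' k k'. N \<noteq> N' \<and>
      mcong P (Poly_Mapping.single y N + Poly_Mapping.single x k) (Poly_Mapping.single y N' + Poly_Mapping.single x k')"
  shows "prime_chain mpoly_ring (length ys) P"
  using assms
proof (induction ys arbitrary: P)
  case Nil
  then show ?case by (simp add: prime_chain_0)
next
  case (Cons y ys)
  note P = Cons.prems(1) and Pi = is_prime_ideal[OF Cons.prems(1)]
  define w :: "'n \<Rightarrow> nat" where "w i = (if i = y then 1 else 0)" for i
  let ?Q = "wcore w P"
  have Q: "is_prime ?Q" "?Q \<subseteq> P" using is_prime_wcore[OF P] wcore_subset[OF Pi] by auto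
  have "prime_chain mpoly_ring (length ys) ?Q"
  proof (rule Cons.IH[OF Q(1)])
    show "tvar i \<notin> ?Q" for i using Cons.prems(2)[of i] Q(2) by blast
    fix z assume z: "z \<in> set ys"
    have "\<exists>N N' k k'. N \<noteq> N' \<and>
      mcong P (Poly_Mapping.single z N + Poly_Mapping.single x k) (Poly_Mapping.single z N' + Poly_Mapping.single x k')"
      by (rule Cons.prems(5)) (use z in simp)
    then obtain N N' k k' where N: "N \<noteq> N'"
      and mem: "monomial (Poly_Mapping.single z N + Poly_Mapping.single x k)
        - monomial (Poly_Mapping.single z N' + Poly_Mapping.single x k') \<in> P" (is "?g \<in> P")
      unfolding mcong_def by blast
    have ne: "z \<noteq> y" "x \<noteq> y" using z Cons.prems(3,4) by auto
    have "wcomp w j ?g = (?g when j = 0)" for j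
      by (auto simp: wcomp_diff wcomp_monomial weighted_degree_add w_def ne when_def)
    then have "?g \<in> ?Q" using mem is_ideal_zero[OF Pi] by (simp add: wcore_def when_def)
    then show "\<exists>N N' k k'. N \<noteq> N' \<and>
      mcong ?Q (Poly_Mapping.single z N + Poly_Mapping.single x k) (Poly_Mapping.single z N' + Poly_Mapping.single x k')"
      using N unfolding mcong_def by blast
  qed (use Cons.prems in auto)
  moreover have "?Q \<subset> P"
  proof -
    have "\<exists>N N' k k'. N \<noteq> N' \<and>
      mcong P (Poly_Mapping.single y N + Poly_Mapping.single x k) (Poly_Mapping.single y N' + Poly_Mapping.single x k')"
      by (rule Cons.prems(5)) simp
    then obtain N N' k k' where N: "N \<noteq> N'"
      and mem: "monomial (Poly_Mapping.single y N + Poly_Mapping.single x k)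
        - monomial (Poly_Mapping.single y N' + Poly_Mapping.single x k') \<in> P" (is "?g \<in> P")
      unfolding mcong_def by blast
    have ne: "x \<noteq> y" using Cons.prems(4) by auto
    \<comment> \<open>The two terms differ in their degree in \<open>y\<close>, so one of them alone
      is a component; a prime without variables contains no monomial.\<close>
    have "wcomp w N ?g = monomial (Poly_Mapping.single y N + Poly_Mapping.single x k)"
      using N by (auto simp: wcomp_diff wcomp_monomial weighted_degree_add w_def ne when_def)
    moreover have "monomial (Poly_Mapping.single y N + Poly_Mapping.single x k) \<notin> P"
      using monomial_mem_prime_iff[OF P] Cons.prems(2) by blast
    ultimately have "?g \<notin> ?Q" by (auto simp: wcore_def) metis
    then show ?thesis using mem Q(2) by blast
  qed
  ultimately show ?case using prime_chain_SucI[OF _ _ P] by simp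
qed

section \<open>Primes over the ideal and the dimension of the quotient\<close>

locale graded_binomial =
  fixes I :: "('n::finite, 'k::field) mpoly set" and d :: "'n \<Rightarrow> nat"
  assumes binomial: "binomial_ideal I"
    and d_pos: "\<And>i. d i > 0" and graded: "wgraded d I"
    and zeros: "\<And>i. zero_set (Idl\<^bsub>mpoly_ring\<^esub> (I \<union> {tvar i})) = {\<lambda>_. 0}"
begin

lemma ideal_I: "is_ideal I"
  using binomial is_ideal_Idl by (auto simp: binomial_ideal_def)

lemma generators:
  obtains B where "\<And>g. g \<in> B \<Longrightarrow> \<exists>b c. g = monomial b - monomial c" "I = Idl\<^bsub>mpoly_ring\<^esub> B"
  using binomial by (auto simp: binomial_ideal_def)

lemma subset_kernel: "I \<subseteq> {f. mlin (\<lambda>_. 1) f = 0}"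
proof -
  obtain B where B: "\<And>g. g \<in> B \<Longrightarrow> \<exists>b c. g = monomial b - monomial c" "I = Idl\<^bsub>mpoly_ring\<^esub> B"
    by (rule generators) blast
  have "is_ideal {f :: ('n, 'k) mpoly. mlin (\<lambda>_. 1) f = 0}"
    by (rule is_prime_ideal[OF is_prime_mlin_kernel]) auto
  then show ?thesis
    unfolding B(2) by (rule type_ring.genideal_minimal) (use B(1) in \<open>force simp: mlin_diff\<close>)
qed

lemma monomial_notin: "monomial m \<notin> I"
  using subset_kernel by auto

text \<open>The ideal of the all-ones point contains \<open>I\<close> but is not inside
  \<open>irrelevant\<close>; its core is, being graded and proper.\<close>

definition base_prime :: "('n, 'k) mpoly set" where
  "base_prime = wcore d {f. mlin (\<lambda>_. 1) f = 0}"

lemma base_prime: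
  "is_prime base_prime" "I \<subseteq> base_prime" "base_prime \<subset> irrelevant" "tvar i \<notin> base_prime"
proof -
  let ?K = "{f :: ('n, 'k) mpoly. mlin (\<lambda>_. 1) f = 0}"
  have K: "is_prime ?K" by (rule is_prime_mlin_kernel) auto
  then show P: "is_prime base_prime" unfolding base_prime_def by (rule is_prime_wcore)
  show "I \<subseteq> base_prime"
    unfolding base_prime_def by (rule subset_wcore[OF graded subset_kernel])
  have sub: "base_prime \<subseteq> ?K" unfolding base_prime_def by (rule wcore_subset[OF is_prime_ideal[OF K]])
  show tv: "tvar i \<notin> base_prime" for i using sub by (auto simp: tvar_def)
  have "base_prime \<subseteq> irrelevant"
    by (rule wgraded_subset_irrelevant[where d = d, OF d_pos is_prime_ideal[OF P] is_prime_one[OF P]])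
      (simp add: base_prime_def wgraded_wcore[OF is_prime_ideal[OF K]])
  then show "base_prime \<subset> irrelevant" using tv tvar_in_irrelevant by blast
qed

lemma subset_irrelevant: "I \<subseteq> irrelevant"
  using base_prime by blast

text \<open>The variables outside \<open>P\<close> define a \<open>0/1\<close> point of \<open>V(I, t\<^sub>i)\<close>; being over the prime field,
  it is visible in \<open>K\<^sup>s\<close> even if \<open>K\<close> is not algebraically closed.\<close>
lemma prime_with_variable:
  assumes P: "is_prime P" "I \<subseteq> P" "tvar i \<in> P"
  shows "P = irrelevant"
proof -
  define x :: "'n \<Rightarrow> 'k" where "x j = (if tvar j \<in> P then 0 else 1)" for j
  have eval: "poly_eval (monomial m) x = (if monomial m \<in> P then 0 else 1)" for m
  proof (cases "monomial m \<in> P")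
    case True
    then obtain j where "Poly_Mapping.lookup m j > 0" "tvar j \<in> P"
      unfolding monomial_mem_prime_iff[OF P(1)] by blast
    then have "x j ^ Poly_Mapping.lookup m j = 0" by (simp add: x_def)
    then have "(\<Prod>j\<in>UNIV. x j ^ Poly_Mapping.lookup m j) = 0" by (intro prod_zero) auto
    then show ?thesis using True by (simp add: poly_eval_eq_mlin)
  next
    case False
    then have "tvar j \<notin> P \<or> Poly_Mapping.lookup m j = 0" for j
      unfolding monomial_mem_prime_iff[OF P(1)] by auto
    then have "x j ^ Poly_Mapping.lookup m j = 1" for j
      using x_def[of j] by (metis power_0 power_one)
    then show ?thesis using False by (simp add: poly_eval_eq_mlin)
  qed
  obtain B where B: "\<And>g. g \<in> B \<Longrightarrow> \<exists>b c. g = monomial b - monomial c" "I = Idl\<^bsub>mpoly_ring\<^esub> B"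
    by (rule generators) blast
  have "poly_eval g x = 0" if "g \<in> B" for g
  proof -
    obtain b c where g: "g = monomial b - monomial c" using B(1) \<open>g \<in> B\<close> by blast
    have "g \<in> P" using \<open>g \<in> B\<close> B(2) Idl_superset[of B] P(2) by blast
    then have "monomial b \<in> P \<longleftrightarrow> monomial c \<in> P"
      using is_ideal_add_iff[OF is_prime_ideal[OF P(1)] \<open>g \<in> P\<close>, of "monomial c"] by (simp add: g)
    then have "poly_eval (monomial b) x = poly_eval (monomial c) x" unfolding eval by simp
    then show ?thesis unfolding g poly_eval_eq_mlin mlin_diff by simp
  qed
  then have "x \<in> zero_set I" unfolding B(2) by (rule mem_zero_set_IdlI)
  moreover have "poly_eval (tvar i) x = 0" using eval[of "Poly_Mapping.single i 1"] P(3) by (simp add: tvar_def)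
  ultimately have "x \<in> zero_set (Idl\<^bsub>mpoly_ring\<^esub> (I \<union> {tvar i}))"
    by (intro mem_zero_set_IdlI) (auto simp: zero_set_def)
  then have "x = (\<lambda>_. 0)" using zeros[of i] by blast
  then have "x j = 0" for j by simp
  then have "tvar j \<in> P" for j unfolding x_def by (metis zero_neq_one)
  then have "irrelevant \<subseteq> P" by (rule irrelevant_subset[OF is_prime_ideal[OF P(1)]])
  then show ?thesis by (rule irrelevant_maximal[OF is_prime_ideal[OF P(1)] is_prime_one[OF P(1)]])
qed

text \<open>Otherwise a prime over \<open>I\<close> containing \<open>tvar i\<close> would miss all
  powers of \<open>tvar j\<close>, while \<open>prime_with_variable\<close> identifies it with
  \<open>irrelevant\<close>.\<close>

lemma tvar_power_in_Idl: "\<exists>n. tvar j ^ n \<in> Idl\<^bsub>mpoly_ring\<^esub> (I \<union> {tvar i})"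
proof (rule ccontr)
  let ?J = "Idl\<^bsub>mpoly_ring\<^esub> (I \<union> {tvar i}) :: ('n, 'k) mpoly set"
  let ?W = "range (\<lambda>n::nat. tvar j ^ n :: ('n, 'k) mpoly)"
  assume no: "\<nexists>n. tvar j ^ n \<in> ?J"
  obtain g where g: "is_prime (colon_ideal mpoly_ring ?J g)" "colon_ideal mpoly_ring ?J g \<inter> ?W = {}"
  proof (rule mpoly.exists_prime_colon[of ?J ?W])
    show "is_ideal ?J" by (rule is_ideal_Idl)
    show "\<one>\<^bsub>mpoly_ring\<^esub> \<in> ?W" by (auto intro!: image_eqI[of _ _ 0])
    show "a \<otimes>\<^bsub>mpoly_ring\<^esub> b \<in> ?W" if "a \<in> ?W" "b \<in> ?W" for a b
      using that by (auto simp flip: power_add)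
    show "?W \<inter> ?J = {}" using no by blast
  qed auto
  let ?P = "colon_ideal mpoly_ring ?J g"
  have sub: "?J \<subseteq> ?P" by (rule type_ring.ideal_subset_colon[OF is_ideal_Idl]) simp
  have "I \<subseteq> ?P" "tvar i \<in> ?P" using sub Idl_superset[of "I \<union> {tvar i}"] by blast+
  then have "?P = irrelevant" using prime_with_variable[OF g(1)] by blast
  moreover have "tvar j ^ 1 \<in> ?W" by blast
  ultimately show False using g(2) tvar_in_irrelevant[of j] by auto
qed

lemma uniform_power: "\<exists>n\<ge>1. \<forall>i j. tvar j ^ n \<in> Idl\<^bsub>mpoly_ring\<^esub> (I \<union> {tvar i})"
proof -
  define N where "N i j = (SOME n. tvar j ^ n \<in> Idl\<^bsub>mpoly_ring\<^esub> (I \<union> {tvar i}))" for i j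
  have N: "tvar j ^ N i j \<in> Idl\<^bsub>mpoly_ring\<^esub> (I \<union> {tvar i})" for i j
    unfolding N_def by (rule someI_ex[OF tvar_power_in_Idl])
  define n where "n = Suc (\<Sum>i\<in>UNIV. \<Sum>j\<in>UNIV. N i j)"
  have "N i j \<le> n" for i j
  proof -
    have "N i j \<le> (\<Sum>j\<in>UNIV. N i j)" by (rule member_le_sum) auto
    also have "\<dots> \<le> (\<Sum>i\<in>UNIV. \<Sum>j\<in>UNIV. N i j)" by (rule member_le_sum) auto
    finally show ?thesis by (simp add: n_def)
  qed
  then have "tvar j ^ n = tvar j ^ (n - N i j) * (tvar j ^ N i j :: ('n, 'k) mpoly)" for i j
    by (simp flip: power_add)
  then have "tvar j ^ n \<in> Idl\<^bsub>mpoly_ring\<^esub> (I \<union> {tvar i})" for i j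
    using is_ideal_mult[OF is_ideal_Idl N, of "tvar j ^ (n - N i j)" j i] by simp
  then show ?thesis by (intro exI[of _ n]) (auto simp: n_def)
qed

text \<open>With unequal degrees, \<open>monomial b\<close> would be a component of an element of
  \<open>I\<close>, hence a monomial in \<open>I\<close>.\<close>

lemma mcong_degree:
  assumes "mcong I b c"
  shows "weighted_degree d b = weighted_degree d c"
proof (rule ccontr)
  assume ne: "weighted_degree d b \<noteq> weighted_degree d c"
  have "wcomp d (weighted_degree d b) (monomial b - monomial c) \<in> I"
    using assms graded by (auto simp: mcong_def wgraded_def)
  then show False using ne monomial_notin by (simp add: wcomp_diff wcomp_monomial when_def)
qed

text \<open>Write \<open>tvar j ^ n = a + tvar x * h\<close> and sum the coefficients over the
  congruence class of the left-hand side. This gives 1 on the left and 0 for \<open>a\<close> in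
  \<open>I\<close>; if the class had no multiple of \<open>tvar x\<close>, the last term would give
  0 as well.\<close>

lemma mcong_variable_factor:
  assumes "tvar j ^ n \<in> Idl\<^bsub>mpoly_ring\<^esub> (I \<union> {tvar x})"
  shows "\<exists>c. mcong I (Poly_Mapping.single j n) (Poly_Mapping.single x 1 + c)"
proof (rule ccontr)
  assume no: "\<nexists>c. mcong I (Poly_Mapping.single j n) (Poly_Mapping.single x 1 + c)"
  obtain a h where ah: "a \<in> I" "tvar j ^ n = a + tvar x * h"
    using assms mem_Idl_Un_singleton_iff[OF ideal_I] by blast
  define \<mu> :: "_ \<Rightarrow> 'k" where "\<mu> b = (if mcong I (Poly_Mapping.single j n) b then 1 else 0)" for b
  obtain B where B: "\<And>g. g \<in> B \<Longrightarrow> \<exists>b c. g = monomial b - monomial c" "I = Idl\<^bsub>mpoly_ring\<^esub> B"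
    by (rule generators) blast
  have "mlin \<mu> a = 0"
  proof (rule mlin_invariant_Idl[where E = "mcong I" and B = B])
    fix g assume g: "g \<in> B"
    then obtain b c where bc: "g = monomial b - monomial c" using B(1) by blast
    have "g \<in> I" using g B(2) Idl_superset[of B] by blast
    then show "\<exists>b c. g = monomial b - monomial c \<and> mcong I b c" using bc unfolding mcong_def by blast
  next
    show "a \<in> Idl\<^bsub>mpoly_ring\<^esub> B" using ah(1) B(2) by simp
    show "mcong I (m + b) (m + c)" if "mcong I b c" for m b c
      using mcong_add[OF ideal_I that] .
    show "\<mu> b = \<mu> c" if bc: "mcong I b c" for b c
      using mcong_trans[OF ideal_I _ bc] mcong_trans[OF ideal_I _ mcong_sym[OF ideal_I bc]]
      by (auto simp: \<mu>_def)
  qed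
  moreover have "mlin \<mu> (tvar x * h) = 0"
    using no by (simp add: tvar_def monomial_def mlin_single_mult \<mu>_def) (simp add: mlin_def)
  ultimately have "mlin \<mu> (tvar j ^ n) = 0" by (simp add: ah(2) mlin_add)
  then show False using mcong_refl[OF ideal_I] by (simp add: tvar_power \<mu>_def)
qed

text \<open>While some exponent other than that of \<open>t\<^sub>x\<close> exceeds \<open>n\<close>, a further factor \<open>t\<^sub>x\<close> can be
  split off; since the degree is preserved, this terminates.\<close>
lemma mcong_normal_form:
  assumes n: "\<And>j. tvar j ^ n \<in> Idl\<^bsub>mpoly_ring\<^esub> (I \<union> {tvar x})"
  shows "\<exists>k. \<exists>c\<in>exponent_box n. mcong I b (Poly_Mapping.single x k + c)"
proof (induction "weighted_degree d b - d x * Poly_Mapping.lookup b x" arbitrary: b rule: less_induct)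
  case less
  show ?case
  proof (cases "\<forall>j. j \<noteq> x \<longrightarrow> Poly_Mapping.lookup b j \<le> n")
    case True
    let ?c = "b - Poly_Mapping.single x (Poly_Mapping.lookup b x)"
    have "b = Poly_Mapping.single x (Poly_Mapping.lookup b x) + ?c"
      by (rule poly_mapping_eqI) (auto simp: lookup_add lookup_minus lookup_single when_def)
    moreover have "?c \<in> exponent_box n"
      using True by (auto simp: exponent_box_def lookup_minus lookup_single when_def)
    ultimately show ?thesis using mcong_refl[OF ideal_I, of b] by metis
  next
    case False
    then obtain j where j: "j \<noteq> x" "n \<le> Poly_Mapping.lookup b j" by force
    obtain c where c: "mcong I (Poly_Mapping.single j n) (Poly_Mapping.single x 1 + c)"
      using mcong_variable_factor[OF n] by blast
    define b2 where "b2 = b - Poly_Mapping.single j n"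
    define b1 where "b1 = b2 + (Poly_Mapping.single x 1 + c)"
    have b: "b = b2 + Poly_Mapping.single j n"
      by (rule poly_mapping_eqI) (use j in \<open>auto simp: b2_def lookup_add lookup_minus lookup_single when_def\<close>)
    have bb1: "mcong I b b1" unfolding b1_def by (subst b) (rule mcong_add[OF ideal_I c])
    have "Poly_Mapping.lookup b2 x = Poly_Mapping.lookup b x"
      using j by (simp add: b2_def lookup_minus lookup_single when_def)
    then have "Poly_Mapping.lookup b x < Poly_Mapping.lookup b1 x"
      by (simp add: b1_def lookup_add)
    then have "d x * Poly_Mapping.lookup b x < d x * Poly_Mapping.lookup b1 x" using d_pos[of x] by simp
    \<comment> \<open>The measure is the degree outside \<open>tvar x\<close>; this bound keeps
      truncation from hiding its decrease.\<close>
    moreover have "d x * Poly_Mapping.lookup b1 x \<le> weighted_degree d b1"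
      unfolding weighted_degree_def by (rule member_le_sum) auto
    ultimately have "weighted_degree d b1 - d x * Poly_Mapping.lookup b1 x
      < weighted_degree d b - d x * Poly_Mapping.lookup b x"
      using mcong_degree[OF bb1] by linarith
    then obtain k c where "c \<in> exponent_box n" "mcong I b1 (Poly_Mapping.single x k + c)"
      using less.hyps by blast
    then show ?thesis using mcong_trans[OF ideal_I bb1] by blast
  qed
qed

text \<open>The box parts \<open>c N\<close> of the normal forms of the powers of
  \<open>tvar y\<close> range over a finite set, so two agree. Multiplying each of the two
  congruences by the power of \<open>tvar x\<close> in the other makes the right-hand sides
  equal.\<close>

lemma binomial_relation:
  "\<exists>N N' k k'. N \<noteq> N' \<and>
    mcong I (Poly_Mapping.single y N + Poly_Mapping.single x k) (Poly_Mapping.single y N' + Poly_Mapping.single x k')"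
proof -
  obtain n where n: "\<And>i j. tvar j ^ n \<in> Idl\<^bsub>mpoly_ring\<^esub> (I \<union> {tvar i})"
    using uniform_power by blast
  have "\<forall>N. \<exists>k c. c \<in> exponent_box n \<and> mcong I (Poly_Mapping.single y N) (Poly_Mapping.single x k + c)"
    using mcong_normal_form[OF n] by blast
  from choice[OF this] obtain k where
    "\<forall>N. \<exists>c. c \<in> exponent_box n \<and> mcong I (Poly_Mapping.single y N) (Poly_Mapping.single x (k N) + c)"
    by blast
  from choice[OF this] obtain c where kc: "\<And>N. c N \<in> exponent_box n"
    "\<And>N. mcong I (Poly_Mapping.single y N) (Poly_Mapping.single x (k N) + c N)"
    by blast
  have "finite (range c)"
    by (rule finite_subset[OF _ exponent_box_card(1)[of n]]) (use kc(1) in auto)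
  then have "\<not> inj c" using range_inj_infinite by blast
  then obtain N N' :: nat where N: "N \<noteq> N'" "c N = c N'" by (auto simp: inj_def)
  have 1: "mcong I (Poly_Mapping.single y N + Poly_Mapping.single x (k N'))
      (Poly_Mapping.single x (k N) + c N + Poly_Mapping.single x (k N'))"
    by (rule mcong_add2[OF ideal_I kc(2) mcong_refl[OF ideal_I]])
  have 2: "mcong I (Poly_Mapping.single y N' + Poly_Mapping.single x (k N))
      (Poly_Mapping.single x (k N') + c N' + Poly_Mapping.single x (k N))"
    by (rule mcong_add2[OF ideal_I kc(2) mcong_refl[OF ideal_I]])
  have "Poly_Mapping.single x (k N') + c N' + Poly_Mapping.single x (k N)
    = Poly_Mapping.single x (k N) + c N + Poly_Mapping.single x (k N')"
    by (simp add: N(2) ac_simps)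
  then have "mcong I (Poly_Mapping.single y N + Poly_Mapping.single x (k N'))
      (Poly_Mapping.single y N' + Poly_Mapping.single x (k N))"
    using mcong_trans[OF ideal_I 1] mcong_sym[OF ideal_I 2] by simp
  then show ?thesis using N(1) by blast
qed

lemma prime_chain_below:
  assumes P: "is_prime P" "I \<subseteq> P" "P \<noteq> irrelevant"
  shows "prime_chain mpoly_ring (card (UNIV :: 'n set) - 1) P"
proof -
  obtain x :: 'n where True by blast
  obtain ys where ys: "set ys = UNIV - {x}" "distinct ys"
    using finite_distinct_list[of "UNIV - {x}"] by auto
  have "prime_chain mpoly_ring (length ys) P"
  proof (rule prime_chain_of_binomials[OF P(1)])
    show "tvar i \<notin> P" for i using prime_with_variable[OF P(1,2)] P(3) by blast
    show "\<exists>N N' k k'. N \<noteq> N' \<and>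
      mcong P (Poly_Mapping.single y N + Poly_Mapping.single x k) (Poly_Mapping.single y N' + Poly_Mapping.single x k')"
      for y
      using binomial_relation[of y x] P(2) unfolding mcong_def by blast
  qed (use ys in auto)
  moreover have "length ys = card (UNIV :: 'n set) - 1"
    using distinct_card[OF ys(2)] ys(1) by (simp add: card_Diff_singleton)
  ultimately show ?thesis by simp
qed

text \<open>The dimension bound for the quotient: \<open>s - 1\<close> steps below
  \<open>P\<^sub>0\<close>, which is not maximal, and two steps above it are too many.\<close>

lemma no_long_chain:
  assumes "is_prime P\<^sub>0" "is_prime P\<^sub>1" "is_prime P\<^sub>2" "I \<subseteq> P\<^sub>0" "P\<^sub>0 \<subset> P\<^sub>1" "P\<^sub>1 \<subset> P\<^sub>2"
  shows False
proof -
  have "P\<^sub>0 \<noteq> irrelevant"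
  proof
    assume "P\<^sub>0 = irrelevant"
    then have "irrelevant \<subseteq> P\<^sub>1" using assms(5) by simp
    from irrelevant_maximal[OF is_prime_ideal[OF assms(2)] is_prime_one[OF assms(2)] this]
    show False using assms(5) \<open>P\<^sub>0 = irrelevant\<close> by simp
  qed
  then have "prime_chain mpoly_ring (card (UNIV :: 'n set) - 1) P\<^sub>0"
    by (rule prime_chain_below[OF assms(1,4)])
  then have "prime_chain mpoly_ring (Suc (Suc (card (UNIV :: 'n set) - 1))) P\<^sub>2"
    by (rule prime_chain_SucI[OF prime_chain_SucI[OF _ assms(5,2)] assms(6,3)])
  then show False using prime_chain_length_le by fastforce
qed

section \<open>Regularity of the variables and the prime \<open>irrelevant\<close>\<close>

definition regular :: bool where
  "regular \<longleftrightarrow> (\<forall>i f. f * tvar i \<in> I \<longrightarrow> f \<in> I)"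

lemma regular_iff_lattice: "regular \<longleftrightarrow> lattice_ideal I"
  unfolding regular_def using regular_imp_lattice_ideal[OF binomial] lattice_ideal_regular by blast

text \<open>Modulo \<open>I\<close> a power of \<open>tvar x\<close> is a multiple of
  \<open>tvar i\<close>, so an \<open>f\<close> killed by \<open>tvar i\<close> is killed by that
  power too. This is why condition (d) can speak of one variable only.\<close>

lemma regular_if_one_regular:
  assumes one: "\<And>f. f * tvar x \<in> I \<Longrightarrow> f \<in> I"
  shows regular
  unfolding regular_def
proof (intro allI impI)
  fix i f assume f: "f * tvar i \<in> I"
  obtain n where n: "tvar x ^ n \<in> Idl\<^bsub>mpoly_ring\<^esub> (I \<union> {tvar i})"
    using tvar_power_in_Idl by blast
  then obtain a h where ah: "a \<in> I" "tvar x ^ n = a + tvar i * h"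
    using mem_Idl_Un_singleton_iff[OF ideal_I] by blast
  have "f * tvar x ^ n = f * a + f * tvar i * h" by (simp add: ah(2) algebra_simps)
  also have "\<dots> \<in> I"
    by (rule is_ideal_add[OF ideal_I is_ideal_mult[OF ideal_I ah(1)] is_ideal_mult'[OF ideal_I f]])
  finally have "f * tvar x ^ n \<in> I" .
  then show "f \<in> I"
  proof (induction n)
    case (Suc n)
    have "f * tvar x ^ n * tvar x \<in> I" using Suc.prems by (simp add: ac_simps)
    then show ?case using one Suc.IH by blast
  qed simp
qed

text \<open>If \<open>tvar x\<close> kills some nonzero class of \<open>f\<close> modulo
  \<open>I\<close>, then powers of all variables kill it, so only finitely many monomials keep
  \<open>f\<close> outside \<open>I\<close>. Multiplying \<open>f\<close> by one of maximal weighted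
  degree gives an element whose colon ideal is \<open>irrelevant\<close>.\<close>

lemma regular_iff_not_associated: "regular \<longleftrightarrow> irrelevant \<notin> associated_primes mpoly_ring I"
proof
  assume reg: regular
  show "irrelevant \<notin> associated_primes mpoly_ring I"
  proof
    assume "irrelevant \<in> associated_primes mpoly_ring I"
    then obtain g where g: "irrelevant = colon_ideal mpoly_ring I g" by (auto simp: associated_primes_def)
    then have "g * tvar i \<in> I" for i
      using tvar_in_irrelevant[of i] by (auto simp: mult.commute)
    then have "g \<in> I" using reg by (auto simp: regular_def)
    then have "1 \<in> colon_ideal mpoly_ring I g" by simp
    moreover have "(1 :: ('n, 'k) mpoly) \<notin> irrelevant" by (rule is_prime_one[OF is_prime_irrelevant])
    ultimately show False using g by simp
  qed
next
  assume not: "irrelevant \<notin> associated_primes mpoly_ring I"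
  show regular
  proof (rule ccontr)
    assume "\<not> regular"
    then obtain x f where f: "f * tvar x \<in> I" "f \<notin> I" by (auto simp: regular_def)
    obtain n where n: "\<And>i j. tvar j ^ n \<in> Idl\<^bsub>mpoly_ring\<^esub> (I \<union> {tvar i})"
      using uniform_power by blast
    have fn: "f * tvar j ^ n \<in> I" for j
    proof -
      obtain a h where ah: "a \<in> I" "tvar j ^ n = a + tvar x * h"
        using n mem_Idl_Un_singleton_iff[OF ideal_I] by blast
      have "f * tvar j ^ n = f * a + f * tvar x * h" by (simp add: ah(2) algebra_simps)
      also have "\<dots> \<in> I"
        by (rule is_ideal_add[OF ideal_I is_ideal_mult[OF ideal_I ah(1)] is_ideal_mult'[OF ideal_I f(1)]])
      finally show ?thesis .
    qed
    define U where "U = {u. f * monomial u \<notin> I}"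
    have "U \<subseteq> exponent_box n"
    proof
      fix u assume u: "u \<in> U"
      have "Poly_Mapping.lookup u j \<le> n" for j
      proof (rule ccontr)
        assume "\<not> Poly_Mapping.lookup u j \<le> n"
        then have "u = Poly_Mapping.single j n + (u - Poly_Mapping.single j n)"
          by (intro poly_mapping_eqI) (auto simp: lookup_add lookup_minus lookup_single when_def)
        then have "monomial u = tvar j ^ n * (monomial (u - Poly_Mapping.single j n) :: ('n, 'k) mpoly)"
          unfolding tvar_power by (metis monomial_add)
        then have "f * monomial u = f * tvar j ^ n * monomial (u - Poly_Mapping.single j n)"
          by (simp add: mult.assoc)
        then have "f * monomial u \<in> I" using is_ideal_mult'[OF ideal_I fn] by simp
        then show False using u by (simp add: U_def)
      qed
      then show "u \<in> exponent_box n" by (simp add: exponent_box_def)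
    qed
    then have finU: "finite U" using exponent_box_card(1) by (rule finite_subset)
    have "0 \<in> U" using f(2) by (simp add: U_def)
    then have "weighted_degree d ` U \<noteq> {}" "finite (weighted_degree d ` U)" using finU by auto
    then have "Max (weighted_degree d ` U) \<in> weighted_degree d ` U" by (intro Max_in)
    then obtain u where u: "u \<in> U" "Max (weighted_degree d ` U) = weighted_degree d u" by blast
    have max: "weighted_degree d v \<le> weighted_degree d u" if "v \<in> U" for v
      using Max_ge[OF finite_imageI[OF finU], of "weighted_degree d v" "weighted_degree d"] that u(2) by simp
    let ?P = "colon_ideal mpoly_ring I (f * monomial u)"
    have P: "is_ideal ?P" by (rule type_ring.colon_ideal_is_ideal[OF ideal_I]) simp
    have "tvar j \<in> ?P" for j
    proof -
      have "Poly_Mapping.single j 1 + u \<notin> U"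
        using max[of "Poly_Mapping.single j 1 + u"] d_pos[of j] by (auto simp: weighted_degree_add)
      then have "f * monomial (Poly_Mapping.single j 1 + u) \<in> I" by (simp add: U_def)
      then show ?thesis by (simp add: monomial_add tvar_def ac_simps)
    qed
    then have "irrelevant \<subseteq> ?P" by (rule irrelevant_subset[OF P])
    moreover have "1 \<notin> ?P" using u(1) by (simp add: U_def)
    ultimately have "?P = irrelevant" using irrelevant_maximal[OF P] by blast
    then have "irrelevant \<in> associated_primes mpoly_ring I"
      using is_prime_irrelevant by (auto simp: associated_primes_def)
    then show False using not by contradiction
  qed
qed

end

section \<open>Associated primes of the ideal\<close>

context graded_binomial
begin

abbreviation quotient_ring :: "('n, 'k) mpoly set ring" where
  "quotient_ring \<equiv> mpoly_ring Quot I"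

lemma associated_prime:
  assumes "P \<in> associated_primes mpoly_ring I"
  shows "is_prime P" "I \<subseteq> P" "P \<subseteq> irrelevant"
proof -
  obtain g where g: "P = colon_ideal mpoly_ring I g" and P: "is_prime P"
    using assms by (auto simp: associated_primes_def)
  show "is_prime P" by (rule P)
  show "I \<subseteq> P" unfolding g by (rule type_ring.ideal_subset_colon[OF ideal_I]) simp
  show "P \<subseteq> irrelevant"
    by (rule wgraded_subset_irrelevant[where d = d, OF d_pos is_prime_ideal[OF P] is_prime_one[OF P]
          associated_prime_wgraded[OF ideal_I graded assms]])
qed

text \<open>A smaller prime would start the forbidden chain \<open>P'\<close>, \<open>P\<close>,
  \<open>irrelevant\<close>, since associated primes lie inside \<open>irrelevant\<close>.\<close>

lemma associated_prime_no_smaller: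
  assumes "regular" "P \<in> associated_primes mpoly_ring I" "is_prime P'" "I \<subseteq> P'" "P' \<subseteq> P"
  shows "P' = P"
proof (rule ccontr)
  assume "P' \<noteq> P"
  moreover have "P \<noteq> irrelevant" using assms(1,2) regular_iff_not_associated by blast
  ultimately have "P' \<subset> P" "P \<subset> irrelevant" using associated_prime(3)[OF assms(2)] assms(5) by blast+
  then show False
    using no_long_chain[OF assms(3) associated_prime(1)[OF assms(2)] is_prime_irrelevant assms(4)] by blast
qed

lemma associated_prime_minimal:
  assumes "regular" "P \<in> associated_primes mpoly_ring I"
  shows "P \<in> minimal_primes mpoly_ring I"
  using associated_prime[OF assms(2)] associated_prime_no_smaller[OF assms]
  by (auto simp: minimal_primes_def)

lemma height_le: "prime_height mpoly_ring (P :: ('n, 'k) mpoly set) \<le> enat (card (UNIV :: 'n set))"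
  by (rule prime_height_le) (rule prime_chain_length_le)

subsection \<open>Saturation and colon ideals\<close>

lemma regular_iff_saturation: "regular \<longleftrightarrow> I = saturation mpoly_ring I (\<Prod>i\<in>UNIV. tvar i)"
proof
  let ?h = "\<Prod>i\<in>UNIV. tvar i :: ('n, 'k) mpoly"
  have mem: "f \<in> saturation mpoly_ring I ?h \<longleftrightarrow> (\<exists>k\<ge>1. f * ?h ^ k \<in> I)" for f
    by (auto simp: saturation_def)
  {
    assume reg: regular
    obtain m :: "'n \<Rightarrow>\<^sub>0 nat" where "\<And>i. Poly_Mapping.lookup m i = 1"
      using exists_poly_mapping[of "\<lambda>_. 1"] by blast
    then have h: "?h = monomial m" by (simp add: monomial_eq_prod)
    have cancel: "f \<in> I" if "f * ?h ^ k \<in> I" for f k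
      using that
    proof (induction k)
      case (Suc k)
      have "f * ?h ^ k * monomial m \<in> I" using Suc.prems by (simp add: h ac_simps)
      then have "f * ?h ^ k \<in> I" using regular_monomial[where I = I] reg unfolding regular_def by blast
      then show ?case by (rule Suc.IH)
    qed simp
    show "I = saturation mpoly_ring I ?h"
    proof
      show "I \<subseteq> saturation mpoly_ring I ?h"
      proof
        fix f assume "f \<in> I"
        then have "f * ?h ^ 1 \<in> I" by (rule is_ideal_mult'[OF ideal_I])
        then show "f \<in> saturation mpoly_ring I ?h" unfolding mem by blast
      qed
      show "saturation mpoly_ring I ?h \<subseteq> I" using cancel by (auto simp: mem)
    qed
  next
    assume sat: "I = saturation mpoly_ring I ?h"
    show regular
      unfolding regular_def
    proof (intro allI impI)
      fix i f assume f: "f * tvar i \<in> I"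
      have "?h = tvar i * (\<Prod>j\<in>UNIV - {i}. tvar j)" by (simp add: prod.remove)
      then have "f * ?h ^ 1 = f * tvar i * (\<Prod>j\<in>UNIV - {i}. tvar j)" by (simp add: mult.assoc)
      then have "f * ?h ^ 1 \<in> I" using is_ideal_mult'[OF ideal_I f] by simp
      then have "f \<in> saturation mpoly_ring I ?h" unfolding mem by blast
      then show "f \<in> I" using sat by simp
    qed
  }
qed

lemma regular_iff_regular_modulo: "regular \<longleftrightarrow> (\<forall>i. regular_modulo mpoly_ring I (tvar i))"
  using type_ring.regular_modulo_iff[OF ideal_I] by (simp add: regular_def)

lemma regular_iff_colon: "regular \<longleftrightarrow> I = colon_ideal mpoly_ring I (tvar x)"
proof
  assume regular
  then show "I = colon_ideal mpoly_ring I (tvar x)"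
    using is_ideal_mult'[OF ideal_I, of _ "tvar x"] by (auto simp: regular_def)
next
  assume "I = colon_ideal mpoly_ring I (tvar x)"
  then have "f * tvar x \<in> I \<Longrightarrow> f \<in> I" for f by (metis mem_colon_ideal_iff)
  then show regular by (rule regular_if_one_regular)
qed

subsection \<open>Unmixedness and the hull\<close>

text \<open>If \<open>irrelevant\<close> is not associated, each associated prime has
  \<open>s - 1\<close> steps below it and one more step up to \<open>irrelevant\<close>. Conversely,
  some associated prime lies inside \<open>base_prime\<close>, so its height is smaller than that of
  \<open>irrelevant\<close>.\<close>

lemma regular_iff_unmixed: "regular \<longleftrightarrow> unmixed mpoly_ring I"
proof
  assume reg: regular
  have "prime_height mpoly_ring P = enat (card (UNIV :: 'n set) - 1)"
    if P: "P \<in> associated_primes mpoly_ring I" for P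
  proof (rule antisym)
    note ass = associated_prime[OF P]
    have ne: "P \<noteq> irrelevant" using reg P regular_iff_not_associated by blast
    show "enat (card (UNIV :: 'n set) - 1) \<le> prime_height mpoly_ring P"
      by (rule prime_chain_le_height[OF prime_chain_below[OF ass(1,2) ne]])
    show "prime_height mpoly_ring P \<le> enat (card (UNIV :: 'n set) - 1)"
    proof (rule prime_height_le)
      fix n assume "prime_chain mpoly_ring n P"
      then have "prime_chain mpoly_ring (Suc n) (irrelevant :: ('n, 'k) mpoly set)"
        by (rule prime_chain_SucI[OF _ _ is_prime_irrelevant]) (use ass(3) ne in blast)
      then show "n \<le> card (UNIV :: 'n set) - 1" using prime_chain_length_le by fastforce
    qed
  qed
  then show "unmixed mpoly_ring I" by (simp add: unmixed_def)
next
  assume unm: "unmixed mpoly_ring I"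
  obtain g where g: "is_prime (colon_ideal mpoly_ring I g)" "colon_ideal mpoly_ring I g \<subseteq> base_prime"
    by (rule mpoly.exists_prime_colon_below[OF ideal_I base_prime(1,2)]) blast
  let ?Q = "colon_ideal mpoly_ring I g"
  have Q: "?Q \<in> associated_primes mpoly_ring I" using g(1) unfolding associated_primes_def by auto
  have sub: "?Q \<subset> irrelevant" using g(2) base_prime(3) by blast
  have "prime_height mpoly_ring ?Q < prime_height mpoly_ring (irrelevant :: ('n, 'k) mpoly set)"
    by (rule prime_height_strict_mono[OF height_le sub g(1) is_prime_irrelevant])
  then have "irrelevant \<notin> associated_primes mpoly_ring I"
    using unm[unfolded unmixed_def, rule_format, OF Q] by (metis order_less_irrefl)
  then show regular using regular_iff_not_associated by blast
qed

lemma minimal_prime_no_variable: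
  assumes "P \<in> minimal_primes mpoly_ring I"
  shows "tvar i \<notin> P"
proof
  assume "tvar i \<in> P"
  then have "P = irrelevant" using prime_with_variable assms by (auto simp: minimal_primes_def)
  then show False using assms base_prime(1-3) by (auto simp: minimal_primes_def)
qed

text \<open>In the regular case all components are isolated. Conversely, the radical of an isolated
  component contains no variable, so variables can be cancelled in each of these components.\<close>

lemma regular_iff_Hull: "regular \<longleftrightarrow> I = Hull mpoly_ring I"
proof
  assume reg: regular
  obtain D where D: "primary_decomposition mpoly_ring I D"
    using mpoly.exists_primary_decomposition[OF ideal_I] by blast
  have "D \<subseteq> isolated_primary_components mpoly_ring I"
  proof
    fix Q assume "Q \<in> D"
    then have "ideal_radical mpoly_ring Q \<in> minimal_primes mpoly_ring I"
      using associated_prime_minimal[OF reg mpoly.radical_component_associated[OF D _ ideal_I]] by blast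
    then show "Q \<in> isolated_primary_components mpoly_ring I"
      using D \<open>Q \<in> D\<close> unfolding isolated_primary_components_def by blast
  qed
  then have "Hull mpoly_ring I \<subseteq> \<Inter>D" by (auto simp: Hull_def)
  moreover have "\<Inter>D = I" using D by (simp add: primary_decomposition_def)
  moreover have "I \<subseteq> Hull mpoly_ring I"
    by (auto simp: Hull_def isolated_primary_components_def primary_decomposition_def)
  ultimately show "I = Hull mpoly_ring I" by blast
next
  assume hull: "I = Hull mpoly_ring I"
  show regular
    unfolding regular_def
  proof (intro allI impI)
    fix i f assume f: "f * tvar i \<in> I"
    have "f \<in> Q" if Q: "Q \<in> isolated_primary_components mpoly_ring I" for Q
    proof -
      have prim: "primary_ideal mpoly_ring Q" and min: "ideal_radical mpoly_ring Q \<in> minimal_primes mpoly_ring I"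
        using Q by (auto simp: isolated_primary_components_def primary_decomposition_def)
      have "f * tvar i \<in> Q" using f Q hull unfolding Hull_def by blast
      then have "f \<in> Q \<or> tvar i \<in> ideal_radical mpoly_ring Q"
        using prim by (auto simp: primary_ideal_def ideal_radical_def)
      then show ?thesis using minimal_prime_no_variable[OF min] by blast
    qed
    then have "f \<in> Hull mpoly_ring I" by (simp add: Hull_def)
    then show "f \<in> I" using hull by simp
  qed
qed

subsection \<open>The Cohen-Macaulay property\<close>

lemma cring_quotient: "cring quotient_ring"
  by (rule ideal.quotient_is_cring[OF ideal_I type_ring.is_cring])

lemma noetherian_quotient: "noetherian_cring quotient_ring"
  by (intro noetherian_cring.intro cring_quotient type_ring.noetherian_Quot[OF ideal_I noetherian_mpoly])

text \<open>The first entry of a regular sequence is tested modulo the ideal generated by the empty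
  set, which explains this form of the zero ideal.\<close>

lemma regular_modulo_zero_quotient_iff:
  "regular_modulo quotient_ring (Idl\<^bsub>quotient_ring\<^esub> {}) (I +>\<^bsub>mpoly_ring\<^esub> f) \<longleftrightarrow> (\<forall>g. g * f \<in> I \<longrightarrow> g \<in> I)"
proof -
  interpret Q: cring quotient_ring by (rule cring_quotient)
  interpret I: ideal I mpoly_ring by (rule ideal_I)
  have f: "I +>\<^bsub>mpoly_ring\<^esub> f \<in> carrier quotient_ring" by (rule I.rcos_in_carrier_Quot) simp
  have zero: "(I +>\<^bsub>mpoly_ring\<^esub> g) \<otimes>\<^bsub>quotient_ring\<^esub> (I +>\<^bsub>mpoly_ring\<^esub> f) = I \<longleftrightarrow> g * f \<in> I" for g
    using I.mult_Quot[of g f] I.rcos_eq_ideal_iff[of "g * f"] by simp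
  show ?thesis
    unfolding Q.genideal_empty Q.regular_modulo_iff[OF Q.zeroideal f]
    by (simp add: I.carrier_Quot I.zero_Quot zero I.rcos_eq_ideal_iff)
qed

lemma image_strict:
  assumes "is_prime P" "is_prime P'" "I \<subseteq> P" "P \<subset> P'"
  shows "(+>\<^bsub>mpoly_ring\<^esub>) I ` P \<subset> (+>\<^bsub>mpoly_ring\<^esub>) I ` P'"
proof -
  obtain f where f: "f \<in> P'" "f \<notin> P" using assms(4) by blast
  then have "I +>\<^bsub>mpoly_ring\<^esub> f \<notin> (+>\<^bsub>mpoly_ring\<^esub>) I ` P"
    using type_ring.rcos_mem_image_iff[OF ideal_I is_prime_ideal[OF assms(1)] assms(3), of f] by simp
  then show ?thesis using f(1) assms(4) by blast
qed

lemma quotient_chain_le_1: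
  assumes "prime_chain quotient_ring n M"
  shows "n \<le> 1"
proof (rule ccontr)
  assume "\<not> n \<le> 1"
  then have "n = Suc (Suc (n - 2))" by simp
  then obtain k where n: "n = Suc (Suc k)" by blast
  obtain p where p: "\<And>i. i \<le> n \<Longrightarrow> primeideal (p i) quotient_ring" "\<And>i. i < n \<Longrightarrow> p i \<subset> p (Suc i)"
    using assms by (auto simp: prime_chain_def)
  define v where "v i = {f \<in> carrier mpoly_ring. I +>\<^bsub>mpoly_ring\<^esub> f \<in> p i}" for i
  have prime: "is_prime (v i)" if "i \<le> n" for i
    unfolding v_def by (rule type_ring.primeideal_Quot_vimage[OF ideal_I p(1)[OF that]])
  have sub: "I \<subseteq> v k"
    unfolding v_def by (rule type_ring.ideal_subset_Quot_vimage[OF ideal_I primeideal.axioms(1)[OF p(1)]]) (simp add: n)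
  have strict: "v i \<subset> v (Suc i)" if i: "i < n" for i
  proof -
    obtain y where y: "y \<in> p (Suc i)" "y \<notin> p i" using p(2)[OF i] by blast
    have "y \<in> carrier quotient_ring"
      by (rule ideal.Icarr[OF primeideal.axioms(1)[OF p(1)] y(1)]) (use i in simp)
    then obtain f where "y = I +>\<^bsub>mpoly_ring\<^esub> f" unfolding ideal.carrier_Quot[OF ideal_I] by blast
    then have "f \<in> v (Suc i)" "f \<notin> v i" using y by (simp_all add: v_def)
    moreover have "v i \<subseteq> v (Suc i)" using p(2)[OF i] unfolding v_def by blast
    ultimately show ?thesis by blast
  qed
  \<comment> \<open>The last three primes of the chain are pulled back.\<close>
  show False
    by (rule no_long_chain[of "v k" "v (Suc k)" "v (Suc (Suc k))"]) (simp_all add: prime sub strict n)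
qed

lemma irrelevant_image_maximal: "maximalideal ((+>\<^bsub>mpoly_ring\<^esub>) I ` irrelevant) quotient_ring"
proof -
  note irr = is_prime_ideal[OF is_prime_irrelevant]
  interpret h: ring_hom_ring "mpoly_ring :: ('n, 'k) mpoly ring" quotient_ring "(+>\<^bsub>mpoly_ring\<^esub>) I"
    by (rule ideal.rcos_ring_hom_ring[OF ideal_I])
  have prime: "primeideal ((+>\<^bsub>mpoly_ring\<^esub>) I ` irrelevant) quotient_ring"
    by (rule type_ring.primeideal_Quot_image[OF ideal_I is_prime_irrelevant subset_irrelevant])
  show ?thesis
  proof (rule maximalidealI)
    show "ideal ((+>\<^bsub>mpoly_ring\<^esub>) I ` irrelevant) quotient_ring" by (rule primeideal.axioms(1)[OF prime])
    show "carrier quotient_ring \<noteq> (+>\<^bsub>mpoly_ring\<^esub>) I ` irrelevant" by (rule primeideal.I_notcarr[OF prime])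
  next
    fix J assume J: "ideal J quotient_ring" "(+>\<^bsub>mpoly_ring\<^esub>) I ` irrelevant \<subseteq> J" "J \<subseteq> carrier quotient_ring"
    define V where "V = {f \<in> carrier mpoly_ring. I +>\<^bsub>mpoly_ring\<^esub> f \<in> J}"
    have V: "is_ideal V" unfolding V_def by (rule h.ideal_vimage[OF J(1)])
    have JV: "J = (+>\<^bsub>mpoly_ring\<^esub>) I ` V"
      using J(3) unfolding V_def ideal.carrier_Quot[OF ideal_I] by auto
    have "irrelevant \<subseteq> V" using J(2) by (auto simp: V_def)
    then consider "V = irrelevant" | "V = UNIV"
      using irrelevant_maximal[OF V] is_ideal_one[OF V] by blast
    then show "J = (+>\<^bsub>mpoly_ring\<^esub>) I ` irrelevant \<or> J = carrier quotient_ring"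
      by cases (simp_all add: JV ideal.carrier_Quot[OF ideal_I])
  qed
qed

text \<open>The third assumption is what preimages of maximal ideals satisfy, graded or not. For
  \<open>N = irrelevant\<close> the smaller prime is \<open>base_prime\<close>; otherwise it is the
  graded core, which lies inside \<open>irrelevant\<close> and therefore differs from
  \<open>N\<close>.\<close>

lemma exists_smaller_prime:
  assumes N: "is_prime N" "I \<subseteq> N" "\<not> N \<subset> irrelevant"
  obtains N\<^sub>0 where "is_prime N\<^sub>0" "I \<subseteq> N\<^sub>0" "N\<^sub>0 \<subset> N"
proof (cases "N = irrelevant")
  case True
  then show ?thesis using that base_prime(1-3) by blast
next
  case False
  note Ni = is_prime_ideal[OF N(1)] and C = is_prime_wcore[OF N(1), of d]
  have "wcore d N \<subseteq> irrelevant"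
    by (rule wgraded_subset_irrelevant[where d = d, OF d_pos is_prime_ideal[OF C] is_prime_one[OF C] wgraded_wcore[OF Ni]])
  then have "wcore d N \<noteq> N" using False N(3) by blast
  then show ?thesis using that[OF C subset_wcore[OF graded N(2)]] wcore_subset[OF Ni, of d] by blast
qed

text \<open>The radicals of the primary components are associated primes, which in the regular case
  are minimal over \<open>I\<close>, hence incomparable, and cannot contain \<open>N\<close> because
  of the smaller prime \<open>N\<^sub>0\<close>. An element of \<open>N\<close> outside all of them
  can be cancelled in each component.\<close>

lemma exists_regular_element:
  assumes reg: regular and N: "is_prime N" "I \<subseteq> N" "\<not> N \<subset> irrelevant"
  shows "\<exists>f\<in>N. \<forall>g. g * f \<in> I \<longrightarrow> g \<in> I"
proof -
  obtain N\<^sub>0 where N0: "is_prime N\<^sub>0" "I \<subseteq> N\<^sub>0" "N\<^sub>0 \<subset> N" using exists_smaller_prime[OF N] by blast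
  obtain D where D: "primary_decomposition mpoly_ring I D"
    using mpoly.exists_primary_decomposition[OF ideal_I] by blast
  let ?F = "ideal_radical mpoly_ring ` D"
  have F: "P \<in> associated_primes mpoly_ring I" if "P \<in> ?F" for P
    using that mpoly.radical_component_associated[OF D _ ideal_I] by blast
  have "\<exists>f\<in>N. \<forall>P\<in>?F. f \<notin> P"
  proof (rule type_ring.prime_avoidance)
    show "finite ?F" using D by (simp add: primary_decomposition_def)
    show "is_prime P" if "P \<in> ?F" for P by (rule associated_prime(1)[OF F[OF that]])
    show "is_ideal N" by (rule is_prime_ideal[OF N(1)])
    show "P = P'" if "P \<in> ?F" "P' \<in> ?F" "P \<subseteq> P'" for P P'
      by (rule associated_prime_no_smaller[OF reg F[OF that(2)] associated_prime(1,2)[OF F[OF that(1)]] that(3)])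
    show "\<not> N \<subseteq> P" if "P \<in> ?F" for P
    proof
      assume "N \<subseteq> P"
      then have "N\<^sub>0 \<subseteq> P" using N0(3) by blast
      then have "N\<^sub>0 = P" by (rule associated_prime_no_smaller[OF reg F[OF that] N0(1,2)])
      then show False using N0(3) \<open>N \<subseteq> P\<close> by blast
    qed
  qed
  then obtain f where f: "f \<in> N" "\<And>Q. Q \<in> D \<Longrightarrow> f \<notin> ideal_radical mpoly_ring Q" by blast
  have "g \<in> I" if g: "g * f \<in> I" for g
  proof -
    have "g \<in> Q" if Q: "Q \<in> D" for Q
    proof -
      have "primary_ideal mpoly_ring Q" "g * f \<in> Q" using D Q g by (auto simp: primary_decomposition_def)
      then show ?thesis using f(2)[OF Q] by (auto simp: primary_ideal_def ideal_radical_def)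
    qed
    then show ?thesis using D by (auto simp: primary_decomposition_def)
  qed
  then show ?thesis using f(1) by blast
qed

lemma height_quotient_maximal_ge_1:
  assumes "is_prime N\<^sub>0" "is_prime N" "I \<subseteq> N\<^sub>0" "N\<^sub>0 \<subset> N"
  shows "enat 1 \<le> prime_height quotient_ring ((+>\<^bsub>mpoly_ring\<^esub>) I ` N)"
proof -
  have "primeideal ((+>\<^bsub>mpoly_ring\<^esub>) I ` N\<^sub>0) quotient_ring" "primeideal ((+>\<^bsub>mpoly_ring\<^esub>) I ` N) quotient_ring"
    using type_ring.primeideal_Quot_image[OF ideal_I] assms by blast+
  then have "prime_chain quotient_ring (Suc 0) ((+>\<^bsub>mpoly_ring\<^esub>) I ` N)"
    by (intro prime_chain_SucI[OF prime_chain_0 image_strict]) (use assms in auto)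
  then show ?thesis using prime_chain_le_height by fastforce
qed

text \<open>Every maximal ideal of the quotient has height exactly 1 and contains a regular element,
  so its depth is squeezed to 1.\<close>

lemma regular_imp_Cohen_Macaulay:
  assumes reg: regular
  shows "Cohen_Macaulay_ring quotient_ring"
  unfolding Cohen_Macaulay_ring_def
proof (intro conjI allI impI)
  interpret Q: noetherian_cring quotient_ring by (rule noetherian_quotient)
  show "cring quotient_ring" "noetherian_ring quotient_ring" by unfold_locales
  fix M assume M: "maximalideal M quotient_ring"
  have Mp: "primeideal M quotient_ring" by (rule Q.maximalideal_prime[OF M])
  note Mi = primeideal.axioms(1)[OF Mp]
  define N where "N = {f \<in> carrier mpoly_ring. I +>\<^bsub>mpoly_ring\<^esub> f \<in> M}"
  have N: "is_prime N" unfolding N_def by (rule type_ring.primeideal_Quot_vimage[OF ideal_I Mp])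
  have IN: "I \<subseteq> N" unfolding N_def by (rule type_ring.ideal_subset_Quot_vimage[OF ideal_I Mi])
  have MN: "M = (+>\<^bsub>mpoly_ring\<^esub>) I ` N"
    using additive_subgroup.a_subset[OF ideal.axioms(1)[OF Mi]]
    unfolding N_def ideal.carrier_Quot[OF ideal_I] by auto
  \<comment> \<open>The image of \<open>irrelevant\<close> would be a proper ideal strictly above
    the maximal ideal \<open>M\<close>.\<close>
  have max: "\<not> N \<subset> irrelevant"
  proof
    assume "N \<subset> irrelevant"
    from image_strict[OF N is_prime_irrelevant IN this]
    have "M \<subset> (+>\<^bsub>mpoly_ring\<^esub>) I ` irrelevant" by (simp add: MN)
    moreover note irr = irrelevant_image_maximal
    ultimately have "(+>\<^bsub>mpoly_ring\<^esub>) I ` irrelevant = carrier quotient_ring"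
      using maximalideal.I_maximal[OF M maximalideal.axioms(1)[OF irr]]
        additive_subgroup.a_subset[OF ideal.axioms(1)[OF maximalideal.axioms(1)[OF irr]]] by blast
    then show False using maximalideal.I_notcarr[OF irr] by simp
  qed
  obtain N\<^sub>0 where N0: "is_prime N\<^sub>0" "I \<subseteq> N\<^sub>0" "N\<^sub>0 \<subset> N" using exists_smaller_prime[OF N IN max] by blast
  have h_ge: "enat 1 \<le> prime_height quotient_ring M"
    unfolding MN by (rule height_quotient_maximal_ge_1[OF N0(1) N N0(2,3)])
  have h_le: "prime_height quotient_ring M \<le> enat 1" by (rule prime_height_le) (rule quotient_chain_le_1)
  obtain f where f: "f \<in> N" "\<forall>g. g * f \<in> I \<longrightarrow> g \<in> I" using exists_regular_element[OF reg N IN max] by blast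
  let ?x = "I +>\<^bsub>mpoly_ring\<^esub> f"
  have xM: "?x \<in> M" using f(1) by (simp add: N_def)
  have "Idl\<^bsub>quotient_ring\<^esub> {?x} \<subseteq> M" by (rule Q.genideal_minimal[OF Mi]) (simp add: xM)
  then have "Idl\<^bsub>quotient_ring\<^esub> {?x} \<noteq> carrier quotient_ring"
    using maximalideal.I_notcarr[OF M] additive_subgroup.a_subset[OF ideal.axioms(1)[OF Mi]] by blast
  then have "regular_sequence quotient_ring [?x]"
    using f(2) regular_modulo_zero_quotient_iff[of f] ideal.Icarr[OF Mi xM]
    by (simp add: regular_sequence_def)
  then have "enat 1 \<le> ideal_depth quotient_ring M"
    unfolding ideal_depth_def by (intro Sup_upper) (use xM in \<open>auto intro!: exI[of _ "[?x]"]\<close>)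
  then show "ideal_depth quotient_ring M = prime_height quotient_ring M"
    using Q.ideal_depth_le_height[OF Mp] h_le h_ge by (meson antisym order_trans)
qed

text \<open>The image of \<open>irrelevant\<close> has height at least 1 because of
  \<open>base_prime\<close>, so its depth provides a regular element in it. If
  \<open>irrelevant = (I : g)\<close>, however, all its elements kill the nonzero class of
  \<open>g\<close>.\<close>

lemma Cohen_Macaulay_imp_regular:
  assumes CM: "Cohen_Macaulay_ring quotient_ring"
  shows regular
proof (rule ccontr)
  assume "\<not> regular"
  then have "irrelevant \<in> associated_primes mpoly_ring I" using regular_iff_not_associated by blast
  then obtain g where g: "irrelevant = colon_ideal mpoly_ring I g" by (auto simp: associated_primes_def)
  have "(1 :: ('n, 'k) mpoly) \<notin> irrelevant" by (rule is_prime_one[OF is_prime_irrelevant])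
  then have gI: "g \<notin> I" unfolding g by simp
  let ?M = "(+>\<^bsub>mpoly_ring\<^esub>) I ` irrelevant"
  have "enat 1 \<le> prime_height quotient_ring ?M"
    by (rule height_quotient_maximal_ge_1[OF base_prime(1) is_prime_irrelevant base_prime(2,3)])
  then have "enat 1 \<le> ideal_depth quotient_ring ?M"
    using CM irrelevant_image_maximal by (simp add: Cohen_Macaulay_ring_def)
  then have "\<not> ideal_depth quotient_ring ?M \<le> enat 0" by (metis enat_ord_simps(1) not_one_le_zero order_trans)
  then have "\<exists>xs. regular_sequence quotient_ring xs \<and> set xs \<subseteq> ?M \<and> xs \<noteq> []"
  proof (rule contrapos_np)
    assume "\<nexists>xs. regular_sequence quotient_ring xs \<and> set xs \<subseteq> ?M \<and> xs \<noteq> []"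
    then show "ideal_depth quotient_ring ?M \<le> enat 0"
      unfolding ideal_depth_def by (intro Sup_least) auto
  qed
  then obtain xs where xs: "regular_sequence quotient_ring xs" "set xs \<subseteq> ?M" "xs \<noteq> []" by blast
  then have "xs ! 0 \<in> ?M" by (simp add: subset_iff)
  then obtain f where f: "f \<in> irrelevant" "xs ! 0 = I +>\<^bsub>mpoly_ring\<^esub> f" by blast
  have "regular_modulo quotient_ring (Idl\<^bsub>quotient_ring\<^esub> {}) (xs ! 0)"
    using xs(1,3) by (auto simp: regular_sequence_def)
  then have "\<forall>g. g * f \<in> I \<longrightarrow> g \<in> I" unfolding f(2) regular_modulo_zero_quotient_iff .
  moreover have "g * f \<in> I" using f(1) unfolding g by (simp add: mult.commute)
  ultimately show False using gI by blast
qed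

end

section \<open>Equivalence of the seven conditions\<close>

theorem proposition5p3:
  fixes I :: "('n::finite, 'k::field) mpoly set"
    and i\<^sub>1 :: 'n
  assumes "binomial_ideal I"
    and "graded_ideal I"
    and "\<And>i. zero_set (Idl\<^bsub>mpoly_ring\<^esub> (I \<union> {tvar i})) = {\<lambda>_. 0}"
  shows "(lattice_ideal I \<longleftrightarrow> I = saturation mpoly_ring I (\<Prod>i\<in>UNIV. tvar i)) \<and>
    (lattice_ideal I \<longleftrightarrow> (\<forall>i. regular_modulo mpoly_ring I (tvar i))) \<and>
    (lattice_ideal I \<longleftrightarrow> I = colon_ideal mpoly_ring I (tvar i\<^sub>1)) \<and>
    (lattice_ideal I \<longleftrightarrow> Cohen_Macaulay_ring (mpoly_ring Quot I)) \<and>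
    (lattice_ideal I \<longleftrightarrow> unmixed mpoly_ring I) \<and>
    (lattice_ideal I \<longleftrightarrow> I = Hull mpoly_ring I)"
proof -
  obtain d where "\<forall>i. d i > 0" "wgraded d I" using graded_ideal_wgraded[OF assms(2)] by blast
  then interpret graded_binomial I d using assms(1,3) by unfold_locales auto
  show ?thesis
    unfolding regular_iff_lattice[symmetric]
    by (intro conjI regular_iff_saturation regular_iff_regular_modulo regular_iff_colon
        regular_iff_unmixed regular_iff_Hull iffI[OF regular_imp_Cohen_Macaulay Cohen_Macaulay_imp_regular])
qed

end
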